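(* Let $R=\{r(k,n): k,n\in\mathbb{Z},\ 3\le k\le n\}$ be the set of non-trivial Ramsey numbers, and for real $x\ge 0$ let $D(x)=\#\big(R\cap[0,x]\big)$ (each value counted once, ignoring multiplicity). Then $D(x)=\Theta\big(\sqrt{x\ln x}\,\big)$ as $x\to\infty$; that is, there exist constants $0<C_1\le C_2$ and $X_0$ such that $C_1\sqrt{x\ln x}\le D(x)\le C_2\sqrt{x\ln x}$ for all $x\ge X_0$.
   Context: For positive integers $k,l$, the Ramsey number $r(k,l)$ is the least positive integer $N$ such that every graph on $N$ vertices contains a clique on $k$ vertices or an independent set on $l$ vertices. *)

theory Defs
  imports Complex_Main "HOL-Library.Ramsey" "HOL-Library.Landau_Symbols"
begin

text \<open>A finite simple graph is a finite vertex set \<open>V\<close> together with a set \<open>E\<close> of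
  two-element subsets of \<open>V\<close>.  Taking the vertices among the natural numbers loses no
  generality, as every finite graph is isomorphic to one of this kind.\<close>

definition ramsey_arrow :: "nat \<Rightarrow> nat \<Rightarrow> nat \<Rightarrow> bool" where
  "ramsey_arrow N k l \<longleftrightarrow>
     (\<forall>(V :: nat set) E. finite V \<and> card V = N \<and> E \<subseteq> [V]\<^bsup>2\<^esup> \<longrightarrow>
        (\<exists>W \<subseteq> V. card W = k \<and> clique W E) \<or> (\<exists>W \<subseteq> V. card W = l \<and> indep W E))"

definition ramsey_number :: "nat \<Rightarrow> nat \<Rightarrow> nat" where
  "ramsey_number k l = (LEAST N. 0 < N \<and> ramsey_arrow N k l)"

text \<open>Ramsey's theorem: the minimum is taken over a nonempty set.\<close>

lemma ramsey_arrow_exists: "\<exists>N>0. ramsey_arrow N k l"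
proof -
  obtain r where r: "r \<ge> 1"
    "\<And>(V :: nat set) E. finite V \<and> card V \<ge> r \<Longrightarrow>
       \<exists>R \<subseteq> V. card R = k \<and> clique R E \<or> card R = l \<and> indep R E"
    using ramsey2[where 'a = nat, of k l] by blast
  have "ramsey_arrow r k l"
    unfolding ramsey_arrow_def using r(2) by (metis order_refl)
  with r(1) show ?thesis by (intro exI[of _ r]) auto
qed

definition nontrivial_ramsey_numbers :: "nat set" where
  "nontrivial_ramsey_numbers = {ramsey_number k n | k n. 3 \<le> k \<and> k \<le> n}"

definition ramsey_count :: "real \<Rightarrow> nat" where
  "ramsey_count x = card (real ` nontrivial_ramsey_numbers \<inter> {0..x})"

end

theory Submission
  imports Defs "HOL-Real_Asymp.Real_Asymp"
begin

text \<open>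
  Everything reduces to \<open>r(3,n) = \<Theta>(n\<^sup>2 / ln n)\<close>: the numbers \<open>r(3,n)\<close> are strictly increasing in
  \<open>n\<close>, and the pairs \<open>4 \<le> k \<le> n\<close> contribute only \<open>o(\<surd>x)\<close> values, because \<open>r(4,n)\<close> grows faster than
  \<open>n\<close> to the power \<open>2.1\<close> (local lemma) and \<open>r(k,k)\<close> grows exponentially.

  The upper bound on \<open>r(3,n)\<close> is the argument of Shearer and Alon: the average size of an independent set
  of a triangle-free graph is large.

  The lower bound uses two overlaid blow-ups instead of a nibble.  Map about \<open>M log M\<close> vertices to
  \<open>{..<M}\<close> in two ways \<open>\<phi>\<^sub>1, \<phi>\<^sub>2\<close> and pull back two independent random graphs \<open>G\<^sub>1, G\<^sub>2\<close> of
  density \<open>p = \<epsilon> / \<surd>M\<close>.  Delete a \<open>G\<^sub>1\<close>-edge that closes a path of length two in \<open>G\<^sub>2\<close>, or that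
  closes a path of length two in \<open>G\<^sub>1\<close> through a vertex larger than both its ends, and symmetrically for
  \<open>G\<^sub>2\<close>.  Two edges of any triangle have the same colour, so no triangle survives.
  As \<open>M p\<^sup>2 = \<epsilon>\<^sup>2\<close> is small, only a small part of the pairs of a large set is closed in this way.
  Since \<open>\<phi>\<^sub>1, \<phi>\<^sub>2\<close> are the two ends of the edges of a locally sparse bipartite graph, any large vertex set
  contains a large subset on which one of them is injective.  On such a subset, exposing
  the pairs from the largest vertex downwards decides whether a pair is open before the pair is exposed;
  so with overwhelming probability some open pair becomes an edge.
\<close>

section \<open>Ramsey numbers and triangle-free graphs\<close>

text \<open>The union bound fixes the scale. There are at most \<open>exp (c * s * log M)\<close>
  vertex sets of size \<open>s\<close>, and such a set misses all of its order \<open>s^2\<close>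
  open pairs with probability about \<open>exp (- c' * p * s^2)\<close>; so \<open>s\<close> must be
  of order \<open>log M / p\<close>, that is \<open>sqrt M * log M\<close>. On \<open>M\<close>
  vertices this would give only a lower bound of order \<open>n^2 / (log n)^2\<close> for r(3,n).
  The missing factor \<open>log M\<close> comes from using \<open>M * log M\<close> vertices with
  \<open>s\<close> of the same order. One blow-up cannot do this, since the full preimage of an
  independent set is independent; the second map breaks up the fibres of the first. A triangle
  inside one colour has to lose only one edge, so it suffices to delete the edge opposite to its
  largest vertex. If smaller vertices could close a pair too, its openness would depend on pairs
  exposed later. The delicate estimate is that a set has few closed pairs. Their number is bounded
  by a sum of squared degrees, whose upper tail is governed by rare large terms. So degrees above a
  threshold \<open>D\<close> are handled deterministically, through codegrees, and only the
  truncated squares by exponential moments.\<close>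

lemma not_ramsey_arrowI:
  fixes adj :: "'a \<Rightarrow> 'a \<Rightarrow> bool"
  assumes fin: "finite V" and card: "card V = N"
    and sym: "\<And>x y. adj x y \<Longrightarrow> adj y x"
    and noclique: "\<And>W. W \<subseteq> V \<Longrightarrow> card W = k \<Longrightarrow> \<exists>x\<in>W. \<exists>y\<in>W. x \<noteq> y \<and> \<not> adj x y"
    and noindep: "\<And>W. W \<subseteq> V \<Longrightarrow> card W = l \<Longrightarrow> \<exists>x\<in>W. \<exists>y\<in>W. x \<noteq> y \<and> adj x y"
  shows "\<not> ramsey_arrow N k l"
proof
  assume A: "ramsey_arrow N k l"
  obtain g where g: "bij_betw g {0..<N} V"
    using ex_bij_betw_nat_finite[OF fin] unfolding card by blast
  define E where "E = {{i,j} | i j. i < N \<and> j < N \<and> i \<noteq> j \<and> adj (g i) (g j)}"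
  have E: "E \<subseteq> [{0..<N}]\<^bsup>2\<^esup>"
    by (auto simp: E_def nsets_def card_insert_if)
  have E_iff: "{i,j} \<in> E \<longleftrightarrow> adj (g i) (g j)" if "i < N" "j < N" "i \<noteq> j" for i j
    using that sym by (auto simp: E_def doubleton_eq_iff)
  have inj: "inj_on g W" and sub: "g ` W \<subseteq> V" if "W \<subseteq> {0..<N}" for W
    using g that by (auto simp: bij_betw_def intro: inj_on_subset)
  from A E have "(\<exists>W\<subseteq>{0..<N}. card W = k \<and> clique W E) \<or> (\<exists>W\<subseteq>{0..<N}. card W = l \<and> indep W E)"
    unfolding ramsey_arrow_def by (metis card_atLeastLessThan diff_zero finite_atLeastLessThan)
  then show False
  proof (elim disjE exE conjE)
    fix W assume W: "W \<subseteq> {0..<N}" "card W = k" "clique W E"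
    from noclique[OF sub[OF W(1)]] card_image[OF inj[OF W(1)]] W(2)
    obtain i j where "i \<in> W" "j \<in> W" "g i \<noteq> g j" "\<not> adj (g i) (g j)" by auto
    with W E_iff[of i j] show False by (auto simp: clique_def subset_iff)
  next
    fix W assume W: "W \<subseteq> {0..<N}" "card W = l" "indep W E"
    from noindep[OF sub[OF W(1)]] card_image[OF inj[OF W(1)]] W(2)
    obtain i j where "i \<in> W" "j \<in> W" "g i \<noteq> g j" "adj (g i) (g j)" by auto
    with W E_iff[of i j] show False by (auto simp: indep_def subset_iff)
  qed
qed

lemma not_ramsey_arrowE:
  assumes "\<not> ramsey_arrow N k l"
  obtains V :: "nat set" and E where "finite V" "card V = N" "E \<subseteq> [V]\<^bsup>2\<^esup>"
    "\<And>W. W \<subseteq> V \<Longrightarrow> card W = k \<Longrightarrow> \<not> clique W E"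
    "\<And>W. W \<subseteq> V \<Longrightarrow> card W = l \<Longrightarrow> \<not> indep W E"
  using assms unfolding ramsey_arrow_def by blast

lemma ramsey_arrow_mono:
  assumes A: "ramsey_arrow N k l" and le: "N \<le> N'" "k' \<le> k" "l' \<le> l"
  shows "ramsey_arrow N' k' l'"
  unfolding ramsey_arrow_def
proof (intro allI impI, elim conjE)
  fix V :: "nat set" and E assume V: "finite V" "card V = N'" "E \<subseteq> [V]\<^bsup>2\<^esup>"
  obtain U where U: "U \<subseteq> V" "card U = N" using V le by (metis obtain_subset_with_card_n)
  then have "finite U" using V finite_subset by blast
  with A U have "(\<exists>W\<subseteq>U. card W = k \<and> clique W (E \<inter> [U]\<^bsup>2\<^esup>)) \<or> (\<exists>W\<subseteq>U. card W = l \<and> indep W (E \<inter> [U]\<^bsup>2\<^esup>))"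
    unfolding ramsey_arrow_def by (metis inf_le2)
  then show "(\<exists>W\<subseteq>V. card W = k' \<and> clique W E) \<or> (\<exists>W\<subseteq>V. card W = l' \<and> indep W E)"
  proof (elim disjE exE conjE)
    fix W assume W: "W \<subseteq> U" "card W = k" "clique W (E \<inter> [U]\<^bsup>2\<^esup>)"
    obtain X where "X \<subseteq> W" "card X = k'" using W le by (metis obtain_subset_with_card_n)
    with W U show ?thesis by (intro disjI1 exI[of _ X]) (auto simp: clique_def subset_iff)
  next
    fix W assume W: "W \<subseteq> U" "card W = l" "indep W (E \<inter> [U]\<^bsup>2\<^esup>)"
    obtain X where X: "X \<subseteq> W" "card X = l'" using W le by (metis obtain_subset_with_card_n)
    have "indep W E"
      using W by (auto simp: indep_def nsets_def card_insert_if subset_iff)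
    with X W U show ?thesis by (intro disjI2 exI[of _ X]) (auto simp: indep_def subset_iff)
  qed
qed

lemma ramsey_number_pos: "0 < ramsey_number k l"
  and ramsey_arrow_ramsey_number: "ramsey_arrow (ramsey_number k l) k l"
  using LeastI_ex[OF ramsey_arrow_exists[of k l]] unfolding ramsey_number_def by auto

lemma ramsey_number_le: "0 < N \<Longrightarrow> ramsey_arrow N k l \<Longrightarrow> ramsey_number k l \<le> N"
  unfolding ramsey_number_def by (rule Least_le) auto

lemma less_ramsey_numberI: "\<not> ramsey_arrow N k l \<Longrightarrow> N < ramsey_number k l"
  using ramsey_arrow_mono[OF ramsey_arrow_ramsey_number[of k l], of N k l] by force

lemma ramsey_number_mono: "k \<le> k' \<Longrightarrow> l \<le> l' \<Longrightarrow> ramsey_number k l \<le> ramsey_number k' l'"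
  by (meson le_refl ramsey_arrow_mono ramsey_arrow_ramsey_number ramsey_number_le ramsey_number_pos)

lemma not_ramsey_arrow_pred:
  assumes "0 < k" "0 < l"
  shows "\<not> ramsey_arrow (ramsey_number k l - 1) k l"
proof (cases "ramsey_number k l = 1")
  case True
  \<comment> \<open>The minimum is over positive \<open>N\<close>, so for value 1 minimality says
    nothing about the predecessor 0; the empty graph refutes it directly.\<close>
  have "\<not> ramsey_arrow 0 k l" unfolding ramsey_arrow_def using assms by (auto intro!: exI[of _ "{}"])
  with True show ?thesis by simp
next
  case False
  with ramsey_number_pos[of k l] show ?thesis
    using ramsey_number_le[of "ramsey_number k l - 1" k l] by linarith
qed

text \<open>An isolated vertex added to an extremal graph for \<open>(k,l)\<close> enlarges
  independent sets by at most one and lies in no clique of size \<open>k \<ge> 2\<close>.\<close>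

lemma ramsey_number_less_Suc:
  assumes "2 \<le> k" "0 < l"
  shows "ramsey_number k l < ramsey_number k (Suc l)"
proof -
  have "\<not> ramsey_arrow (ramsey_number k l - 1) k l" using assms by (intro not_ramsey_arrow_pred) auto
  then obtain V :: "nat set" and E where V: "finite V" "card V = ramsey_number k l - 1" "E \<subseteq> [V]\<^bsup>2\<^esup>"
    and nc: "\<And>W. W \<subseteq> V \<Longrightarrow> card W = k \<Longrightarrow> \<not> clique W E"
    and ni: "\<And>W. W \<subseteq> V \<Longrightarrow> card W = l \<Longrightarrow> \<not> indep W E" by (rule not_ramsey_arrowE) blast
  obtain v where v: "v \<notin> V" using V(1) ex_new_if_finite infinite_UNIV_nat by blast
  have "\<not> ramsey_arrow (ramsey_number k l) k (Suc l)"
  proof (rule not_ramsey_arrowI[where V = "insert v V" and adj = "\<lambda>x y. {x,y} \<in> E"])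
    show "card (insert v V) = ramsey_number k l"
      using V v ramsey_number_pos[of k l] by simp
  next
    fix W assume W: "W \<subseteq> insert v V" "card W = k"
    show "\<exists>x\<in>W. \<exists>y\<in>W. x \<noteq> y \<and> {x, y} \<notin> E"
    proof (cases "v \<in> W")
      case True
      have "W \<noteq> {v}" using W assms by auto
      then obtain x where x: "x \<in> W" "x \<noteq> v" using True by auto
      have "{v,x} \<notin> E" using V(3) v by (auto simp: nsets_def)
      then show ?thesis using True x by (intro bexI[of _ v] bexI[of _ x]) auto
    next
      case False
      then have "\<not> clique W E" using nc[of W] W by blast
      then show ?thesis unfolding clique_def by blast
    qed
  next
    fix W assume W: "W \<subseteq> insert v V" "card W = Suc l"
    have "l \<le> card (W - {v})" using W by (simp add: card_Diff_singleton_if)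
    then obtain X where X: "X \<subseteq> W - {v}" "card X = l" by (metis obtain_subset_with_card_n)
    then have "\<not> indep X E" using ni[of X] W by auto
    then show "\<exists>x\<in>W. \<exists>y\<in>W. x \<noteq> y \<and> {x, y} \<in> E" using X(1) unfolding indep_def by blast
  qed (use V in \<open>auto simp: insert_commute\<close>)
  then show ?thesis by (rule less_ramsey_numberI)
qed

section \<open>Independent sets of triangle-free graphs: the upper bound on r(3,n)\<close>

lemma indep_Un_iff:
  "indep (A \<union> B) E \<longleftrightarrow> indep A E \<and> indep B E \<and> (\<forall>a\<in>A. \<forall>b\<in>B. a \<noteq> b \<longrightarrow> {a,b} \<notin> E)"
  by (auto simp: indep_def) (metis insert_commute)

lemma sum_card_Pow:
  assumes "finite A"
  shows "2 * (\<Sum>Y\<in>Pow A. card Y) = card A * 2 ^ card A"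
proof -
  have "(\<Sum>Y\<in>Pow A. card Y) = (\<Sum>Y\<in>Pow A. card (A - Y))"
    by (rule sum.reindex_bij_witness[of _ "\<lambda>Y. A - Y" "\<lambda>Y. A - Y"]) (auto simp: double_diff)
  then have "2 * (\<Sum>Y\<in>Pow A. card Y) = (\<Sum>Y\<in>Pow A. card Y + card (A - Y))"
    by (simp add: sum.distrib)
  also have "\<dots> = (\<Sum>Y\<in>Pow A. card A)"
    using assms by (intro sum.cong refl) (auto simp: card_Diff_subset finite_subset card_mono)
  finally show ?thesis using assms by (simp add: card_Pow)
qed

text \<open>A vertex \<open>v\<close> with \<open>x\<close> available neighbours gives rise to
  \<open>2 ^ x + 1\<close> independent sets: \<open>{v}\<close>, counted with weight
  \<open>d\<close>, and \<open>2 ^ x\<close> subsets of average size \<open>x / 2\<close>. Either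
  \<open>2 ^ x\<close> is at most \<open>sqrt d\<close> and the term \<open>d\<close> alone
  suffices, or \<open>x\<close> is at least half of \<open>log 2 d\<close>.\<close>

lemma local_occupancy_ineq:
  fixes d :: real and x :: nat
  assumes "1 \<le> d"
  shows "log 2 d / 8 * (2 ^ x + 1) \<le> d + real x * 2 ^ x / 2"
proof (cases "2 ^ x \<le> sqrt d")
  case True
  have "log 2 d = 2 * log 2 (sqrt d)"
    using assms by (simp add: log_def ln_sqrt)
  also have "log 2 (sqrt d) \<le> sqrt d * 2"
  proof -
    have "ln (sqrt d) \<le> sqrt d" using assms by (smt (verit) ln_bound real_sqrt_ge_one)
    moreover have "ln (exp (1 / 2)) \<le> ln (2::real)" using exp_half_le2 by (subst ln_le_cancel_iff) auto
    then have "1 / 2 \<le> ln (2::real)" by simp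
    ultimately have "ln (sqrt d) / ln 2 \<le> sqrt d / (1 / 2)"
      using assms by (intro frac_le) auto
    then show ?thesis by (simp add: log_def)
  qed
  finally have "log 2 d / 8 \<le> sqrt d / 2" by simp
  moreover have "2 ^ x + 1 \<le> 2 * sqrt d" using True assms by (smt (verit) real_sqrt_ge_one)
  ultimately have "log 2 d / 8 * (2 ^ x + 1) \<le> sqrt d / 2 * (2 * sqrt d)"
    using assms by (intro mult_mono) auto
  also have "\<dots> = d" using assms by simp
  finally show ?thesis by (smt (verit) of_nat_0_le_iff divide_nonneg_nonneg mult_nonneg_nonneg zero_le_power)
next
  case False
  then have "log 2 (sqrt d) \<le> log 2 (2 ^ x)" using assms by (intro log_mono) auto
  then have *: "log 2 d \<le> 2 * real x"
    using assms by (simp add: log_def ln_sqrt ln_realpow)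
  have "log 2 d / 8 * (2 ^ x + 1) \<le> (2 * real x) / 8 * (2 ^ x + 2 ^ x)"
    using * by (intro mult_mono) auto
  also have "\<dots> \<le> d + real x * 2 ^ x / 2" using assms by simp
  finally show ?thesis .
qed

text \<open>The average, over a uniformly random independent set \<open>W\<close>, of \<open>d [v \<in> W] + |N(v) \<inter> W|\<close> is
  bounded below after conditioning on \<open>W\<close> outside the closed neighbourhood of \<open>v\<close>: what is left
  is either \<open>{v}\<close> or an arbitrary subset of the \<open>x\<close> still available neighbours.\<close>

lemma triangle_free_local_occupancy:
  fixes V :: "nat set" and d :: real
  assumes V: "finite V" and E: "E \<subseteq> [V]\<^bsup>2\<^esup>" and tf: "\<And>W. W \<subseteq> V \<Longrightarrow> card W = 3 \<Longrightarrow> \<not> clique W E"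
    and d: "1 \<le> d" and v: "v \<in> V"
  defines "Ind \<equiv> {W. W \<subseteq> V \<and> indep W E}" and "N \<equiv> {u\<in>V. {u,v} \<in> E}"
  shows "log 2 d / 8 * card Ind \<le> (\<Sum>W\<in>Ind. d * of_bool (v \<in> W) + card (N \<inter> W))"
proof -
  have fI: "finite Ind" unfolding Ind_def using V by auto
  have fN: "finite N" unfolding N_def using V by auto
  have vN: "v \<notin> N" using E by (auto simp: N_def nsets_def)
  have Nind: "{u,w} \<notin> E" if uw: "u \<in> N" "w \<in> N" for u w
  proof
    assume e: "{u,w} \<in> E"
    then have "u \<noteq> w" using E by (auto simp: nsets_def)
    with uw vN have "card {u,w,v} = 3" by (subst card_insert_disjoint) (auto simp: card_insert_if)
    moreover have "{u,w,v} \<subseteq> V" using uw v by (auto simp: N_def)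
    moreover have "clique {u,w,v} E"
      using uw e by (auto simp: clique_def N_def insert_commute)
    ultimately show False using tf by blast
  qed
  define g where "g W = W - insert v N" for W
  define f where "f W = d * of_bool (v \<in> W) + card (N \<inter> W)" for W
  have fiber: "log 2 d / 8 * card {W\<in>Ind. g W = H} \<le> (\<Sum>W\<in>{W\<in>Ind. g W = H}. f W)"
    if H: "H \<in> g ` Ind" for H
  proof -
    from H have HV: "H \<subseteq> V" "indep H E" "v \<notin> H" "H \<inter> N = {}"
      by (auto simp: g_def Ind_def indep_def)
    \<comment> \<open>The neighbours of \<open>v\<close> that can be added to \<open>H\<close>. They
      do not exclude one another, as \<open>N\<close> is independent in a triangle-free graph, so
      every subset of \<open>A\<close> occurs.\<close>
    define A where "A = {u\<in>N. \<forall>h\<in>H. {u,h} \<notin> E}"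
    have fA: "finite A" "A \<subseteq> N" using fN by (auto simp: A_def)
    have sub_V: "A \<subseteq> V" by (auto simp: A_def N_def)
    have vH: "{v,h} \<notin> E" if "h \<in> H" for h
      using that HV by (auto simp: N_def insert_commute)
    have eq: "{W\<in>Ind. g W = H} = insert (insert v H) ((\<lambda>Y. H \<union> Y) ` Pow A)" (is "?L = ?R")
    proof (intro equalityI subsetI)
      fix W assume "W \<in> ?L"
      then have W: "W \<subseteq> V" "indep W E" "W - insert v N = H" by (auto simp: Ind_def g_def)
      show "W \<in> ?R"
      proof (cases "v \<in> W")
        case True
        have "u \<notin> W" if "u \<in> N" for u
        proof
          assume "u \<in> W"
          moreover have "u \<noteq> v" using that vN by auto
          ultimately have "{u,v} \<notin> E" using W(2) True unfolding indep_def by blast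
          then show False using that by (simp add: N_def)
        qed
        then have "W \<inter> N = {}" by blast
        then have "W = insert v H" using W True by auto
        then show ?thesis by simp
      next
        case False
        have WH: "W = H \<union> (W \<inter> N)" using W(3) False by auto
        then have "indep (H \<union> (W \<inter> N)) E" using W(2) by metis
        then have "\<forall>h\<in>H. \<forall>u\<in>W \<inter> N. h \<noteq> u \<longrightarrow> {h,u} \<notin> E" by (simp add: indep_Un_iff)
        then have "W \<inter> N \<subseteq> A" using HV(4) by (force simp: A_def insert_commute)
        then have "W \<in> (\<lambda>Y. H \<union> Y) ` Pow A" using WH by (intro image_eqI[of _ _ "W \<inter> N"]) simp_all
        then show ?thesis by simp
      qed
    next
      fix W assume "W \<in> ?R"
      then consider "W = insert v H" | Y where "Y \<subseteq> A" "W = H \<union> Y" by auto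
      then show "W \<in> ?L"
      proof cases
        case 1
        have "indep ({v} \<union> H) E" unfolding indep_Un_iff using HV(2) vH by (auto simp: indep_def)
        then show ?thesis using HV v 1 by (auto simp: Ind_def g_def)
      next
        case 2
        have "indep Y E" using 2 Nind fA(2) unfolding indep_def by (meson subsetD)
        moreover have "{h,u} \<notin> E" if "h \<in> H" "u \<in> Y" for h u
          using that 2 by (auto simp: A_def insert_commute)
        ultimately have "indep W E" using 2 HV(2) by (simp add: indep_Un_iff)
        moreover have "g W = H" using 2 HV fA by (auto simp: g_def)
        ultimately show ?thesis using 2 HV sub_V by (auto simp: Ind_def)
      qed
    qed
    have notin: "insert v H \<notin> (\<lambda>Y. H \<union> Y) ` Pow A" using HV fA vN by auto
    have inj: "inj_on (\<lambda>Y. H \<union> Y) (Pow A)"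
    proof (rule inj_onI)
      fix X Y assume XY: "X \<in> Pow A" "Y \<in> Pow A" "H \<union> X = H \<union> Y"
      have "X = (H \<union> X) \<inter> N" "Y = (H \<union> Y) \<inter> N" using XY(1,2) HV(4) fA(2) by auto
      then show "X = Y" using XY(3) by metis
    qed
    have c: "card {W\<in>Ind. g W = H} = 2 ^ card A + 1"
      unfolding eq using notin inj fA by (simp add: card_image card_Pow)
    have "(\<Sum>W\<in>{W\<in>Ind. g W = H}. f W) = f (insert v H) + (\<Sum>Y\<in>Pow A. f (H \<union> Y))"
      unfolding eq using notin inj fA by (simp add: sum.reindex)
    also have "f (insert v H) = d" using HV vN by (auto simp: f_def Int_commute)
    also have "(\<Sum>Y\<in>Pow A. f (H \<union> Y)) = (\<Sum>Y\<in>Pow A. real (card Y))"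
    proof (rule sum.cong[OF refl])
      fix Y assume "Y \<in> Pow A"
      then have "N \<inter> (H \<union> Y) = Y" "v \<notin> H \<union> Y" using HV fA vN by auto
      then show "f (H \<union> Y) = real (card Y)" by (simp add: f_def)
    qed
    also have "\<dots> = real (\<Sum>Y\<in>Pow A. card Y)" by simp
    also have "\<dots> = real (card A) * 2 ^ card A / 2"
    proof -
      have "2 * real (\<Sum>Y\<in>Pow A. card Y) = real (card A * 2 ^ card A)"
        using sum_card_Pow[OF fA(1)] by (metis of_nat_mult of_nat_numeral)
      then show ?thesis by simp
    qed
    finally show ?thesis using local_occupancy_ineq[OF d, of "card A"] c by (simp add: add.commute)
  qed
  have "log 2 d / 8 * card Ind = (\<Sum>W\<in>Ind. log 2 d / 8)" by simp
  also have "\<dots> = (\<Sum>H\<in>g ` Ind. \<Sum>W\<in>{W\<in>Ind. g W = H}. log 2 d / 8)"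
    by (rule sum.image_gen[OF fI])
  also have "\<dots> = (\<Sum>H\<in>g ` Ind. log 2 d / 8 * card {W\<in>Ind. g W = H})" by (simp add: mult.commute)
  also have "\<dots> \<le> (\<Sum>H\<in>g ` Ind. \<Sum>W\<in>{W\<in>Ind. g W = H}. f W)" by (intro sum_mono fiber)
  also have "\<dots> = (\<Sum>W\<in>Ind. f W)" by (rule sum.image_gen[OF fI, symmetric])
  finally show ?thesis by (simp add: f_def)
qed

text \<open>Local occupancy with \<open>d = n\<close>, summed over all \<open>v\<close>. After
  exchanging the sums, an independent \<open>W\<close> contributes \<open>n * card W\<close> plus
  the degrees of its elements, at most \<open>2 * n^2\<close> in all: independent sets have at most
  \<open>n\<close> elements, and neighbourhoods are independent.\<close>

lemma not_ramsey_arrow_3_bound: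
  assumes na: "\<not> ramsey_arrow N 3 n" and n: "1 \<le> n"
  shows "real N * log 2 n \<le> 16 * real n ^ 2"
proof -
  obtain V :: "nat set" and E where V: "finite V" "card V = N" and E: "E \<subseteq> [V]\<^bsup>2\<^esup>"
    and nc: "\<And>W. W \<subseteq> V \<Longrightarrow> card W = 3 \<Longrightarrow> \<not> clique W E"
    and ni: "\<And>W. W \<subseteq> V \<Longrightarrow> card W = n \<Longrightarrow> \<not> indep W E"
    using na by (rule not_ramsey_arrowE) blast
  define Ind where "Ind = {W. W \<subseteq> V \<and> indep W E}"
  define Nb where "Nb v = {u\<in>V. {u,v} \<in> E}" for v
  have fI: "finite Ind" unfolding Ind_def using V by auto
  have "{} \<in> Ind" by (auto simp: Ind_def indep_def)
  then have Ipos: "0 < card Ind" using fI by (auto simp: card_gt_0_iff)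
  have small: "card W \<le> n" if "W \<subseteq> V" "indep W E" for W
  proof (rule ccontr)
    assume "\<not> card W \<le> n"
    then obtain X where "X \<subseteq> W" "card X = n" by (metis nat_le_linear obtain_subset_with_card_n)
    with that ni[of X] show False by (auto simp: indep_def subset_iff)
  qed
  have Nsmall: "card (Nb v) \<le> n" if v: "v \<in> V" for v
  proof (rule small)
    show "Nb v \<subseteq> V" by (auto simp: Nb_def)
    have "{u,w} \<notin> E" if uw: "u \<in> Nb v" "w \<in> Nb v" "u \<noteq> w" for u w
    proof
      assume e: "{u,w} \<in> E"
      have "v \<noteq> u" "v \<noteq> w" using uw E by (auto simp: Nb_def nsets_def)
      with uw have "card {u,w,v} = 3" by auto
      moreover have "{u,w,v} \<subseteq> V" using uw v by (auto simp: Nb_def)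
      moreover have "clique {u,w,v} E"
        using uw e by (auto simp: clique_def Nb_def insert_commute)
      ultimately show False using nc by blast
    qed
    then show "indep (Nb v) E" by (auto simp: indep_def)
  qed
  have "real N * (log 2 n / 8 * card Ind) = (\<Sum>v\<in>V. log 2 n / 8 * card Ind)"
    using V by simp
  also have "\<dots> \<le> (\<Sum>v\<in>V. \<Sum>W\<in>Ind. real n * of_bool (v \<in> W) + card (Nb v \<inter> W))"
    unfolding Ind_def Nb_def using V E nc n
    by (intro sum_mono triangle_free_local_occupancy) auto
  also have "\<dots> = (\<Sum>W\<in>Ind. \<Sum>v\<in>V. real n * of_bool (v \<in> W) + card (Nb v \<inter> W))"
    by (rule sum.swap)
  also have "\<dots> \<le> (\<Sum>W\<in>Ind. 2 * real n ^ 2)"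
  proof (rule sum_mono)
    fix W assume "W \<in> Ind"
    then have W: "W \<subseteq> V" "card W \<le> n" "finite W"
      using small V finite_subset by (auto simp: Ind_def)
    have "(\<Sum>v\<in>V. real n * of_bool (v \<in> W)) = real n * card W"
      using V W by (simp add: sum_distrib_left[symmetric] Int_absorb1 of_bool_def sum.If_cases)
    also have "\<dots> \<le> real n * real n" using W by (intro mult_left_mono) auto
    finally have 1: "(\<Sum>v\<in>V. real n * of_bool (v \<in> W)) \<le> real n * real n" .
    have "(\<Sum>v\<in>V. card (Nb v \<inter> W)) = (\<Sum>v\<in>V. \<Sum>u\<in>W. of_bool (u \<in> Nb v))"
      using W by (intro sum.cong) (auto simp: of_bool_def sum.If_cases Int_commute)
    also have "\<dots> = (\<Sum>u\<in>W. \<Sum>v\<in>V. of_bool (u \<in> Nb v))" by (rule sum.swap)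
    also have "\<dots> = (\<Sum>u\<in>W. card (Nb u))"
    proof (rule sum.cong[OF refl])
      fix u assume "u \<in> W"
      then have "Nb u = {v\<in>V. u \<in> Nb v}" using W by (auto simp: Nb_def insert_commute)
      then show "(\<Sum>v\<in>V. of_bool (u \<in> Nb v)) = card (Nb u)"
        using V by (simp add: of_bool_def sum.If_cases Int_def)
    qed
    also have "\<dots> \<le> (\<Sum>u\<in>W. n)" using W by (intro sum_mono Nsmall) auto
    also have "\<dots> \<le> n * n" using W by simp
    finally have "real (\<Sum>v\<in>V. card (Nb v \<inter> W)) \<le> real (n * n)" by (simp only: of_nat_le_iff)
    with 1 show "(\<Sum>v\<in>V. real n * of_bool (v \<in> W) + card (Nb v \<inter> W)) \<le> 2 * real n ^ 2"
      by (simp add: sum.distrib power2_eq_square)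
  qed
  also have "\<dots> = 2 * real n ^ 2 * card Ind" by simp
  finally show ?thesis using Ipos by (simp add: field_simps)
qed

section \<open>Random subsets of a finite set\<close>

text \<open>The mean of \<open>f\<close> when each element of \<open>E\<close> is kept independently
  with probability \<open>p\<close>. Being a finite sum, it needs no measure space; the algebraic
  identities hold for every real \<open>p\<close>, and only the inequalities ask for
  \<open>0 \<le> p \<le> 1\<close>.\<close>

definition expect :: "real \<Rightarrow> 'a set \<Rightarrow> ('a set \<Rightarrow> real) \<Rightarrow> real" where
  "expect p E f = (\<Sum>G\<in>Pow E. p ^ card G * (1 - p) ^ card (E - G) * f G)"

lemma expect_empty [simp]: "expect p {} f = f {}"
  by (simp add: expect_def)

lemma expect_insert:
  assumes "finite E" "e \<notin> E"
  shows "expect p (insert e E) f = p * expect p E (\<lambda>G. f (insert e G)) + (1 - p) * expect p E f"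
proof -
  have inj: "inj_on (insert e) (Pow E)" using assms(2) by (intro inj_onI) (auto simp: insert_ident)
  have "expect p (insert e E) f =
      (\<Sum>G\<in>Pow E. p ^ card G * (1 - p) ^ card (insert e E - G) * f G) +
      (\<Sum>G\<in>insert e ` Pow E. p ^ card G * (1 - p) ^ card (insert e E - G) * f G)"
    unfolding expect_def Pow_insert using assms by (intro sum.union_disjoint) auto
  also have "(\<Sum>G\<in>insert e ` Pow E. p ^ card G * (1 - p) ^ card (insert e E - G) * f G) =
      (\<Sum>G\<in>Pow E. p ^ card (insert e G) * (1 - p) ^ card (insert e E - insert e G) * f (insert e G))"
    by (rule sum.reindex_cong[OF inj]) auto
  also have "\<dots> = (\<Sum>G\<in>Pow E. p * (p ^ card G * (1 - p) ^ card (E - G) * f (insert e G)))"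
  proof (rule sum.cong[OF refl])
    fix G assume "G \<in> Pow E"
    then have "finite G" "e \<notin> G" "insert e E - insert e G = E - G" using assms finite_subset by auto
    then show "p ^ card (insert e G) * (1 - p) ^ card (insert e E - insert e G) * f (insert e G) =
      p * (p ^ card G * (1 - p) ^ card (E - G) * f (insert e G))" by simp
  qed
  also have "(\<Sum>G\<in>Pow E. p ^ card G * (1 - p) ^ card (insert e E - G) * f G) =
      (\<Sum>G\<in>Pow E. (1 - p) * (p ^ card G * (1 - p) ^ card (E - G) * f G))"
  proof (rule sum.cong[OF refl])
    fix G assume "G \<in> Pow E"
    then have "insert e E - G = insert e (E - G)" using assms by auto
    then show "p ^ card G * (1 - p) ^ card (insert e E - G) * f G =
      (1 - p) * (p ^ card G * (1 - p) ^ card (E - G) * f G)" using assms by simp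
  qed
  finally show ?thesis by (simp add: expect_def sum_distrib_left add.commute)
qed

lemma expect_cong: "E = E' \<Longrightarrow> (\<And>G. G \<subseteq> E \<Longrightarrow> f G = g G) \<Longrightarrow> expect p E f = expect p E' g"
  unfolding expect_def by (intro sum.cong) auto

lemma expect_mono:
  "0 \<le> p \<Longrightarrow> p \<le> 1 \<Longrightarrow> (\<And>G. G \<subseteq> E \<Longrightarrow> f G \<le> g G) \<Longrightarrow> expect p E f \<le> expect p E g"
  unfolding expect_def by (intro sum_mono mult_left_mono) auto

lemma expect_nonneg:
  "0 \<le> p \<Longrightarrow> p \<le> 1 \<Longrightarrow> (\<And>G. G \<subseteq> E \<Longrightarrow> 0 \<le> f G) \<Longrightarrow> 0 \<le> expect p E f"
  unfolding expect_def by (intro sum_nonneg mult_nonneg_nonneg) auto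

lemma expect_add: "expect p E (\<lambda>G. f G + g G) = expect p E f + expect p E g"
  unfolding expect_def by (simp add: sum.distrib algebra_simps)

lemma expect_diff: "expect p E (\<lambda>G. f G - g G) = expect p E f - expect p E g"
  unfolding expect_def by (simp add: sum_subtractf algebra_simps)

lemma expect_cmult: "expect p E (\<lambda>G. c * f G) = c * expect p E f"
  unfolding expect_def by (simp add: sum_distrib_left algebra_simps)

lemma expect_cmult_right: "expect p E (\<lambda>G. f G * c) = expect p E f * c"
  using expect_cmult[of p E c f] by (simp add: mult.commute)

lemma expect_sum: "expect p E (\<lambda>G. \<Sum>i\<in>I. f i G) = (\<Sum>i\<in>I. expect p E (f i))"
  unfolding expect_def by (simp add: sum_distrib_left sum.swap[of _ I])

lemma expect_const [simp]: "finite E \<Longrightarrow> expect p E (\<lambda>_. c) = c"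
  by (induction E rule: finite_induct) (simp_all add: expect_insert algebra_simps)

lemma expect_Un:
  assumes "finite A" "finite B" "A \<inter> B = {}"
  shows "expect p (A \<union> B) f = expect p A (\<lambda>X. expect p B (\<lambda>Y. f (X \<union> Y)))"
  using assms
proof (induction A arbitrary: f rule: finite_induct)
  case (insert e A)
  then have "expect p (insert e (A \<union> B)) f =
      p * expect p (A \<union> B) (\<lambda>G. f (insert e G)) + (1 - p) * expect p (A \<union> B) f"
    by (intro expect_insert) auto
  with insert show ?case by (simp add: expect_insert)
qed simp

lemma expect_indep:
  assumes "finite A" "finite B" "A \<inter> B = {}"
  shows "expect p (A \<union> B) (\<lambda>G. f (G \<inter> A) * g (G \<inter> B)) = expect p A f * expect p B g"
proof -
  have "expect p (A \<union> B) (\<lambda>G. f (G \<inter> A) * g (G \<inter> B)) =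
      expect p A (\<lambda>X. expect p B (\<lambda>Y. f ((X \<union> Y) \<inter> A) * g ((X \<union> Y) \<inter> B)))"
    by (rule expect_Un[OF assms])
  also have "\<dots> = expect p A (\<lambda>X. expect p B (\<lambda>Y. f X * g Y))"
  proof (intro expect_cong refl)
    fix X Y assume "X \<subseteq> A" "Y \<subseteq> B"
    then have "(X \<union> Y) \<inter> A = X" "(X \<union> Y) \<inter> B = Y" using assms(3) by auto
    then show "f ((X \<union> Y) \<inter> A) * g ((X \<union> Y) \<inter> B) = f X * g Y" by simp
  qed
  also have "\<dots> = expect p A f * expect p B g" by (simp add: expect_cmult expect_cmult_right)
  finally show ?thesis .
qed

lemma expect_restrict:
  assumes "finite E" "A \<subseteq> E"
  shows "expect p E (\<lambda>G. f (G \<inter> A)) = expect p A f"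
proof -
  have "expect p (A \<union> (E - A)) (\<lambda>G. f (G \<inter> A) * 1) = expect p A f * expect p (E - A) (\<lambda>_. 1)"
    using assms finite_subset by (intro expect_indep[where g = "\<lambda>_. 1"]) auto
  moreover have "A \<union> (E - A) = E" using assms by auto
  ultimately show ?thesis using assms by simp
qed

lemma expect_prod_UNION:
  assumes "finite I" "\<And>i. i \<in> I \<Longrightarrow> finite (E i)"
    "\<And>i j. i \<in> I \<Longrightarrow> j \<in> I \<Longrightarrow> i \<noteq> j \<Longrightarrow> E i \<inter> E j = {}"
  shows "expect p (\<Union>i\<in>I. E i) (\<lambda>G. \<Prod>i\<in>I. h i (G \<inter> E i)) = (\<Prod>i\<in>I. expect p (E i) (h i))"
  using assms
proof (induction I rule: finite_induct)
  case (insert a I)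
  have "expect p (E a \<union> (\<Union>i\<in>I. E i)) (\<lambda>G. \<Prod>i\<in>insert a I. h i (G \<inter> E i)) =
      expect p (E a \<union> (\<Union>i\<in>I. E i)) (\<lambda>G. h a (G \<inter> E a) * (\<lambda>X. \<Prod>i\<in>I. h i (X \<inter> E i)) (G \<inter> (\<Union>i\<in>I. E i)))"
  proof (intro expect_cong refl)
    fix G
    have "(\<Prod>i\<in>I. h i (G \<inter> E i)) = (\<Prod>i\<in>I. h i (G \<inter> (\<Union>i\<in>I. E i) \<inter> E i))"
      by (intro prod.cong refl) (auto intro!: arg_cong2[where f = h])
    then show "(\<Prod>i\<in>insert a I. h i (G \<inter> E i)) = h a (G \<inter> E a) * (\<lambda>X. \<Prod>i\<in>I. h i (X \<inter> E i)) (G \<inter> (\<Union>i\<in>I. E i))"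
      using insert by simp
  qed
  also have "\<dots> = expect p (E a) (h a) * expect p (\<Union>i\<in>I. E i) (\<lambda>X. \<Prod>i\<in>I. h i (X \<inter> E i))"
  proof (rule expect_indep)
    have "E a \<inter> E i = {}" if "i \<in> I" for i
      using that insert.hyps(2) by (intro insert.prems(2)) auto
    then show "E a \<inter> (\<Union>i\<in>I. E i) = {}" by blast
  qed (use insert.prems(1) insert.hyps(1) in auto)
  also have "expect p (\<Union>i\<in>I. E i) (\<lambda>X. \<Prod>i\<in>I. h i (X \<inter> E i)) = (\<Prod>i\<in>I. expect p (E i) (h i))"
    using insert.prems by (intro insert.IH) auto
  finally show ?case using insert by simp
qed simp

lemma expect_prod:
  assumes "finite E"
  shows "expect p E (\<lambda>G. \<Prod>e\<in>G. c e) = (\<Prod>e\<in>E. 1 - p + p * c e)"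
  using assms
proof (induction E rule: finite_induct)
  case (insert e E)
  have "expect p E (\<lambda>G. \<Prod>e\<in>insert e G. c e) = expect p E (\<lambda>G. c e * (\<Prod>e\<in>G. c e))"
    using insert by (intro expect_cong refl prod.insert) (auto intro: finite_subset)
  with insert show ?case by (simp add: expect_insert expect_cmult algebra_simps)
qed simp

lemma expect_exp_sum_le:
  fixes x :: "'a \<Rightarrow> real"
  assumes "finite E" "0 \<le> p" "p \<le> 1"
  shows "expect p E (\<lambda>G. exp (\<Sum>e\<in>G. x e)) \<le> exp (p * (\<Sum>e\<in>E. exp (x e) - 1))"
proof -
  have "expect p E (\<lambda>G. exp (\<Sum>e\<in>G. x e)) = expect p E (\<lambda>G. \<Prod>e\<in>G. exp (x e))"
    using assms by (intro expect_cong refl exp_sum) (auto intro: finite_subset)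
  also have "\<dots> = (\<Prod>e\<in>E. 1 - p + p * exp (x e))" using assms by (simp add: expect_prod)
  also have "\<dots> \<le> (\<Prod>e\<in>E. exp (p * (exp (x e) - 1)))"
  proof (intro prod_mono conjI)
    fix e
    show "0 \<le> 1 - p + p * exp (x e)" using assms by (intro add_nonneg_nonneg mult_nonneg_nonneg) auto
    show "1 - p + p * exp (x e) \<le> exp (p * (exp (x e) - 1))"
      using exp_ge_add_one_self[of "p * (exp (x e) - 1)"] by (simp add: algebra_simps)
  qed
  also have "\<dots> = exp (p * (\<Sum>e\<in>E. exp (x e) - 1))"
    using assms by (simp add: exp_sum[symmetric] sum_distrib_left)
  finally show ?thesis .
qed

lemma expect_subset:
  assumes "finite E" "B \<subseteq> E"
  shows "expect p E (\<lambda>G. of_bool (B \<subseteq> G)) = p ^ card B"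
proof -
  have "expect p E (\<lambda>G. of_bool (B \<subseteq> G)) = expect p E (\<lambda>G. (\<lambda>X. of_bool (B = X)) (G \<inter> B))"
    by (intro expect_cong refl arg_cong[where f = of_bool]) auto
  also have "\<dots> = expect p B (\<lambda>X. of_bool (B = X))" by (rule expect_restrict[OF assms])
  also have "\<dots> = p ^ card B"
    using assms finite_subset[OF assms(2)]
    by (simp add: expect_def of_bool_def if_distrib[of "(*) _"] sum.If_cases)
  finally show ?thesis .
qed

lemma expect_disjoint:
  assumes "finite E" "B \<subseteq> E"
  shows "expect p E (\<lambda>G. of_bool (B \<inter> G = {})) = (1 - p) ^ card B"
proof -
  have "expect p E (\<lambda>G. of_bool (B \<inter> G = {})) = expect p E (\<lambda>G. (\<lambda>X. of_bool (X = {})) (G \<inter> B))"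
    by (intro expect_cong refl arg_cong[where f = of_bool]) auto
  also have "\<dots> = expect p B (\<lambda>X. of_bool (X = {}))" by (rule expect_restrict[OF assms])
  also have "\<dots> = (1 - p) ^ card B"
    using assms finite_subset[OF assms(2)]
    by (simp add: expect_def of_bool_def if_distrib[of "(*) _"] sum.If_cases)
  finally show ?thesis .
qed

lemma expect_union_bound:
  assumes "0 \<le> p" "p \<le> 1" "finite S"
  shows "expect p E (\<lambda>G. of_bool (\<exists>x\<in>S. P x G)) \<le> (\<Sum>x\<in>S. expect p E (\<lambda>G. of_bool (P x G)))"
proof -
  have "expect p E (\<lambda>G. of_bool (\<exists>x\<in>S. P x G)) \<le> expect p E (\<lambda>G. \<Sum>x\<in>S. of_bool (P x G))"
  proof (rule expect_mono[OF assms(1,2)])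
    fix G
    show "of_bool (\<exists>x\<in>S. P x G) \<le> (\<Sum>x\<in>S. of_bool (P x G) :: real)"
    proof (cases "\<exists>x\<in>S. P x G")
      case True
      then obtain x where "x \<in> S" "P x G" by blast
      then have "(of_bool (P x G) :: real) \<le> (\<Sum>x\<in>S. of_bool (P x G))"
        using assms(3) by (intro member_le_sum) auto
      with True \<open>P x G\<close> show ?thesis by simp
    qed (simp add: sum_nonneg)
  qed
  then show ?thesis by (simp add: expect_sum)
qed

lemma expect_lessD:
  assumes "expect p E f < c" "finite E" "0 \<le> p" "p \<le> 1"
  shows "\<exists>G\<subseteq>E. f G < c"
proof (rule ccontr)
  assume "\<not> ?thesis"
  then have "expect p E (\<lambda>_. c) \<le> expect p E f" using assms by (intro expect_mono) (auto simp: not_less)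
  with assms show False by simp
qed

text \<open>The elements of \<open>E\<close> are exposed in increasing order of \<open>rank\<close>; whether \<open>e\<close> is open is decided
  before \<open>e\<close> itself is exposed.  Weighting each open element by \<open>1 / (1 - p)\<close> turns the event that no
  open element has appeared so far into a martingale.\<close>

lemma expect_no_open:
  fixes rank :: "'a \<Rightarrow> 'b :: linorder"
  assumes "finite E" "p < 1"
    and "\<And>e G. op e G \<longleftrightarrow> op e {g\<in>G. rank g < rank e}"
  shows "expect p E (\<lambda>G. of_bool (\<forall>e\<in>G. \<not> op e G) * inverse (1 - p) ^ card {e\<in>E. op e G}) = 1"
  using assms(1)
proof (induction E rule: finite_ranking_induct[where f = rank])
  case (insert e E)
  show ?case
  proof (cases "e \<in> E")
    case True
    with insert show ?thesis by (simp add: insert_absorb)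
  next
    case False
    \<comment> \<open>The induction adds an element \<open>e\<close> of maximal rank, the last to be
      exposed. Hence \<open>e\<close> cannot influence the openness of the others, nor, the
      comparison of ranks being strict, its own.\<close>
    have op_insert: "op g (insert e G) \<longleftrightarrow> op g G" if "g \<in> insert e E" for g G
    proof -
      have "{h\<in>insert e G. rank h < rank g} = {h\<in>G. rank h < rank g}" using insert(2) that by force
      then show ?thesis using assms(3)[of g] by metis
    qed
    let ?f = "\<lambda>E G. of_bool (\<forall>e\<in>G. \<not> op e G) * inverse (1 - p) ^ card {e\<in>E. op e G} :: real"
    have card_eq: "card {g\<in>insert e E. op g G} = card {g\<in>E. op g G} + of_bool (op e G)" for G
    proof -
      have "{g\<in>insert e E. op g G} = (if op e G then insert e {g\<in>E. op g G} else {g\<in>E. op g G})" by auto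
      then show ?thesis using insert(1) False by simp
    qed
    \<comment> \<open>If \<open>e\<close> is open, only the branch without \<open>e\<close> remains,
      and its factor \<open>1 - p\<close> cancels the additional weight; if \<open>e\<close> is
      closed, both branches have the old weight and \<open>p + (1 - p) = 1\<close>.\<close>
    have step: "p * ?f (insert e E) (insert e G) + (1 - p) * ?f (insert e E) G = ?f E G" if G: "G \<subseteq> E" for G
    proof -
      have 1: "{g\<in>insert e E. op g (insert e G)} = {g\<in>insert e E. op g G}" using op_insert by blast
      have 2: "(\<forall>g\<in>insert e G. \<not> op g (insert e G)) \<longleftrightarrow> \<not> op e G \<and> (\<forall>g\<in>G. \<not> op g G)"
        using op_insert G by blast
      show ?thesis unfolding 1 2 card_eq using assms(2) by (cases "op e G") (simp_all add: algebra_simps field_simps)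
    qed
    have "expect p (insert e E) (?f (insert e E)) =
      expect p E (\<lambda>G. p * ?f (insert e E) (insert e G) + (1 - p) * ?f (insert e E) G)"
      unfolding expect_insert[OF insert(1) False] expect_add expect_cmult ..
    also have "\<dots> = expect p E (?f E)" by (intro expect_cong refl step)
    finally show ?thesis using insert by simp
  qed
qed simp

text \<open>Markov's inequality: as soon as \<open>m\<close> elements are open, the weight whose
  mean is 1 is at least \<open>inverse (1 - p) ^ m\<close>.\<close>

lemma expect_no_open_le:
  fixes rank :: "'a \<Rightarrow> 'b :: linorder"
  assumes "finite E" "0 \<le> p" "p < 1"
    and "\<And>e G. op e G \<longleftrightarrow> op e {g\<in>G. rank g < rank e}"
  shows "expect p E (\<lambda>G. of_bool ((\<forall>e\<in>G. \<not> op e G) \<and> m \<le> card {e\<in>E. op e G})) \<le> (1 - p) ^ m"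
proof -
  have "expect p E (\<lambda>G. of_bool ((\<forall>e\<in>G. \<not> op e G) \<and> m \<le> card {e\<in>E. op e G})) \<le>
    expect p E (\<lambda>G. (1 - p) ^ m * (of_bool (\<forall>e\<in>G. \<not> op e G) * inverse (1 - p) ^ card {e\<in>E. op e G}))"
  proof (rule expect_mono)
    fix G
    have "1 \<le> (1 - p) ^ m * inverse (1 - p) ^ k" if "m \<le> k" for k
    proof -
      have "1 = (1 - p) ^ m * inverse (1 - p) ^ m" using assms(3) by (simp add: power_mult_distrib[symmetric])
      also have "\<dots> \<le> (1 - p) ^ m * inverse (1 - p) ^ k"
        using assms that by (intro mult_left_mono power_increasing) (auto simp: one_le_inverse_iff)
      finally show ?thesis .
    qed
    then show "of_bool ((\<forall>e\<in>G. \<not> op e G) \<and> m \<le> card {e\<in>E. op e G}) \<le>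
      (1 - p) ^ m * (of_bool (\<forall>e\<in>G. \<not> op e G) * inverse (1 - p) ^ card {e\<in>E. op e G})"
      using assms by auto
  qed (use assms in auto)
  also have "\<dots> = (1 - p) ^ m" unfolding expect_cmult using expect_no_open[where op = op and rank = rank, OF assms(1,3,4)] by simp
  finally show ?thesis .
qed

section \<open>The local lemma, diagonal Ramsey numbers and \<open>r(4,n)\<close>\<close>

text \<open>The asymmetric Lovasz local lemma in variable form: \<open>A i\<close> looks only at
  \<open>S i\<close>, and events with disjoint \<open>S\<close> are independent. Joint probabilities
  replace conditional ones throughout, so there is no division by a probability not yet known to be
  positive.\<close>

lemma local_lemma:
  fixes A :: "'i \<Rightarrow> 'a set \<Rightarrow> bool" and S :: "'i \<Rightarrow> 'a set" and \<Gamma> :: "'i \<Rightarrow> 'i set" and x :: "'i \<Rightarrow> real"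
  assumes E: "finite E" and p: "0 \<le> p" "p \<le> 1" and I: "finite I"
    and S: "\<And>i. i \<in> I \<Longrightarrow> S i \<subseteq> E"
    and dep: "\<And>i G. i \<in> I \<Longrightarrow> A i G \<longleftrightarrow> A i (G \<inter> S i)"
    and \<Gamma>: "\<And>i. i \<in> I \<Longrightarrow> \<Gamma> i \<subseteq> I"
    and disj: "\<And>i j. i \<in> I \<Longrightarrow> j \<in> I \<Longrightarrow> j \<noteq> i \<Longrightarrow> j \<notin> \<Gamma> i \<Longrightarrow> S i \<inter> S j = {}"
    and x: "\<And>i. i \<in> I \<Longrightarrow> 0 \<le> x i \<and> x i < 1"
    and bound: "\<And>i. i \<in> I \<Longrightarrow> expect p E (\<lambda>G. of_bool (A i G)) \<le> x i * (\<Prod>j\<in>\<Gamma> i. 1 - x j)"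
  shows "\<exists>G\<subseteq>E. \<forall>i\<in>I. \<not> A i G"
proof -
  define avoid where "avoid J = expect p E (\<lambda>G. of_bool (\<forall>j\<in>J. \<not> A j G))" for J
  have avoid_nonneg: "0 \<le> avoid J" for J
    unfolding avoid_def using p by (intro expect_nonneg) auto
  have avoid_insert: "avoid (insert j J) = avoid J - expect p E (\<lambda>G. of_bool (A j G \<and> (\<forall>i\<in>J. \<not> A i G)))" for j J
    unfolding avoid_def expect_diff[symmetric] by (intro expect_cong refl) auto
  \<comment> \<open>The product form of \<open>P(A i | no A j with j in J) <= x i\<close>. Events
    outside \<open>\<Gamma> i\<close> are independent of \<open>A i\<close>; those inside are put
    back one by one.\<close>
  have main: "expect p E (\<lambda>G. of_bool (A i G \<and> (\<forall>j\<in>J. \<not> A j G))) \<le> x i * avoid J"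
    if "J \<subseteq> I" "i \<in> I" "i \<notin> J" for i J
    using that
  proof (induction "card J" arbitrary: i J rule: less_induct)
    case less
    have fJ: "finite J" using less.prems I finite_subset by blast
    define J2 where "J2 = J - \<Gamma> i"
    \<comment> \<open>Putting back the event \<open>k\<close> costs at most the factor
      \<open>1 - x k\<close>, by the induction hypothesis for \<open>J2 \<union> K\<close>, which is
      smaller than \<open>J\<close> because it omits \<open>k\<close>.\<close>
    have grow: "avoid J2 * (\<Prod>j\<in>K. 1 - x j) \<le> avoid (J2 \<union> K)" if "finite K" "K \<subseteq> J \<inter> \<Gamma> i" for K
      using that
    proof (induction K rule: finite_induct)
      case (insert k K)
      have k: "k \<in> J" "k \<in> I" "k \<notin> J2 \<union> K" using insert less.prems by (auto simp: J2_def)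
      then have "J2 \<union> K \<subset> J" using insert by (auto simp: J2_def)
      then have "expect p E (\<lambda>G. of_bool (A k G \<and> (\<forall>j\<in>J2 \<union> K. \<not> A j G))) \<le> x k * avoid (J2 \<union> K)"
        using less.prems k fJ by (intro less.hyps psubset_card_mono) auto
      then have "(1 - x k) * avoid (J2 \<union> K) \<le> avoid (insert k (J2 \<union> K))"
        unfolding avoid_insert by (simp add: algebra_simps)
      moreover have "(1 - x k) * (avoid J2 * (\<Prod>j\<in>K. 1 - x j)) \<le> (1 - x k) * avoid (J2 \<union> K)"
        using insert x[OF k(2)] by (intro mult_left_mono) auto
      ultimately show ?case using insert by (simp add: mult_ac)
    qed simp
    have Gi: "finite (\<Gamma> i)" using \<Gamma>[OF less.prems(2)] I finite_subset by blast
    have indep: "expect p E (\<lambda>G. of_bool (A i G \<and> (\<forall>j\<in>J2. \<not> A j G))) = expect p E (\<lambda>G. of_bool (A i G)) * avoid J2"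
    proof -
      let ?C = "E - S i"
      have un: "S i \<union> ?C = E" using S[OF less.prems(2)] by auto
      have fin: "finite (S i)" "finite ?C" using E S[OF less.prems(2)] finite_subset by auto
      have depC: "A j G \<longleftrightarrow> A j (G \<inter> ?C)" if "j \<in> J2" "G \<subseteq> E" for j G
      proof -
        have j: "j \<in> I" "j \<noteq> i" "j \<notin> \<Gamma> i" using that less.prems by (auto simp: J2_def)
        then have "G \<inter> ?C \<inter> S j = G \<inter> S j" using disj[of i j] less.prems S[OF j(1)] by auto
        then show ?thesis using dep[OF j(1), of G] dep[OF j(1), of "G \<inter> ?C"] by simp
      qed
      have "expect p E (\<lambda>G. of_bool (A i G \<and> (\<forall>j\<in>J2. \<not> A j G))) =
          expect p (S i \<union> ?C) (\<lambda>G. (\<lambda>X. of_bool (A i X)) (G \<inter> S i) * (\<lambda>X. of_bool (\<forall>j\<in>J2. \<not> A j X)) (G \<inter> ?C))"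
        using un depC dep[OF less.prems(2)] by (intro expect_cong) (auto simp: of_bool_conj)
      also have "\<dots> = expect p (S i) (\<lambda>X. of_bool (A i X)) * expect p ?C (\<lambda>X. of_bool (\<forall>j\<in>J2. \<not> A j X))"
        using fin by (intro expect_indep) auto
      also have "expect p (S i) (\<lambda>X. of_bool (A i X)) = expect p E (\<lambda>G. of_bool (A i G))"
        using expect_restrict[OF E S[OF less.prems(2)], of p "\<lambda>X. of_bool (A i X)"] dep[OF less.prems(2)] by simp
      also have "expect p ?C (\<lambda>X. of_bool (\<forall>j\<in>J2. \<not> A j X)) = expect p E (\<lambda>G. of_bool (\<forall>j\<in>J2. \<not> A j (G \<inter> ?C)))"
        using expect_restrict[OF E, of ?C p "\<lambda>X. of_bool (\<forall>j\<in>J2. \<not> A j X)"] by simp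
      also have "\<dots> = avoid J2"
        unfolding avoid_def using depC by (intro expect_cong refl) auto
      finally show ?thesis .
    qed
    have "expect p E (\<lambda>G. of_bool (A i G \<and> (\<forall>j\<in>J. \<not> A j G))) \<le>
        expect p E (\<lambda>G. of_bool (A i G \<and> (\<forall>j\<in>J2. \<not> A j G)))"
      using p by (intro expect_mono) (auto simp: J2_def)
    also have "\<dots> \<le> x i * (\<Prod>j\<in>\<Gamma> i. 1 - x j) * avoid J2"
      unfolding indep using bound[OF less.prems(2)] avoid_nonneg by (intro mult_right_mono) auto
    also have "\<dots> = x i * (avoid J2 * (\<Prod>j\<in>\<Gamma> i. 1 - x j))" by simp
    also have "\<dots> \<le> x i * (avoid J2 * (\<Prod>j\<in>J \<inter> \<Gamma> i. 1 - x j))"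
    proof (intro mult_left_mono)
      have "(\<Prod>j\<in>\<Gamma> i. 1 - x j) = (\<Prod>j\<in>J \<inter> \<Gamma> i. 1 - x j) * (\<Prod>j\<in>\<Gamma> i - J. 1 - x j)"
        using Gi by (subst prod.union_disjoint[symmetric]) (auto intro: prod.cong)
      also have "\<dots> \<le> (\<Prod>j\<in>J \<inter> \<Gamma> i. 1 - x j) * 1"
        using x \<Gamma>[OF less.prems(2)] less.prems(1)
        by (intro mult_left_mono prod_le_1 prod_nonneg) (auto simp: subset_iff less_imp_le)
      finally show "(\<Prod>j\<in>\<Gamma> i. 1 - x j) \<le> (\<Prod>j\<in>J \<inter> \<Gamma> i. 1 - x j)" by simp
    qed (use avoid_nonneg x less.prems in auto)
    also have "\<dots> \<le> x i * avoid (J2 \<union> (J \<inter> \<Gamma> i))"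
      using grow[of "J \<inter> \<Gamma> i"] fJ x less.prems by (intro mult_left_mono) auto
    also have "J2 \<union> (J \<inter> \<Gamma> i) = J" by (auto simp: J2_def)
    finally show ?case .
  qed
  have "(\<Prod>j\<in>K. 1 - x j) \<le> avoid K" if "finite K" "K \<subseteq> I" for K
    using that
  proof (induction K rule: finite_induct)
    case empty
    then show ?case using E by (simp add: avoid_def)
  next
    case (insert k K)
    have "(1 - x k) * (\<Prod>j\<in>K. 1 - x j) \<le> (1 - x k) * avoid K"
      using insert x[of k] by (intro mult_left_mono) auto
    also have "\<dots> \<le> avoid (insert k K)"
      using main[of K k] insert unfolding avoid_insert by (auto simp: algebra_simps)
    finally show ?case using insert by simp
  qed
  from this[OF I] have "(\<Prod>j\<in>I. 1 - x j) \<le> avoid I" by simp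
  moreover have "0 < (\<Prod>j\<in>I. 1 - x j)" using x by (intro prod_pos) auto
  ultimately have pos: "0 < avoid I" by simp
  show ?thesis
  proof (rule ccontr)
    assume "\<not> ?thesis"
    then have "avoid I = expect p E (\<lambda>_. 0)" unfolding avoid_def by (intro expect_cong refl) auto
    with pos E show False by simp
  qed
qed

section \<open>Diagonal Ramsey numbers by the first moment method\<close>

lemma clique_iff_nsets: "clique W E \<longleftrightarrow> [W]\<^bsup>2\<^esup> \<subseteq> E"
  unfolding clique_def nsets_2_eq UN_subset_iff by auto

lemma indep_iff_nsets: "indep W E \<longleftrightarrow> [W]\<^bsup>2\<^esup> \<inter> E = {}"
proof -
  have "indep W E \<longleftrightarrow> clique W (- E)" by (simp add: indep_def clique_def)
  then show ?thesis by (auto simp: clique_iff_nsets)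
qed

lemma card_subsets_le:
  assumes "finite V"
  shows "card {T. T \<subseteq> V \<and> card T = k} \<le> card V ^ k"
proof (cases "k \<le> card V")
  case True
  then show ?thesis using assms by (simp add: n_subsets binomial_le_pow)
next
  case False
  then show ?thesis using assms by (simp add: n_subsets binomial_eq_0)
qed

lemma card_nsets_2: "finite T \<Longrightarrow> card ([T]\<^bsup>2\<^esup>) = card T choose 2"
proof -
  assume T: "finite T"
  then have "[T]\<^bsup>2\<^esup> = {B. B \<subseteq> T \<and> card B = 2}" by (auto simp: nsets_def finite_subset)
  then show ?thesis using n_subsets[OF T, of 2] by simp
qed

text \<open>Erdos's union bound over the \<open>k\<close>-sets with \<open>p = 1/2\<close>. The
  exponent \<open>k div 2 - 1\<close> is low enough for the crude count \<open>N ^ k\<close> of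
  these sets, since \<open>2 * N ^ k < 2 ^ (k choose 2)\<close>.\<close>

lemma not_ramsey_arrow_diagonal:
  assumes k: "4 \<le> k"
  shows "\<not> ramsey_arrow (2 ^ (k div 2 - 1)) k k"
proof -
  define N :: nat where "N = 2 ^ (k div 2 - 1)"
  define E where "E = [{..<N}]\<^bsup>2\<^esup>"
  define I where "I = {T. T \<subseteq> {..<N} \<and> card T = k}"
  have fE: "finite E" unfolding E_def by (rule finite_imp_finite_nsets) simp
  have fI: "finite I" unfolding I_def by simp
  have sub: "[T]\<^bsup>2\<^esup> \<subseteq> E" and card2: "card ([T]\<^bsup>2\<^esup>) = k choose 2" if "T \<in> I" for T
    using that by (auto simp: I_def E_def card_nsets_2 finite_subset intro: nsets_mono[THEN subsetD])
  have "expect (1/2) E (\<lambda>G. of_bool (\<exists>T\<in>I. [T]\<^bsup>2\<^esup> \<subseteq> G \<or> [T]\<^bsup>2\<^esup> \<inter> G = {})) \<le>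
      (\<Sum>T\<in>I. expect (1/2) E (\<lambda>G. of_bool ([T]\<^bsup>2\<^esup> \<subseteq> G \<or> [T]\<^bsup>2\<^esup> \<inter> G = {})))"
    using fI by (intro expect_union_bound) auto
  also have "\<dots> \<le> (\<Sum>T\<in>I. expect (1/2) E (\<lambda>G. of_bool ([T]\<^bsup>2\<^esup> \<subseteq> G) + of_bool ([T]\<^bsup>2\<^esup> \<inter> G = {})))"
    by (intro sum_mono expect_mono) auto
  also have "\<dots> = (\<Sum>T\<in>I. 2 * (1/2) ^ (k choose 2))"
    using sub card2 fE by (intro sum.cong refl) (simp add: expect_add expect_subset expect_disjoint)
  also have "\<dots> \<le> real (N ^ k) * (2 * (1/2) ^ (k choose 2))"
    using card_subsets_le[of "{..<N}" k] unfolding I_def sum_constant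
    by (intro mult_right_mono) (simp_all only: of_nat_le_iff, auto)
  also have "\<dots> < 1"
  proof -
    have "k * (k div 2 - 1) + 1 < k choose 2"
    proof -
      have "2 * (k * (k div 2 - 1) + 1) = k * (2 * (k div 2 - 1)) + 2" by simp
      also have "\<dots> \<le> k * (k - 2) + 2" by (intro add_right_mono mult_left_mono) auto
      also have "\<dots> < k * (k - 1)"
      proof -
        obtain j where "k = j + 4" using k le_Suc_ex by (metis add.commute)
        then show ?thesis by (simp add: algebra_simps)
      qed
      also have "k * (k - 1) = 2 * (k choose 2)"
      proof -
        have "even (k * (k - 1))" using k by (cases k) auto
        then show ?thesis by (simp add: choose_two)
      qed
      finally show ?thesis by simp
    qed
    then have "(2::real) ^ (k * (k div 2 - 1) + 1) < 2 ^ (k choose 2)" by (intro power_strict_increasing) auto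
    then show ?thesis by (simp add: N_def power_mult[symmetric] mult.commute power_one_over field_simps)
  qed
  finally have "\<exists>G\<subseteq>E. (of_bool (\<exists>T\<in>I. [T]\<^bsup>2\<^esup> \<subseteq> G \<or> [T]\<^bsup>2\<^esup> \<inter> G = {}) :: real) < 1"
    using fE by (intro expect_lessD) auto
  then obtain G where G: "G \<subseteq> E" "\<not> (\<exists>T\<in>I. [T]\<^bsup>2\<^esup> \<subseteq> G \<or> [T]\<^bsup>2\<^esup> \<inter> G = {})"
    by (auto simp: of_bool_def split: if_splits)
  have nT: "\<not> clique T G" "\<not> indep T G" if "T \<subseteq> {..<N}" "card T = k" for T
    using that G(2) by (auto simp: I_def clique_iff_nsets indep_iff_nsets)
  have "\<not> ramsey_arrow N k k"
    unfolding ramsey_arrow_def using G(1) nT unfolding E_def by (metis card_lessThan finite_lessThan)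
  then show ?thesis by (simp add: N_def)
qed

section \<open>The lower bound on r(4,n)\<close>

lemma choose_two_real: "real (n choose 2) = real n * (real n - 1) / 2"
proof -
  have "even (n * (n - 1))" by (cases n) auto
  then have "2 * (n choose 2) = n * (n - 1)" by (simp add: choose_two)
  then have "2 * real (n choose 2) = real (n * (n - 1))" by (metis of_nat_mult of_nat_numeral)
  then show ?thesis by (cases n) (auto simp: algebra_simps)
qed

lemma exp_neg_double_le:
  fixes y :: real
  assumes "0 \<le> y" "y \<le> 1 / 2"
  shows "exp (- (2 * y)) \<le> 1 - y"
proof -
  have "1 + 2 * y \<le> exp (2 * y)" by (rule exp_ge_add_one_self)
  then have "exp (- (2 * y)) \<le> 1 / (1 + 2 * y)"
    using assms by (simp add: exp_minus inverse_eq_divide frac_le)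
  also have "\<dots> \<le> 1 - y"
  proof -
    have "0 \<le> y * (1 - 2 * y)" using assms by (intro mult_nonneg_nonneg) auto
    then have "1 \<le> (1 - y) * (1 + 2 * y)" by (simp add: algebra_simps)
    then show ?thesis using assms by (subst pos_divide_le_eq) auto
  qed
  finally show ?thesis .
qed

text \<open>The local lemma for "this 4-set is a clique", with weight \<open>2 * p ^ 6\<close>,
  twice its probability, and "this \<open>s\<close>-set is independent", with weight
  \<open>1 / (4 * N ^ s)\<close>. \<open>C1\<close> and \<open>C2\<close> are the two conditions
  that result: by \<open>C1\<close> the at most \<open>16 * N^2\<close> 4-sets sharing a pair with a
  given one have total weight at most \<open>1 / 4\<close>, and in \<open>C2\<close> the
  \<open>3 / 16\<close> is \<open>1 / 4 * (3 / 4)\<close>.\<close>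

lemma not_ramsey_arrow_4I:
  fixes N s :: nat and p :: real
  assumes p: "0 < p" "p < 1" and N: "1 \<le> N" and s: "s \<noteq> 4" "1 \<le> s"
    and C1: "128 * p ^ 6 * real N ^ 2 \<le> 1"
    and C2: "(1 - p) ^ (s choose 2) \<le> 3 / 16 / real N ^ s * (1 - 2 * p ^ 6) ^ (s ^ 2 * N ^ 2)"
  shows "\<not> ramsey_arrow N 4 s"
proof -
  define E where "E = [{..<N}]\<^bsup>2\<^esup>"
  define I4 where "I4 = {T. T \<subseteq> {..<N} \<and> card T = 4}"
  define Is where "Is = {T. T \<subseteq> {..<N} \<and> card T = s}"
  \<comment> \<open>As \<open>s \<noteq> 4\<close>, the size of \<open>T\<close> tells which of the
    two events it stands for.\<close>
  define A where "A T G = (if card T = 4 then [T]\<^bsup>2\<^esup> \<subseteq> G else [T]\<^bsup>2\<^esup> \<inter> G = {})" for T :: "nat set" and G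
  define x :: "nat set \<Rightarrow> real" where "x T = (if card T = 4 then 2 * p ^ 6 else 1 / (4 * real N ^ s))" for T
  define \<Gamma> where "\<Gamma> T = {T'\<in>I4 \<union> Is. 2 \<le> card (T \<inter> T')}" for T
  have fE: "finite E" unfolding E_def by (rule finite_imp_finite_nsets) simp
  have fI: "finite I4" "finite Is" unfolding I4_def Is_def by simp_all
  have N2: "1 \<le> real N ^ 2" "1 \<le> real N ^ s" using N by simp_all
  have x4: "0 < 2 * p ^ 6" "2 * p ^ 6 \<le> 1 / 64"
  proof -
    have "128 * p ^ 6 * 1 \<le> 128 * p ^ 6 * real N ^ 2" using p N2 by (intro mult_left_mono) auto
    then show "2 * p ^ 6 \<le> 1 / 64" using C1 by simp
  qed (use p in simp)
  have xs: "1 / (4 * real N ^ s) < 1"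
  proof -
    have "1 < 4 * real N ^ s" using N2(2) by linarith
    then show ?thesis by (subst divide_less_eq_1_pos) linarith+
  qed
  have x_range: "0 \<le> x T \<and> x T < 1" for T
    using x4 xs by (auto simp: x_def)
  have prod_bound: "(1 - 2 * p ^ 6) ^ (card T ^ 2 * N ^ 2) * (3 / 4) \<le> (\<Prod>T'\<in>\<Gamma> T. 1 - x T')"
    if T: "T \<subseteq> {..<N}" for T
  proof -
    have fT: "finite T" using T finite_subset by blast
    have eq: "\<Gamma> T = (\<Gamma> T \<inter> I4) \<union> (\<Gamma> T \<inter> Is)" by (auto simp: \<Gamma>_def)
    \<comment> \<open>A 4-set sharing a pair with \<open>T\<close> is given by two vertices of
      \<open>T\<close> and two arbitrary ones.\<close>
    have "\<Gamma> T \<inter> I4 \<subseteq> (\<lambda>(u,v,w,z). {u,v,w,z}) ` (T \<times> T \<times> {..<N} \<times> {..<N})"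
    proof
      fix T' assume "T' \<in> \<Gamma> T \<inter> I4"
      then have T': "T' \<subseteq> {..<N}" "card T' = 4" "2 \<le> card (T \<inter> T')" by (auto simp: \<Gamma>_def I4_def)
      then obtain P where P: "P \<subseteq> T \<inter> T'" "card P = 2" by (metis obtain_subset_with_card_n)
      then obtain u v where uv: "P = {u,v}" by (auto simp: card_2_iff)
      have fT': "finite T'" using T'(1) finite_subset by blast
      then have "card (T' - P) = 2" using P T' by (subst card_Diff_subset) (auto intro: finite_subset)
      then obtain w z where wz: "T' - P = {w,z}" by (auto simp: card_2_iff)
      have "T' = {u,v,w,z}" using uv wz P by auto
      then show "T' \<in> (\<lambda>(u,v,w,z). {u,v,w,z}) ` (T \<times> T \<times> {..<N} \<times> {..<N})"
        using T' uv P by (intro image_eqI[of _ _ "(u,v,w,z)"]) auto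
    qed
    then have "card (\<Gamma> T \<inter> I4) \<le> card ((\<lambda>(u,v,w,z). {u,v,w,z}) ` (T \<times> T \<times> {..<N} \<times> {..<N}))"
      using fT by (intro card_mono) auto
    also have "\<dots> \<le> card (T \<times> T \<times> {..<N} \<times> {..<N})" using fT by (intro card_image_le) auto
    also have "\<dots> = card T ^ 2 * N ^ 2" by (simp add: card_cartesian_product power2_eq_square mult_ac)
    finally have c4: "card (\<Gamma> T \<inter> I4) \<le> card T ^ 2 * N ^ 2" .
    have cs: "card (\<Gamma> T \<inter> Is) \<le> N ^ s"
      using card_mono[of Is "\<Gamma> T \<inter> Is"] fI card_subsets_le[of "{..<N}" s] by (auto simp: Is_def)
    have "(\<Prod>T'\<in>\<Gamma> T. 1 - x T') = (\<Prod>T'\<in>\<Gamma> T \<inter> I4. 1 - x T') * (\<Prod>T'\<in>\<Gamma> T \<inter> Is. 1 - x T')"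
      using fI s(1) by (subst eq, intro prod.union_disjoint) (auto simp: I4_def Is_def)
    also have "(\<Prod>T'\<in>\<Gamma> T \<inter> I4. 1 - x T') = (1 - 2 * p ^ 6) ^ card (\<Gamma> T \<inter> I4)"
      by (simp add: x_def I4_def)
    also have "(\<Prod>T'\<in>\<Gamma> T \<inter> Is. 1 - x T') = (1 - 1 / (4 * real N ^ s)) ^ card (\<Gamma> T \<inter> Is)"
      using s by (simp add: x_def Is_def)
    finally have eq2: "(\<Prod>T'\<in>\<Gamma> T. 1 - x T') =
      (1 - 2 * p ^ 6) ^ card (\<Gamma> T \<inter> I4) * (1 - 1 / (4 * real N ^ s)) ^ card (\<Gamma> T \<inter> Is)" .
    have "(1 - 2 * p ^ 6) ^ (card T ^ 2 * N ^ 2) \<le> (1 - 2 * p ^ 6) ^ card (\<Gamma> T \<inter> I4)"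
      using x4 c4 by (intro power_decreasing) auto
    \<comment> \<open>No attention is paid to overlaps here: there are at most \<open>N ^ s\<close>
      sets of size \<open>s\<close> altogether, and Bernoulli's inequality leaves
      \<open>1 - 1 / 4\<close>.\<close>
    moreover have "3 / 4 \<le> (1 - 1 / (4 * real N ^ s)) ^ card (\<Gamma> T \<inter> Is)"
    proof -
      have "3 / 4 \<le> 1 + real (N ^ s) * (- (1 / (4 * real N ^ s)))" using N2 by simp
      also have "\<dots> \<le> (1 + (- (1 / (4 * real N ^ s)))) ^ (N ^ s)"
        using xs by (intro Bernoulli_inequality) linarith
      also have "\<dots> \<le> (1 + (- (1 / (4 * real N ^ s)))) ^ card (\<Gamma> T \<inter> Is)"
        using cs xs by (intro power_decreasing) auto
      finally show ?thesis by simp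
    qed
    ultimately show ?thesis unfolding eq2 using x4 by (intro mult_mono) auto
  qed
  have "\<exists>G\<subseteq>E. \<forall>T\<in>I4 \<union> Is. \<not> A T G"
  proof (rule local_lemma[where S = "\<lambda>T. [T]\<^bsup>2\<^esup>" and \<Gamma> = \<Gamma> and x = x and p = p])
    fix T assume T: "T \<in> I4 \<union> Is"
    then have TN: "T \<subseteq> {..<N}" and fT: "finite T" by (auto simp: I4_def Is_def intro: finite_subset)
    show sub: "[T]\<^bsup>2\<^esup> \<subseteq> E" unfolding E_def by (rule nsets_mono[OF TN])
    show "A T G \<longleftrightarrow> A T (G \<inter> [T]\<^bsup>2\<^esup>)" for G by (auto simp: A_def)
    show "\<Gamma> T \<subseteq> I4 \<union> Is" by (auto simp: \<Gamma>_def)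
    show "[T]\<^bsup>2\<^esup> \<inter> [T']\<^bsup>2\<^esup> = {}" if T': "T' \<in> I4 \<union> Is" "T' \<noteq> T" "T' \<notin> \<Gamma> T" for T'
    proof -
      have "card (T \<inter> T') < 2" using T' by (auto simp: \<Gamma>_def)
      then have "[T \<inter> T']\<^bsup>2\<^esup> = {}" using fT by (intro nsets_eq_empty) auto
      then show ?thesis by (auto simp: nsets_def)
    qed
    show "0 \<le> x T \<and> x T < 1" by (rule x_range)
    show "expect p E (\<lambda>G. of_bool (A T G)) \<le> x T * (\<Prod>T'\<in>\<Gamma> T. 1 - x T')"
    proof (cases "card T = 4")
      case True
      have "expect p E (\<lambda>G. of_bool (A T G)) = p ^ 6"
        using expect_subset[OF fE sub, of p] True fT by (simp add: A_def card_nsets_2 choose_two)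
      also have "\<dots> \<le> 2 * p ^ 6 * ((1 - 2 * p ^ 6) ^ (card T ^ 2 * N ^ 2) * (3 / 4))"
      proof -
        have "3 / 4 \<le> 1 + real (card T ^ 2 * N ^ 2) * (- (2 * p ^ 6))" using C1 True by (simp add: mult_ac)
        also have "\<dots> \<le> (1 + (- (2 * p ^ 6))) ^ (card T ^ 2 * N ^ 2)"
          using x4 by (intro Bernoulli_inequality) simp
        finally have "p ^ 6 * 1 \<le> p ^ 6 * (2 * ((1 - 2 * p ^ 6) ^ (card T ^ 2 * N ^ 2) * (3 / 4)))"
          using p by (intro mult_left_mono) auto
        then show ?thesis by simp
      qed
      also have "\<dots> \<le> 2 * p ^ 6 * (\<Prod>T'\<in>\<Gamma> T. 1 - x T')"
        using x4 prod_bound[OF TN] by (intro mult_left_mono) auto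
      finally show ?thesis using True by (simp add: x_def)
    next
      case False
      then have cT: "card T = s" using T by (auto simp: I4_def Is_def)
      have "expect p E (\<lambda>G. of_bool (A T G)) = (1 - p) ^ (s choose 2)"
        using expect_disjoint[OF fE sub, of p] False fT cT by (simp add: A_def card_nsets_2)
      also have "\<dots> \<le> 1 / (4 * real N ^ s) * ((1 - 2 * p ^ 6) ^ (card T ^ 2 * N ^ 2) * (3 / 4))"
        using C2 cT by simp
      also have "\<dots> \<le> 1 / (4 * real N ^ s) * (\<Prod>T'\<in>\<Gamma> T. 1 - x T')"
        using prod_bound[OF TN] by (intro mult_left_mono) auto
      finally show ?thesis using False by (simp add: x_def)
    qed
  qed (use fE fI p in auto)
  then obtain G where G: "G \<subseteq> E" "\<And>T. T \<in> I4 \<union> Is \<Longrightarrow> \<not> A T G" by blast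
  have "\<not> clique T G" if "T \<subseteq> {..<N}" "card T = 4" for T
    using G(2)[of T] that by (simp add: I4_def A_def clique_iff_nsets)
  moreover have "\<not> indep T G" if "T \<subseteq> {..<N}" "card T = s" for T
    using G(2)[of T] that s by (simp add: Is_def A_def indep_iff_nsets)
  ultimately show ?thesis
    unfolding ramsey_arrow_def using G(1) unfolding E_def
    by (metis card_lessThan finite_lessThan)
qed

text \<open>With \<open>N = u^40\<close>, \<open>s = u^19\<close> and \<open>p = u^-18\<close>, the
  gain \<open>p * s^2 / 2\<close> is about \<open>u^20 / 2\<close>, against
  \<open>s * ln N = 40 * u^19 * ln u\<close> and a cost of order
  \<open>p^6 * s^2 * N^2 = u^10\<close> for the 4-cliques; also \<open>p^6 * N^2 = u^-28\<close>.
  What matters later is \<open>40 / 19 > 2\<close>: even a factor \<open>log x\<close> keeps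
  \<open>x powr (19 / 40)\<close> below \<open>sqrt x\<close>. Integer powers of \<open>u\<close>
  avoid rounding.\<close>

lemma eventually_not_ramsey_arrow_4: "\<forall>\<^sub>F u in sequentially. \<not> ramsey_arrow (u ^ 40) 4 (u ^ 19)"
proof -
  have "\<forall>\<^sub>F u in sequentially. real u ^ 19 * (40 * ln (real u)) + 4 * real u ^ 10 + ln (16 / 3) \<le> (real u ^ 20 - real u) / 2"
    by real_asymp
  moreover have "\<forall>\<^sub>F u in sequentially. 2 \<le> u" by (rule eventually_ge_at_top)
  ultimately show ?thesis
  proof eventually_elim
    case (elim u)
    define U where "U = real u"
    have U: "2 \<le> U" using elim by (simp add: U_def)
    define p where "p = 1 / U ^ 18"
    have U18: "1 < U ^ 18" using U by (intro one_less_power) auto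
    have p: "0 < p" "p < 1" using U U18 by (auto simp: p_def)
    have p6: "p ^ 6 = 1 / U ^ 108" by (simp add: p_def power_divide power_mult[symmetric])
    show ?case
    proof (rule not_ramsey_arrow_4I[OF p])
      show "1 \<le> u ^ 40" "1 \<le> u ^ 19" using elim by auto
      have "2 ^ 19 \<le> u ^ 19" using elim by (intro power_mono) auto
      then show "u ^ 19 \<noteq> 4" by auto
      have "128 \<le> (2::real) ^ 28" by simp
      also have "\<dots> \<le> U ^ 28" using U by (intro power_mono) auto
      finally have "128 * U ^ 80 \<le> U ^ 28 * U ^ 80" using U by (intro mult_right_mono) auto
      then show "128 * p ^ 6 * real (u ^ 40) ^ 2 \<le> 1"
        using U by (simp add: p6 U_def[symmetric] power_add[symmetric] power_mult[symmetric] field_simps)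
      have small: "2 * p ^ 6 \<le> 1 / 2"
      proof -
        have "(2::real) ^ 108 \<le> U ^ 108" using U by (intro power_mono) auto
        then show ?thesis using U by (simp add: p6 field_simps)
      qed
      have ch: "real (u ^ 19 choose 2) = (U ^ 38 - U ^ 19) / 2"
      proof -
        have "real (u ^ 19 choose 2) = real (u ^ 19) * (real (u ^ 19) - 1) / 2"
          by (simp add: choose_two_real)
        then show ?thesis by (simp add: U_def algebra_simps power_add[symmetric])
      qed
      have "(1 - p) ^ (u ^ 19 choose 2) \<le> exp (- p) ^ (u ^ 19 choose 2)"
        using p exp_ge_add_one_self[of "- p"] by (intro power_mono) auto
      also have "\<dots> = exp (- ((U ^ 20 - U) / 2))"
      proof -
        have "p * (U ^ 38 - U ^ 19) = U ^ 20 - U"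
        proof -
          have "U ^ 38 - U ^ 19 = U ^ 18 * (U ^ 20 - U)"
            using power_add[of U 18 20] power_add[of U 18 1] by (simp add: algebra_simps)
          then show ?thesis using U by (simp add: p_def)
        qed
        moreover have "real (u ^ 19 choose 2) * - p = - ((p * (U ^ 38 - U ^ 19)) / 2)" unfolding ch by simp
        ultimately show ?thesis by (metis exp_of_nat_mult)
      qed
      also have "\<dots> \<le> exp (- (U ^ 19 * (40 * ln U) + 4 * U ^ 10 + ln (16 / 3)))"
        using elim(1) unfolding U_def exp_le_cancel_iff by linarith
      also have "\<dots> = 3 / 16 * exp (- (U ^ 19 * (40 * ln U))) * exp (- (4 * U ^ 10))"
        by (simp add: exp_add exp_diff exp_minus ln_div field_simps)
      also have "exp (- (U ^ 19 * (40 * ln U))) = 1 / real (u ^ 40) ^ (u ^ 19)"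
      proof -
        have "real (u ^ 40) = exp (40 * ln U)"
          using U by (simp add: U_def[symmetric] exp_of_nat_mult[of 40 "ln U", simplified])
        then have "real (u ^ 40) ^ (u ^ 19) = exp (real (u ^ 19) * (40 * ln U))"
          using exp_of_nat_mult[of "u ^ 19" "40 * ln U"] by simp
        then show ?thesis by (simp add: U_def exp_minus inverse_eq_divide)
      qed
      also have "3 / 16 * (1 / real (u ^ 40) ^ (u ^ 19)) * exp (- (4 * U ^ 10)) \<le>
          3 / 16 * (1 / real (u ^ 40) ^ (u ^ 19)) * (1 - 2 * p ^ 6) ^ ((u ^ 19) ^ 2 * (u ^ 40) ^ 2)"
      proof (intro mult_left_mono)
        have "real ((u ^ 19) ^ 2 * (u ^ 40) ^ 2) * (4 * p ^ 6) = 4 * U ^ 10"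
          using U by (simp add: p6 U_def[symmetric] power_mult[symmetric] power_add[symmetric] field_simps)
        then have "exp (- (4 * U ^ 10)) = exp (- (4 * p ^ 6)) ^ ((u ^ 19) ^ 2 * (u ^ 40) ^ 2)"
          by (simp add: exp_of_nat_mult[symmetric])
        also have "\<dots> \<le> (1 - 2 * p ^ 6) ^ ((u ^ 19) ^ 2 * (u ^ 40) ^ 2)"
        proof (intro power_mono)
          show "exp (- (4 * p ^ 6)) \<le> 1 - 2 * p ^ 6"
            using exp_neg_double_le[of "2 * p ^ 6"] small p by simp
        qed simp
        finally show "exp (- (4 * U ^ 10)) \<le> (1 - 2 * p ^ 6) ^ ((u ^ 19) ^ 2 * (u ^ 40) ^ 2)" .
      qed simp
      finally show "(1 - p) ^ (u ^ 19 choose 2) \<le> 3 / 16 / real (u ^ 40) ^ (u ^ 19) * (1 - 2 * p ^ 6) ^ ((u ^ 19) ^ 2 * (u ^ 40) ^ 2)"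
        by simp
    qed
  qed
qed

section \<open>Common neighbours in a sparse random graph\<close>

text \<open>Trades a square for the exponential of a linear function, whose mean over independent
  choices factors.\<close>

lemma square_exp_le:
  fixes z :: real
  assumes "0 \<le> z"
  shows "z ^ 2 * exp z \<le> 2 * (exp (2 * z) - 1)"
proof -
  have "z ^ 2 \<le> 2 * (exp z - 1)" using exp_lower_Taylor_quadratic[OF assms] assms by simp
  then have "z ^ 2 * exp z \<le> 2 * (exp z - 1) * exp z" by (intro mult_right_mono) auto
  also have "\<dots> = 2 * (exp (2 * z) - exp z)" unfolding exp_double by (simp add: algebra_simps power2_eq_square)
  also have "\<dots> \<le> 2 * (exp (2 * z) - 1)" using assms by simp
  finally show ?thesis .
qed

lemma exp_le_one_plus:
  fixes g :: real
  shows "exp g \<le> 1 + g * exp g"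
proof -
  have "1 - g \<le> exp (- g)" using exp_ge_add_one_self[of "- g"] by simp
  then have "(1 - g) * exp g \<le> exp (- g) * exp g" by (intro mult_right_mono) auto
  then show ?thesis by (simp add: exp_minus algebra_simps)
qed

lemma exp_double_minus_one_le:
  fixes y :: real
  assumes "0 \<le> y" "y \<le> 1"
  shows "exp (2 * y) - 1 \<le> 18 * y"
proof -
  have "exp (2 * y) \<le> exp (2 * 1)" using assms by (subst exp_le_cancel_iff) auto
  also have "\<dots> = exp 1 ^ 2" by (rule exp_double)
  also have "\<dots> \<le> 3 ^ 2" by (intro power_mono exp_le) auto
  finally have "2 * y * exp (2 * y) \<le> 2 * y * 9" using assms by (intro mult_left_mono) auto
  then show ?thesis using exp_le_one_plus[of "2 * y"] by simp
qed

text \<open>Truncating at \<open>D\<close> makes \<open>Z\<^sup>2 / (F D)\<close> at most \<open>Z / F\<close>, so that its exponential moment is finite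
  and of the same order as its mean.\<close>

lemma expect_exp_truncated_square:
  fixes x :: "'e \<Rightarrow> real" and F D s p :: real
  assumes B: "finite B" and p: "0 \<le> p" "p \<le> 1" and FD: "0 < F" "0 < D"
    and x: "\<And>e. e \<in> B \<Longrightarrow> 0 \<le> x e \<and> x e \<le> F" and s: "(\<Sum>e\<in>B. x e) \<le> s"
  defines "Z \<equiv> \<lambda>G. \<Sum>e\<in>G. x e" and "\<theta> \<equiv> 1 / (F * D)"
  shows "expect p B (\<lambda>G. exp (\<theta> * (of_bool (Z G \<le> D) * Z G ^ 2)))
    \<le> exp (2 * \<theta> * F ^ 2 * (exp (18 * p * s / F) - 1))"
proof -
  have \<theta>: "0 < \<theta>" using FD by (simp add: \<theta>_def)
  have point: "exp (\<theta> * (of_bool (Z G \<le> D) * Z G ^ 2)) \<le>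
      1 + 2 * \<theta> * F ^ 2 * (exp (\<Sum>e\<in>G. 2 * x e / F) - 1)" if G: "G \<subseteq> B" for G
  proof -
    have Z0: "0 \<le> Z G" unfolding Z_def using G x by (intro sum_nonneg) auto
    have Zsum: "(\<Sum>e\<in>G. 2 * x e / F) = 2 * (Z G / F)"
      by (simp add: Z_def sum_divide_distrib sum_distrib_left)
    show ?thesis
    proof (cases "Z G \<le> D")
      case True
      define g where "g = \<theta> * Z G ^ 2"
      have "g = Z G / F * (Z G / D)" by (simp add: g_def \<theta>_def power2_eq_square)
      also have "\<dots> \<le> Z G / F * 1" using True FD Z0 by (intro mult_left_mono) auto
      finally have gle: "g \<le> Z G / F" by simp
      have g0: "0 \<le> g" using \<theta> by (simp add: g_def)
      have "exp g \<le> 1 + g * exp g" by (rule exp_le_one_plus)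
      also have "\<dots> \<le> 1 + g * exp (Z G / F)" using gle g0 by (simp add: mult_left_mono)
      also have "g * exp (Z G / F) = \<theta> * F ^ 2 * ((Z G / F) ^ 2 * exp (Z G / F))"
        using FD by (simp add: g_def power_divide)
      also have "\<dots> \<le> \<theta> * F ^ 2 * (2 * (exp (2 * (Z G / F)) - 1))"
        using FD Z0 \<theta> by (intro mult_left_mono square_exp_le) auto
      finally show ?thesis unfolding Zsum using True by (simp add: g_def algebra_simps)
    next
      case False
      then show ?thesis using Z0 FD \<theta> unfolding Zsum by simp
    qed
  qed
  have "expect p B (\<lambda>G. exp (\<theta> * (of_bool (Z G \<le> D) * Z G ^ 2))) \<le>
      expect p B (\<lambda>G. (1 - 2 * \<theta> * F ^ 2) + 2 * \<theta> * F ^ 2 * exp (\<Sum>e\<in>G. 2 * x e / F))"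
    using p point by (intro expect_mono) (auto simp: algebra_simps)
  also have "\<dots> = (1 - 2 * \<theta> * F ^ 2) + 2 * \<theta> * F ^ 2 * expect p B (\<lambda>G. exp (\<Sum>e\<in>G. 2 * x e / F))"
    using B by (simp only: expect_add expect_cmult expect_const)
  also have "\<dots> \<le> (1 - 2 * \<theta> * F ^ 2) + 2 * \<theta> * F ^ 2 * exp (18 * p * s / F)"
  proof (intro add_left_mono mult_left_mono)
    \<comment> \<open>The ratios \<open>x e / F\<close> lie in \<open>[0,1]\<close>, where
      \<open>exp (2 * y) - 1\<close> is at most linear in \<open>y\<close>; so only the total weight
      \<open>s\<close> enters.\<close>
    have "(\<Sum>e\<in>B. exp (2 * x e / F) - 1) \<le> (\<Sum>e\<in>B. 18 * (x e / F))"
    proof (rule sum_mono)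
      fix e assume "e \<in> B"
      then have "0 \<le> x e / F" "x e / F \<le> 1" using x FD by auto
      from exp_double_minus_one_le[OF this] show "exp (2 * x e / F) - 1 \<le> 18 * (x e / F)" by simp
    qed
    also have "\<dots> = 18 * (\<Sum>e\<in>B. x e) / F" by (simp add: sum_distrib_left sum_divide_distrib)
    also have "\<dots> \<le> 18 * s / F" using s FD by (intro divide_right_mono) auto
    finally have "p * (\<Sum>e\<in>B. exp (2 * x e / F) - 1) \<le> p * (18 * s / F)" using p by (intro mult_left_mono)
    then have "exp (p * (\<Sum>e\<in>B. exp (2 * x e / F) - 1)) \<le> exp (18 * p * s / F)" by (simp add: mult_ac)
    then show "expect p B (\<lambda>G. exp (\<Sum>e\<in>G. 2 * x e / F)) \<le> exp (18 * p * s / F)"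
      using expect_exp_sum_le[OF B p, of "\<lambda>e. 2 * x e / F"] by linarith
  qed (use \<theta> in auto)
  also have "\<dots> = 1 + 2 * \<theta> * F ^ 2 * (exp (18 * p * s / F) - 1)" by (simp add: algebra_simps)
  also have "\<dots> \<le> exp (2 * \<theta> * F ^ 2 * (exp (18 * p * s / F) - 1))" by (rule exp_ge_add_one_self)
  finally show ?thesis .
qed

text \<open>The fibres of \<open>own\<close> are disjoint blocks of \<open>E\<close>, so the
  exponential moment of the sum factors over \<open>W\<close>; the tail is then Chernoff's bound
  with parameter \<open>\<theta>\<close>.\<close>

lemma expect_truncated_square_tail:
  fixes x :: "'e \<Rightarrow> real" and F D s p c :: real and own :: "'e \<Rightarrow> 'w"
  assumes E: "finite E" and p: "0 \<le> p" "p \<le> 1" and FD: "0 < F" "0 < D"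
    and W: "finite W" "own ` E \<subseteq> W"
    and x: "\<And>e. e \<in> E \<Longrightarrow> 0 \<le> x e \<and> x e \<le> F"
    and s: "\<And>w. w \<in> W \<Longrightarrow> (\<Sum>e\<in>{e\<in>E. own e = w}. x e) \<le> s"
  defines "Z \<equiv> \<lambda>G w. \<Sum>e\<in>{e\<in>G. own e = w}. x e" and "\<theta> \<equiv> 1 / (F * D)"
  shows "expect p E (\<lambda>G. of_bool (c < (\<Sum>w\<in>W. of_bool (Z G w \<le> D) * Z G w ^ 2)))
    \<le> exp (real (card W) * (2 * \<theta> * F ^ 2 * (exp (18 * p * s / F) - 1)) - \<theta> * c)"
proof -
  define B where "B w = {e\<in>E. own e = w}" for w
  define Y where "Y X = (\<Sum>e\<in>X. x e)" for X
  have \<theta>: "0 < \<theta>" using FD by (simp add: \<theta>_def)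
  have EB: "E = (\<Union>w\<in>W. B w)" using W by (auto simp: B_def)
  have ZY: "Z G w = Y (G \<inter> B w)" if "G \<subseteq> E" for G w
    using that by (auto simp: Z_def Y_def B_def intro!: sum.cong)
  have "expect p E (\<lambda>G. of_bool (c < (\<Sum>w\<in>W. of_bool (Z G w \<le> D) * Z G w ^ 2))) \<le>
      expect p E (\<lambda>G. exp (- (\<theta> * c)) * (\<Prod>w\<in>W. exp (\<theta> * (of_bool (Y (G \<inter> B w) \<le> D) * Y (G \<inter> B w) ^ 2))))"
  proof (rule expect_mono[OF p])
    fix G assume G: "G \<subseteq> E"
    define S where "S = (\<Sum>w\<in>W. of_bool (Z G w \<le> D) * Z G w ^ 2)"
    have "exp (- (\<theta> * c)) * (\<Prod>w\<in>W. exp (\<theta> * (of_bool (Y (G \<inter> B w) \<le> D) * Y (G \<inter> B w) ^ 2))) = exp (\<theta> * (S - c))"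
      using W(1) ZY[OF G] by (simp add: S_def exp_sum[symmetric] sum_distrib_left[symmetric] mult_exp_exp algebra_simps)
    moreover have "of_bool (c < S) \<le> exp (\<theta> * (S - c))" using \<theta> by auto
    ultimately show "of_bool (c < (\<Sum>w\<in>W. of_bool (Z G w \<le> D) * Z G w ^ 2)) \<le>
      exp (- (\<theta> * c)) * (\<Prod>w\<in>W. exp (\<theta> * (of_bool (Y (G \<inter> B w) \<le> D) * Y (G \<inter> B w) ^ 2)))"
      by (simp add: S_def)
  qed
  also have "\<dots> = exp (- (\<theta> * c)) * (\<Prod>w\<in>W. expect p (B w) (\<lambda>X. exp (\<theta> * (of_bool (Y X \<le> D) * Y X ^ 2))))"
    unfolding expect_cmult
    by (subst (1) EB, subst expect_prod_UNION[where h = "\<lambda>w X. exp (\<theta> * (of_bool (Y X \<le> D) * Y X ^ 2))"])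
      (use E W in \<open>auto simp: B_def\<close>)
  also have "\<dots> \<le> exp (- (\<theta> * c)) * (\<Prod>w\<in>W. exp (2 * \<theta> * F ^ 2 * (exp (18 * p * s / F) - 1)))"
    unfolding Y_def \<theta>_def using E p FD x s
    by (intro mult_left_mono prod_mono conjI expect_exp_truncated_square expect_nonneg) (auto simp: B_def)
  also have "\<dots> = exp (real (card W) * (2 * \<theta> * F ^ 2 * (exp (18 * p * s / F) - 1)) - \<theta> * c)"
    by (simp add: exp_of_nat_mult[symmetric] mult_exp_exp)
  finally show ?thesis .
qed

text \<open>The edges of the complete graph on \<open>{..<M}\<close>. As increasing pairs they have
  one code each, and \<open>snd\<close> is the larger end, by which they will be ordered for
  exposure.\<close>

definition pairs :: "nat \<Rightarrow> (nat \<times> nat) set" where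
  "pairs M = {(a,b). a < b \<and> b < M}"

definition adj :: "(nat \<times> nat) set \<Rightarrow> nat \<Rightarrow> nat \<Rightarrow> bool" where
  "adj G a b \<longleftrightarrow> (a,b) \<in> G \<or> (b,a) \<in> G"

lemma adj_commute: "adj G a b \<longleftrightarrow> adj G b a"
  by (auto simp: adj_def)

lemma finite_pairs [simp]: "finite (pairs M)"
  by (rule finite_subset[of _ "{..<M} \<times> {..<M}"]) (auto simp: pairs_def)

lemma adj_pairs: "G \<subseteq> pairs M \<Longrightarrow> adj G a b \<Longrightarrow> a \<noteq> b \<and> a < M \<and> b < M"
  by (auto simp: adj_def pairs_def)

text \<open>Union bound over \<open>w\<close>, \<open>w'\<close> and a set \<open>Q\<close> of
  \<open>q\<close> common neighbours. The \<open>2 * q\<close> edges required are distinct because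
  \<open>Q\<close> avoids \<open>w\<close> and \<open>w'\<close>.\<close>

lemma expect_codegree_le:
  assumes p: "0 \<le> p" "p \<le> 1"
  shows "expect p (pairs M) (\<lambda>G. of_bool (\<exists>w w'. w \<noteq> w' \<and> q < card {v. adj G v w \<and> adj G v w'}))
    \<le> real M ^ 2 * (real M * p ^ 2) ^ q"
proof -
  define e where "e = (\<lambda>(v,w). (min v w, max v w) :: nat \<times> nat)"
  define J where "J = {(w,w',Q). w < M \<and> w' < M \<and> w \<noteq> w' \<and> Q \<subseteq> {..<M} - {w,w'} \<and> card Q = q}"
  define B where "B = (\<lambda>(w,w',Q). e ` (Q \<times> {w,w'}))"
  have Jsub: "J \<subseteq> {..<M} \<times> {..<M} \<times> {Q. Q \<subseteq> {..<M} \<and> card Q = q}" by (auto simp: J_def)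
  have fJ': "finite ({..<M} \<times> {..<M} \<times> {Q. Q \<subseteq> {..<M} \<and> card Q = q})" by simp
  then have fJ: "finite J" using Jsub finite_subset by blast
  have cJ: "card J \<le> M ^ 2 * M ^ q"
  proof -
    have "card J \<le> card ({..<M} \<times> {..<M} \<times> {Q. Q \<subseteq> {..<M} \<and> card Q = q})"
      using fJ' Jsub by (rule card_mono)
    also have "\<dots> = M * (M * card {Q. Q \<subseteq> {..<M} \<and> card Q = q})" by (simp add: card_cartesian_product)
    also have "\<dots> \<le> M * (M * M ^ q)" using card_subsets_le[of "{..<M}" q] by (intro mult_left_mono) auto
    finally show ?thesis by (simp add: power2_eq_square)
  qed
  have B: "B j \<subseteq> pairs M" "card (B j) = 2 * q" if "j \<in> J" for j
  proof -
    obtain w w' Q where j: "j = (w,w',Q)" by (cases j)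
    have J: "w < M" "w' < M" "w \<noteq> w'" "Q \<subseteq> {..<M} - {w,w'}" "card Q = q" using that by (auto simp: j J_def)
    have "e (v,z) \<in> pairs M" if vz: "v \<in> Q" "z \<in> {w,w'}" for v z
    proof -
      have "v \<noteq> z" "v < M" "z < M" using vz J by auto
      then show ?thesis by (auto simp: e_def pairs_def min_def max_def)
    qed
    then show "B j \<subseteq> pairs M" by (auto simp: B_def j)
    have "inj_on e (Q \<times> {w,w'})"
      using J(4) by (intro inj_onI) (auto simp: e_def min_def max_def split: if_splits)
    then show "card (B j) = 2 * q" using J by (simp add: B_def j card_image card_cartesian_product)
  qed
  have "expect p (pairs M) (\<lambda>G. of_bool (\<exists>w w'. w \<noteq> w' \<and> q < card {v. adj G v w \<and> adj G v w'})) \<le>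
      expect p (pairs M) (\<lambda>G. of_bool (\<exists>j\<in>J. B j \<subseteq> G))"
  proof (rule expect_mono[OF p])
    fix G assume G: "G \<subseteq> pairs M"
    have "\<exists>j\<in>J. B j \<subseteq> G" if w: "w \<noteq> w'" "q < card {v. adj G v w \<and> adj G v w'}" for w w'
    proof -
      obtain Q where Q: "Q \<subseteq> {v. adj G v w \<and> adj G v w'}" "card Q = q"
        using w(2) by (meson less_imp_le obtain_subset_with_card_n)
      have "{v. adj G v w \<and> adj G v w'} \<noteq> {}" using w(2) by (intro notI) simp
      then have "w < M" "w' < M" using adj_pairs[OF G] by auto
      then have "(w,w',Q) \<in> J" using Q w adj_pairs[OF G] by (auto simp: J_def)
      moreover have "B (w,w',Q) \<subseteq> G"
      proof -
        have "e (v,z) \<in> G" if "v \<in> Q" "z \<in> {w,w'}" for v z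
        proof -
          have a: "adj G v z" using that Q by auto
          then show ?thesis using G by (auto simp: e_def adj_def pairs_def min_def max_def)
        qed
        then show ?thesis by (auto simp: B_def)
      qed
      ultimately show ?thesis by blast
    qed
    then show "of_bool (\<exists>w w'. w \<noteq> w' \<and> q < card {v. adj G v w \<and> adj G v w'}) \<le> (of_bool (\<exists>j\<in>J. B j \<subseteq> G) :: real)"
      by (auto simp: of_bool_def)
  qed
  also have "\<dots> \<le> (\<Sum>j\<in>J. expect p (pairs M) (\<lambda>G. of_bool (B j \<subseteq> G)))"
    by (rule expect_union_bound[OF p fJ])
  also have "\<dots> = real (card J) * p ^ (2 * q)" using B by (simp add: expect_subset)
  also have "\<dots> \<le> real (M ^ 2 * M ^ q) * p ^ (2 * q)"
    using cJ p by (intro mult_right_mono) (simp_all only: of_nat_le_iff zero_le_power)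
  also have "\<dots> = real M ^ 2 * (real M * p ^ 2) ^ q" by (simp add: power_mult power_mult_distrib)
  finally show ?thesis .
qed

text \<open>Chernoff's bound with parameter 1 at each vertex; the factor 2 bounds
  \<open>exp 1 - 1\<close>.\<close>

lemma expect_degree_le:
  assumes p: "0 \<le> p" "p \<le> 1"
  shows "expect p (pairs M) (\<lambda>G. of_bool (\<exists>w<M. \<Delta> < card {v. adj G v w}))
    \<le> real M * exp (2 * p * real M - real \<Delta>)"
proof -
  define star where "star w = {e\<in>pairs M. fst e = w \<or> snd e = w}" for w
  have one: "expect p (pairs M) (\<lambda>G. of_bool (\<Delta> < card {v. adj G v w})) \<le> exp (2 * p * real M - real \<Delta>)"
    if w: "w < M" for w
  proof -
    have fs: "finite (star w)" "star w \<subseteq> pairs M" by (auto simp: star_def)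
    have cs: "card (star w) \<le> M"
    proof -
      have "star w \<subseteq> (\<lambda>v. (min v w, max v w)) ` {..<M}"
        by (auto simp: star_def pairs_def image_iff min_def max_def) force+
      then have "card (star w) \<le> card ((\<lambda>v. (min v w, max v w)) ` {..<M})" by (intro card_mono) auto
      also have "\<dots> \<le> M" using card_image_le[of "{..<M}" "\<lambda>v. (min v w, max v w)"] by simp
      finally show ?thesis .
    qed
    have "expect p (pairs M) (\<lambda>G. of_bool (\<Delta> < card {v. adj G v w})) \<le>
      expect p (pairs M) (\<lambda>G. exp (- real \<Delta>) * (\<lambda>X. exp (\<Sum>e\<in>X. 1)) (G \<inter> star w))"
    proof (rule expect_mono[OF p])
      fix G assume G: "G \<subseteq> pairs M"
      then have fG: "finite (G \<inter> star w)" using fs by auto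
      have "{v. adj G v w} \<subseteq> (\<lambda>(a,b). if a = w then b else a) ` (G \<inter> star w)"
      proof
        fix v assume "v \<in> {v. adj G v w}"
        then consider "(v,w) \<in> G" | "(w,v) \<in> G" by (auto simp: adj_def)
        then show "v \<in> (\<lambda>(a,b). if a = w then b else a) ` (G \<inter> star w)"
        proof cases
          case 1
          then show ?thesis using G by (intro image_eqI[of _ _ "(v,w)"]) (auto simp: star_def pairs_def)
        next
          case 2
          then show ?thesis using G by (intro image_eqI[of _ _ "(w,v)"]) (auto simp: star_def)
        qed
      qed
      then have "card {v. adj G v w} \<le> card ((\<lambda>(a,b). if a = w then b else a) ` (G \<inter> star w))"
        using fG by (intro card_mono) auto
      also have "\<dots> \<le> card (G \<inter> star w)" using fG by (rule card_image_le)
      finally have le: "card {v. adj G v w} \<le> card (G \<inter> star w)" .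
      have "of_bool (\<Delta> < card {v. adj G v w}) \<le> exp (real (card (G \<inter> star w)) - real \<Delta>)"
        using le by auto
      then show "of_bool (\<Delta> < card {v. adj G v w}) \<le> exp (- real \<Delta>) * (\<lambda>X. exp (\<Sum>e\<in>X. 1)) (G \<inter> star w)"
        by (simp add: mult_exp_exp)
    qed
    also have "\<dots> = exp (- real \<Delta>) * expect p (star w) (\<lambda>X. exp (\<Sum>e\<in>X. 1))"
      unfolding expect_cmult using expect_restrict[OF finite_pairs fs(2), of p "\<lambda>X. exp (\<Sum>e\<in>X. 1)"] by simp
    also have "\<dots> \<le> exp (- real \<Delta>) * exp (p * (\<Sum>e\<in>star w. exp 1 - 1))"
      by (intro mult_left_mono expect_exp_sum_le fs p) auto
    also have "\<dots> \<le> exp (- real \<Delta>) * exp (p * (real M * 2))"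
    proof -
      have "(\<Sum>e\<in>star w. exp 1 - 1 :: real) \<le> real M * 2"
        unfolding sum_constant using cs exp_le by (intro mult_mono) auto
      then show ?thesis using p by (simp add: mult_left_mono)
    qed
    also have "\<dots> = exp (2 * p * real M - real \<Delta>)" by (simp add: mult_exp_exp mult_ac)
    finally show ?thesis .
  qed
  have "expect p (pairs M) (\<lambda>G. of_bool (\<exists>w\<in>{..<M}. \<Delta> < card {v. adj G v w})) \<le>
      (\<Sum>w\<in>{..<M}. expect p (pairs M) (\<lambda>G. of_bool (\<Delta> < card {v. adj G v w})))"
    by (rule expect_union_bound[OF p]) simp
  also have "\<dots> \<le> (\<Sum>w\<in>{..<M}. exp (2 * p * real M - real \<Delta>))" using one by (intro sum_mono) auto
  finally show ?thesis by (simp add: Bex_def)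
qed


section \<open>Neighbourhoods inside a large vertex set\<close>

lemma sum_card_le_Bonferroni:
  assumes W: "finite W" and I: "finite I" and A: "\<And>w. w \<in> W \<Longrightarrow> A w \<subseteq> I"
    and Q: "\<And>w w'. w \<in> W \<Longrightarrow> w' \<in> W \<Longrightarrow> w \<noteq> w' \<Longrightarrow> card (A w \<inter> A w') \<le> Q"
  shows "(\<Sum>w\<in>W. card (A w)) \<le> card I + card W ^ 2 * Q"
proof -
  have "(\<Sum>w\<in>W. card (A w)) \<le> card (\<Union>w\<in>W. A w) + card W ^ 2 * Q"
    using W A Q
  proof (induction W rule: finite_induct)
    case (insert a W)
    let ?U = "\<Union>w\<in>W. A w"
    have fin: "finite (A w)" if "w \<in> insert a W" for w using insert.prems(1)[OF that] I finite_subset by blast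
    then have fU: "finite ?U" using insert.hyps by auto
    have "card (A a \<inter> ?U) = card (\<Union>w\<in>W. A a \<inter> A w)" by simp
    also have "\<dots> \<le> (\<Sum>w\<in>W. card (A a \<inter> A w))" using insert.hyps(1) by (rule card_UN_le)
    also have "\<dots> \<le> (\<Sum>w\<in>W. Q)" using insert.hyps by (intro sum_mono insert.prems(2)) auto
    also have "\<dots> = card W * Q" by simp
    finally have 1: "card (A a \<inter> ?U) \<le> card W * Q" .
    have 2: "card (A a) + card ?U = card (A a \<union> ?U) + card (A a \<inter> ?U)"
      using fin fU by (intro card_Un_Int) auto
    have 3: "(\<Sum>w\<in>W. card (A w)) \<le> card ?U + card W ^ 2 * Q"
      using insert.prems by (intro insert.IH) auto
    have "card W ^ 2 * Q + card W * Q \<le> card (insert a W) ^ 2 * Q"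
      using insert.hyps by (simp add: power2_eq_square algebra_simps)
    with 1 2 3 insert.hyps show ?case by simp
  qed simp
  moreover have "card (\<Union>w\<in>W. A w) \<le> card I" using A I by (intro card_mono) auto
  ultimately show ?thesis by linarith
qed

definition nbhd :: "('v \<Rightarrow> nat) \<Rightarrow> (nat \<times> nat) set \<Rightarrow> 'v set \<Rightarrow> nat \<Rightarrow> 'v set" where
  "nbhd \<phi> G I w = {u\<in>I. adj G (\<phi> u) w}"

text \<open>The sum counts the pairs in \<open>I \<times> I\<close> whose images have a common neighbour, with multiplicity; a
  typical random graph of density \<open>\<epsilon> / \<surd>M\<close> makes it a small fraction of \<open>s\<^sup>2\<close>.\<close>

definition spread_out :: "'v set \<Rightarrow> ('v \<Rightarrow> nat) \<Rightarrow> nat \<Rightarrow> nat \<Rightarrow> (nat \<times> nat) set \<Rightarrow> bool" where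
  "spread_out V \<phi> s M G \<longleftrightarrow> (\<forall>I\<subseteq>V. card I = s \<longrightarrow> 5 * (\<Sum>w<M. card (nbhd \<phi> G I w) ^ 2) \<le> s ^ 2)"

text \<open>An edge counts towards the degrees of both ends, so full degrees are not independent.
  Here each pair is charged to one end, \<open>own\<close>, and its weight is the fibre over the
  other end, \<open>oth\<close>, inside \<open>I\<close>. The two choices \<open>fst\<close>,
  \<open>snd\<close> and \<open>snd\<close>, \<open>fst\<close> together account for all
  adjacencies.\<close>

lemma expect_low_tail:
  fixes own oth :: "nat \<times> nat \<Rightarrow> nat" and \<phi> :: "'v \<Rightarrow> nat" and c p :: real
  assumes p: "0 \<le> p" "p \<le> 1" and inj: "\<And>e e'. own e = own e' \<Longrightarrow> oth e = oth e' \<Longrightarrow> e = e'"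
    and own: "own ` pairs M \<subseteq> {..<M}" and I: "finite I"
    and fib: "\<And>a. card {u\<in>I. \<phi> u = a} \<le> F" and FD: "0 < F" "0 < D"
  defines "L \<equiv> \<lambda>G w. card {u\<in>I. \<exists>e\<in>G. own e = w \<and> oth e = \<phi> u}" and "\<theta> \<equiv> 1 / (real F * real D)"
  shows "expect p (pairs M) (\<lambda>G. of_bool (c < (\<Sum>w<M. of_bool (L G w \<le> D) * real (L G w) ^ 2)))
    \<le> exp (real M * (2 * \<theta> * real F ^ 2 * (exp (18 * p * real (card I) / real F) - 1)) - \<theta> * c)"
proof -
  define x where "x e = real (card {u\<in>I. \<phi> u = oth e})" for e
  have sumx: "(\<Sum>e\<in>{e\<in>G. own e = w}. x e) = real (L G w)" if G: "G \<subseteq> pairs M" for G w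
  proof -
    have "finite G" using G by (rule finite_subset) simp
    then have "(\<Sum>e\<in>{e\<in>G. own e = w}. card {u\<in>I. \<phi> u = oth e}) = card (\<Union>e\<in>{e\<in>G. own e = w}. {u\<in>I. \<phi> u = oth e})"
    proof (intro card_UN_disjoint[symmetric] ballI impI)
      fix e e' assume "e \<in> {e\<in>G. own e = w}" "e' \<in> {e\<in>G. own e = w}" "e \<noteq> e'"
      then have "oth e \<noteq> oth e'" using inj[of e e'] by auto
      then show "{u\<in>I. \<phi> u = oth e} \<inter> {u\<in>I. \<phi> u = oth e'} = {}" by auto
    qed (use I in auto)
    also have "(\<Union>e\<in>{e\<in>G. own e = w}. {u\<in>I. \<phi> u = oth e}) = {u\<in>I. \<exists>e\<in>G. own e = w \<and> oth e = \<phi> u}" by auto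
    finally show ?thesis unfolding x_def L_def of_nat_sum[symmetric] by simp
  qed
  have LI: "L G w \<le> card I" for G w unfolding L_def using I by (intro card_mono) auto
  have "expect p (pairs M) (\<lambda>G. of_bool (c < (\<Sum>w<M. of_bool (L G w \<le> D) * real (L G w) ^ 2))) =
    expect p (pairs M) (\<lambda>G. of_bool (c < (\<Sum>w\<in>{..<M}. of_bool ((\<Sum>e\<in>{e\<in>G. own e = w}. x e) \<le> real D) * (\<Sum>e\<in>{e\<in>G. own e = w}. x e) ^ 2)))"
    by (intro expect_cong refl) (simp add: sumx)
  also have "\<dots> \<le> exp (real (card {..<M}) * (2 * (1 / (real F * real D)) * real F ^ 2 *
      (exp (18 * p * real (card I) / real F) - 1)) - 1 / (real F * real D) * c)"
  proof (rule expect_truncated_square_tail[OF finite_pairs p _ _ finite_lessThan own])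
    fix w
    show "(\<Sum>e\<in>{e\<in>pairs M. own e = w}. x e) \<le> real (card I)"
      using sumx[of "pairs M" w] LI by simp
  qed (use FD fib in \<open>auto simp: x_def\<close>)
  finally show ?thesis by (simp add: \<theta>_def)
qed

text \<open>Fewer than \<open>h\<close> indices \<open>w\<close> see more than \<open>D\<close>
  elements of \<open>I\<close>: by small codegrees, \<open>h\<close> of them would see more than
  \<open>s\<close> elements together. Hence their degrees add up to at most \<open>2 * s\<close>,
  and with maximum \<open>F * \<Delta>\<close> their squares to at most \<open>s^2 / 10\<close>.
  Elsewhere the degree is at most the sum of a part from below and a part from above, and
  \<open>(a + b)^2 \<le> 2 * a^2 + 2 * b^2\<close> with \<open>low1\<close> and \<open>low2\<close>
  gives another \<open>s^2 / 10\<close>.\<close>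

lemma spread_outI:
  assumes G: "G \<subseteq> pairs M" and V: "finite V"
    and fib: "\<And>a. card {u\<in>V. \<phi> u = a} \<le> F"
    and deg: "\<And>w. w < M \<Longrightarrow> card {v. adj G v w} \<le> \<Delta>"
    and codeg: "\<And>w w'. w \<noteq> w' \<Longrightarrow> card {v. adj G v w \<and> adj G v w'} \<le> q"
    and low1: "\<And>I. I \<subseteq> V \<Longrightarrow> card I = s \<Longrightarrow>
      (\<Sum>w<M. of_bool (card {u\<in>I. (\<phi> u, w) \<in> G} \<le> D) * real (card {u\<in>I. (\<phi> u, w) \<in> G}) ^ 2) \<le> real s ^ 2 / 40"
    and low2: "\<And>I. I \<subseteq> V \<Longrightarrow> card I = s \<Longrightarrow>
      (\<Sum>w<M. of_bool (card {u\<in>I. (w, \<phi> u) \<in> G} \<le> D) * real (card {u\<in>I. (w, \<phi> u) \<in> G}) ^ 2) \<le> real s ^ 2 / 40"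
    and num: "s + h ^ 2 * (F * q) \<le> h * D" "h ^ 2 * (F * q) \<le> s" "20 * F * \<Delta> \<le> s" "0 < h"
  shows "spread_out V \<phi> s M G"
  unfolding spread_out_def
proof (intro allI impI)
  fix I assume I: "I \<subseteq> V" "card I = s"
  have fI: "finite I" using I V finite_subset by blast
  have fG: "finite G" using G by (rule finite_subset) simp
  have fadj: "finite {v. adj G v w}" for w
    by (rule finite_subset[of _ "{..<M}"]) (use adj_pairs[OF G] in auto)
  have fibI: "card {u\<in>I. \<phi> u \<in> X} \<le> F * card X" if X: "finite X" for X
  proof -
    have "{u\<in>I. \<phi> u \<in> X} = (\<Union>a\<in>X. {u\<in>I. \<phi> u = a})" by auto
    then have "card {u\<in>I. \<phi> u \<in> X} \<le> (\<Sum>a\<in>X. card {u\<in>I. \<phi> u = a})" using X card_UN_le by metis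
    also have "\<dots> \<le> (\<Sum>a\<in>X. F)"
    proof (rule sum_mono)
      fix a
      have "card {u\<in>I. \<phi> u = a} \<le> card {u\<in>V. \<phi> u = a}" using V I by (intro card_mono) auto
      then show "card {u\<in>I. \<phi> u = a} \<le> F" using fib[of a] by linarith
    qed
    finally show ?thesis by (simp add: mult.commute)
  qed
  define A where "A w = nbhd \<phi> G I w" for w
  define d where "d w = card (A w)" for w
  define H where "H = {w. w < M \<and> D < d w}"
  have fH: "finite H" by (simp add: H_def)
  have AI: "A w \<subseteq> I" for w by (auto simp: A_def nbhd_def)
  have Acap: "card (A w \<inter> A w') \<le> F * q" if "w \<noteq> w'" for w w'
  proof -
    have "A w \<inter> A w' = {u\<in>I. \<phi> u \<in> {v. adj G v w \<and> adj G v w'}}" by (auto simp: A_def nbhd_def)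
    moreover have "finite {v. adj G v w \<and> adj G v w'}" using fadj[of w] by (rule rev_finite_subset) auto
    ultimately have "card (A w \<inter> A w') \<le> F * card {v. adj G v w \<and> adj G v w'}" using fibI by metis
    also have "\<dots> \<le> F * q" using codeg[OF that] by simp
    finally show ?thesis .
  qed
  have bonf: "(\<Sum>w\<in>W. d w) \<le> s + card W ^ 2 * (F * q)" if "W \<subseteq> H" for W
    unfolding d_def I(2)[symmetric] using fH that fI AI Acap
    by (intro sum_card_le_Bonferroni) (auto intro: finite_subset)
  have cH: "card H < h"
  proof (rule ccontr)
    assume "\<not> card H < h"
    then obtain W where W: "W \<subseteq> H" "card W = h" by (meson not_less obtain_subset_with_card_n)
    have fW: "finite W" "W \<noteq> {}" using W num(4) fH finite_subset by auto
    have "h * D = (\<Sum>w\<in>W. D)" using W by simp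
    also have "\<dots> < (\<Sum>w\<in>W. d w)" using W fW by (intro sum_strict_mono) (auto simp: H_def)
    also have "\<dots> \<le> s + h ^ 2 * (F * q)" using bonf[OF W(1)] W(2) by simp
    finally show False using num(1) by linarith
  qed
  have dmax: "d w \<le> F * \<Delta>" if "w < M" for w
  proof -
    have "A w = {u\<in>I. \<phi> u \<in> {v. adj G v w}}" by (auto simp: A_def nbhd_def)
    then have "d w \<le> F * card {v. adj G v w}" unfolding d_def using fibI[OF fadj] by metis
    also have "\<dots> \<le> F * \<Delta>" using deg[OF that] by simp
    finally show ?thesis .
  qed
  have "(\<Sum>w\<in>H. d w ^ 2) \<le> (\<Sum>w\<in>H. F * \<Delta> * d w)"
    using dmax unfolding power2_eq_square by (intro sum_mono mult_right_mono) (auto simp: H_def)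
  also have "\<dots> = F * \<Delta> * (\<Sum>w\<in>H. d w)" by (simp add: sum_distrib_left)
  also have "\<dots> \<le> F * \<Delta> * (2 * s)"
  proof (intro mult_left_mono)
    have "card H ^ 2 * (F * q) \<le> h ^ 2 * (F * q)" using cH by (intro mult_right_mono power_mono) auto
    then show "(\<Sum>w\<in>H. d w) \<le> 2 * s" using bonf[OF order.refl] num(2) by linarith
  qed simp
  finally have "10 * (\<Sum>w\<in>H. d w ^ 2) \<le> 20 * F * \<Delta> * s" by simp
  also have "\<dots> \<le> s * s" using num(3) by (intro mult_right_mono) auto
  finally have "real (10 * (\<Sum>w\<in>H. d w ^ 2)) \<le> real (s * s)" by (simp only: of_nat_le_iff)
  then have high: "(\<Sum>w\<in>H. real (d w) ^ 2) \<le> real s ^ 2 / 10" by (simp add: power2_eq_square)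
  define d1 where "d1 w = card {u\<in>I. (\<phi> u, w) \<in> G}" for w
  define d2 where "d2 w = card {u\<in>I. (w, \<phi> u) \<in> G}" for w
  have low: "real (d w) ^ 2 \<le> 2 * (of_bool (d1 w \<le> D) * real (d1 w) ^ 2) + 2 * (of_bool (d2 w \<le> D) * real (d2 w) ^ 2)"
    if w: "w \<in> {..<M} - H" for w
  proof -
    have Aeq: "A w = {u\<in>I. (\<phi> u, w) \<in> G} \<union> {u\<in>I. (w, \<phi> u) \<in> G}" by (auto simp: A_def nbhd_def adj_def)
    then have "d w \<le> d1 w + d2 w" unfolding d_def d1_def d2_def by (simp add: card_Un_le)
    then have "real (d w) ^ 2 \<le> (real (d1 w) + real (d2 w)) ^ 2" by (intro power_mono) auto
    also have "\<dots> \<le> 2 * real (d1 w) ^ 2 + 2 * real (d2 w) ^ 2"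
      using sum_squares_bound[of "real (d1 w)" "real (d2 w)"] by (simp add: power2_sum)
    finally have "real (d w) ^ 2 \<le> 2 * real (d1 w) ^ 2 + 2 * real (d2 w) ^ 2" .
    \<comment> \<open>Both parts inherit the bound \<open>D\<close> from \<open>d w\<close>, so the
      truncations in \<open>low1\<close> and \<open>low2\<close> are inactive here.\<close>
    moreover have "d1 w \<le> d w" "d2 w \<le> d w"
      unfolding d_def d1_def d2_def Aeq using fI by (auto intro: card_mono)
    moreover have "d w \<le> D" using w by (auto simp: H_def)
    ultimately show ?thesis by simp
  qed
  have "(\<Sum>w<M. real (d w) ^ 2) = (\<Sum>w\<in>H. real (d w) ^ 2) + (\<Sum>w\<in>{..<M} - H. real (d w) ^ 2)"
    by (intro sum.subset_diff[THEN trans, OF _ _ add.commute]) (auto simp: H_def)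
  also have "(\<Sum>w\<in>{..<M} - H. real (d w) ^ 2) \<le>
      (\<Sum>w\<in>{..<M} - H. 2 * (of_bool (d1 w \<le> D) * real (d1 w) ^ 2) + 2 * (of_bool (d2 w \<le> D) * real (d2 w) ^ 2))"
    by (intro sum_mono low)
  also have "\<dots> \<le> (\<Sum>w<M. 2 * (of_bool (d1 w \<le> D) * real (d1 w) ^ 2) + 2 * (of_bool (d2 w \<le> D) * real (d2 w) ^ 2))"
    by (intro sum_mono2) auto
  also have "\<dots> = 2 * (\<Sum>w<M. of_bool (d1 w \<le> D) * real (d1 w) ^ 2) + 2 * (\<Sum>w<M. of_bool (d2 w \<le> D) * real (d2 w) ^ 2)"
    by (simp only: sum.distrib sum_distrib_left)
  also have "\<dots> \<le> real s ^ 2 / 10"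
    using low1[OF I] low2[OF I] by (simp add: d1_def d2_def)
  finally have "5 * (\<Sum>w<M. real (d w) ^ 2) \<le> real s ^ 2" using high by linarith
  then have "real (5 * (\<Sum>w<M. d w ^ 2)) \<le> real (s ^ 2)" by simp
  then show "5 * (\<Sum>w<M. card (nbhd \<phi> G I w) ^ 2) \<le> s ^ 2"
    unfolding of_nat_le_iff by (simp add: d_def A_def)
qed

text \<open>Four bad events: a large truncated sum for some \<open>s\<close>-set, with edges charged
  to the larger or to the smaller end (hence the factor 2); a large degree; a large
  codegree.\<close>

lemma expect_not_spread_out:
  fixes \<phi> :: "'v \<Rightarrow> nat" and p :: real
  assumes p: "0 \<le> p" "p \<le> 1" and V: "finite V"
    and fib: "\<And>a. card {u\<in>V. \<phi> u = a} \<le> F"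
    and num: "s + h ^ 2 * (F * q) \<le> h * D" "h ^ 2 * (F * q) \<le> s" "20 * F * \<Delta> \<le> s" "0 < h" "0 < F" "0 < D"
  defines "\<theta> \<equiv> 1 / (real F * real D)"
  shows "expect p (pairs M) (\<lambda>G. of_bool (\<not> spread_out V \<phi> s M G)) \<le>
    2 * (real (card V) ^ s * exp (real M * (2 * \<theta> * real F ^ 2 * (exp (18 * p * real s / real F) - 1)) - \<theta> * (real s ^ 2 / 40)))
    + real M * exp (2 * p * real M - real \<Delta>) + real M ^ 2 * (real M * p ^ 2) ^ q"
proof -
  define \<I> where "\<I> = {I. I \<subseteq> V \<and> card I = s}"
  define L where "L own oth I G w = card {u\<in>I. \<exists>e\<in>G. own e = w \<and> oth e = \<phi> u}"
    for own oth :: "nat \<times> nat \<Rightarrow> nat" and I and G :: "(nat \<times> nat) set" and w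
  define bad where "bad own oth I G \<longleftrightarrow> real s ^ 2 / 40 < (\<Sum>w<M. of_bool (L own oth I G w \<le> D) * real (L own oth I G w) ^ 2)"
    for own oth :: "nat \<times> nat \<Rightarrow> nat" and I and G :: "(nat \<times> nat) set"
  define R where "R = exp (real M * (2 * \<theta> * real F ^ 2 * (exp (18 * p * real s / real F) - 1)) - \<theta> * (real s ^ 2 / 40))"
  have fI: "finite \<I>" using V by (simp add: \<I>_def)
  have cI: "card \<I> \<le> card V ^ s" unfolding \<I>_def by (rule card_subsets_le[OF V])
  have low: "expect p (pairs M) (\<lambda>G. of_bool (\<exists>I\<in>\<I>. bad own oth I G)) \<le> real (card V) ^ s * R"
    if inj: "\<And>e e'. own e = own e' \<Longrightarrow> oth e = oth e' \<Longrightarrow> e = e'" and own: "own ` pairs M \<subseteq> {..<M}" for own oth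
  proof -
    have "expect p (pairs M) (\<lambda>G. of_bool (\<exists>I\<in>\<I>. bad own oth I G)) \<le>
      (\<Sum>I\<in>\<I>. expect p (pairs M) (\<lambda>G. of_bool (bad own oth I G)))"
      by (rule expect_union_bound[OF p fI])
    also have "\<dots> \<le> (\<Sum>I\<in>\<I>. R)"
    proof (rule sum_mono)
      fix I assume "I \<in> \<I>"
      then have I: "I \<subseteq> V" "card I = s" "finite I" using V finite_subset by (auto simp: \<I>_def)
      have "card {u\<in>I. \<phi> u = a} \<le> F" for a
      proof -
        have "card {u\<in>I. \<phi> u = a} \<le> card {u\<in>V. \<phi> u = a}" using V I by (intro card_mono) auto
        then show ?thesis using fib[of a] by linarith
      qed
      from expect_low_tail[OF p inj own I(3) this num(5,6), where c = "real s ^ 2 / 40"]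
      show "expect p (pairs M) (\<lambda>G. of_bool (bad own oth I G)) \<le> R"
        unfolding bad_def L_def R_def \<theta>_def I(2) .
    qed
    also have "\<dots> \<le> real (card V) ^ s * R"
    proof -
      have "real (card \<I>) \<le> real (card V ^ s)" using cI by (simp only: of_nat_le_iff)
      then show ?thesis by (simp add: R_def mult_right_mono)
    qed
    finally show ?thesis .
  qed
  let ?b1 = "\<lambda>G. \<exists>I\<in>\<I>. bad snd fst I G" and ?b2 = "\<lambda>G. \<exists>I\<in>\<I>. bad fst snd I G"
  let ?b3 = "\<lambda>G. \<exists>w<M. \<Delta> < card {v. adj G v w}"
  let ?b4 = "\<lambda>G. \<exists>w w'. w \<noteq> w' \<and> q < card {v. adj G v w \<and> adj G v w'}"
  have "expect p (pairs M) (\<lambda>G. of_bool (\<not> spread_out V \<phi> s M G)) \<le>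
    expect p (pairs M) (\<lambda>G. of_bool (?b1 G) + of_bool (?b2 G) + of_bool (?b3 G) + of_bool (?b4 G))"
  proof (rule expect_mono[OF p])
    fix G assume G: "G \<subseteq> pairs M"
    have "spread_out V \<phi> s M G" if nb: "\<not> ?b1 G" "\<not> ?b2 G" "\<not> ?b3 G" "\<not> ?b4 G"
    proof (rule spread_outI[OF G V fib _ _ _ _ num(1-4)])
      fix I assume "I \<subseteq> V" "card I = s"
      then have "I \<in> \<I>" by (simp add: \<I>_def)
      then have "\<not> bad snd fst I G" "\<not> bad fst snd I G" using nb(1,2) by auto
      moreover have "L snd fst I G w = card {u\<in>I. (\<phi> u, w) \<in> G}" "L fst snd I G w = card {u\<in>I. (w, \<phi> u) \<in> G}" for w
        unfolding L_def by (auto intro!: arg_cong[where f = card] intro: rev_bexI)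
      ultimately show "(\<Sum>w<M. of_bool (card {u\<in>I. (\<phi> u, w) \<in> G} \<le> D) * real (card {u\<in>I. (\<phi> u, w) \<in> G}) ^ 2) \<le> real s ^ 2 / 40"
        "(\<Sum>w<M. of_bool (card {u\<in>I. (w, \<phi> u) \<in> G} \<le> D) * real (card {u\<in>I. (w, \<phi> u) \<in> G}) ^ 2) \<le> real s ^ 2 / 40"
        by (simp_all add: bad_def)
    next
      show "card {v. adj G v w} \<le> \<Delta>" if "w < M" for w
        using nb(3) that by (meson not_less)
      show "card {v. adj G v w \<and> adj G v w'} \<le> q" if "w \<noteq> w'" for w w'
        using nb(4) that by (meson not_less)
    qed
    then show "of_bool (\<not> spread_out V \<phi> s M G) \<le> (of_bool (?b1 G) + of_bool (?b2 G) + of_bool (?b3 G) + of_bool (?b4 G) :: real)"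
      by (cases "?b1 G"; cases "?b2 G"; cases "?b3 G"; cases "?b4 G") (simp_all add: of_bool_def)
  qed
  also have "\<dots> \<le> real (card V) ^ s * R + real (card V) ^ s * R + real M * exp (2 * p * real M - real \<Delta>) + real M ^ 2 * (real M * p ^ 2) ^ q"
    unfolding expect_add
    by (intro add_mono low expect_degree_le expect_codegree_le p) (auto simp: pairs_def prod_eq_iff)
  finally show ?thesis by (simp add: R_def)
qed

section \<open>Overlaying two blow-ups\<close>

lemma expect_swap:
  "expect p A (\<lambda>X. expect q B (\<lambda>Y. f X Y)) = expect q B (\<lambda>Y. expect p A (\<lambda>X. f X Y))"
proof -
  have "expect p A (\<lambda>X. expect q B (\<lambda>Y. f X Y)) =
      (\<Sum>X\<in>Pow A. \<Sum>Y\<in>Pow B. (p ^ card X * (1 - p) ^ card (A - X)) * (q ^ card Y * (1 - q) ^ card (B - Y) * f X Y))"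
    by (simp add: expect_def sum_distrib_left)
  also have "\<dots> = (\<Sum>Y\<in>Pow B. \<Sum>X\<in>Pow A. (p ^ card X * (1 - p) ^ card (A - X)) * (q ^ card Y * (1 - q) ^ card (B - Y) * f X Y))"
    by (rule sum.swap)
  also have "\<dots> = expect q B (\<lambda>Y. expect p A (\<lambda>X. f X Y))"
    by (simp add: expect_def sum_distrib_left mult_ac)
  finally show ?thesis .
qed

text \<open>The closing vertices range over all indices, not only over images of given vertices. In
  the own graph \<open>G\<close> they must lie above both ends, so that edges with larger upper end
  decide; in \<open>G'\<close> no order is imposed, as \<open>G'\<close> is held fixed while
  \<open>G\<close> is exposed.\<close>

definition survives :: "('v \<Rightarrow> nat) \<Rightarrow> (nat \<times> nat) set \<Rightarrow> ('v \<Rightarrow> nat) \<Rightarrow> (nat \<times> nat) set \<Rightarrow> 'v \<Rightarrow> 'v \<Rightarrow> bool" where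
  "survives \<phi> G \<phi>' G' u v \<longleftrightarrow> adj G (\<phi> u) (\<phi> v)
    \<and> (\<forall>z. \<phi> u < z \<longrightarrow> \<phi> v < z \<longrightarrow> \<not> (adj G (\<phi> u) z \<and> adj G (\<phi> v) z))
    \<and> (\<forall>w. \<not> (adj G' (\<phi>' u) w \<and> adj G' (\<phi>' v) w))"

lemma survives_commute: "survives \<phi> G \<phi>' G' u v \<longleftrightarrow> survives \<phi> G \<phi>' G' v u"
  unfolding survives_def adj_commute[of G "\<phi> u" "\<phi> v"] by auto

text \<open>The three images are distinct, and the largest is a common neighbour above the other
  two, which contradicts survival of the edge opposite to it.\<close>

lemma survives_monochromatic_triangle:
  assumes G: "G \<subseteq> pairs M" and S: "survives \<phi> G \<phi>' G' u v" "survives \<phi> G \<phi>' G' v w" "survives \<phi> G \<phi>' G' u w"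
  shows False
proof -
  have a: "adj G (\<phi> u) (\<phi> v)" "adj G (\<phi> v) (\<phi> w)" "adj G (\<phi> u) (\<phi> w)"
    using S by (auto simp: survives_def)
  then have b: "adj G (\<phi> v) (\<phi> u)" "adj G (\<phi> w) (\<phi> v)" "adj G (\<phi> w) (\<phi> u)"
    by (auto simp: adj_commute)
  have "\<phi> u \<noteq> \<phi> v" "\<phi> v \<noteq> \<phi> w" "\<phi> u \<noteq> \<phi> w" using adj_pairs[OF G] a by blast+
  then consider "\<phi> u < \<phi> w" "\<phi> v < \<phi> w" | "\<phi> u < \<phi> v" "\<phi> w < \<phi> v" | "\<phi> v < \<phi> u" "\<phi> w < \<phi> u"
    by linarith
  then show False
  proof cases
    case 1
    then show False using S(1) a unfolding survives_def by blast
  next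
    case 2
    then show False using S(3) a(1) b(2) unfolding survives_def by blast
  next
    case 3
    then show False using S(2) b(1,3) unfolding survives_def by blast
  qed
qed

lemma survives_mixed_triangle:
  assumes "survives \<phi> G \<phi>' G' u w" "survives \<phi> G \<phi>' G' v w" "survives \<phi>' G' \<phi> G u v"
  shows False
  using assms unfolding survives_def by blast

lemma survives_triangle_free:
  fixes \<phi>1 \<phi>2 :: "'v \<Rightarrow> nat"
  assumes G: "G1 \<subseteq> pairs M" "G2 \<subseteq> pairs M"
  defines "R \<equiv> \<lambda>u v. survives \<phi>1 G1 \<phi>2 G2 u v \<or> survives \<phi>2 G2 \<phi>1 G1 u v"
  assumes R: "R u v" "R v w" "R u w"
  shows False
proof -
  let ?S = "survives \<phi>1 G1 \<phi>2 G2" and ?T = "survives \<phi>2 G2 \<phi>1 G1"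
  note S = survives_monochromatic_triangle[OF G(1), of \<phi>1 \<phi>2 G2] survives_monochromatic_triangle[OF G(2), of \<phi>2 \<phi>1 G1]
  note T = survives_mixed_triangle[of \<phi>1 G1 \<phi>2 G2] survives_mixed_triangle[of \<phi>2 G2 \<phi>1 G1]
  note C = survives_commute[of \<phi>1 G1 \<phi>2 G2] survives_commute[of \<phi>2 G2 \<phi>1 G1]
  consider "?S u v" "?S v w" "?S u w" | "?T u v" "?T v w" "?T u w"
    | "?S u w" "?S v w" "?T u v" | "?S u v" "?S u w" "?T v w" | "?S u v" "?S v w" "?T u w"
    | "?T u w" "?T v w" "?S u v" | "?T u v" "?T u w" "?S v w" | "?T u v" "?T v w" "?S u w"
    using R unfolding R_def by blast
  then show False
  proof cases
    case 1 then show False by (rule S(1)) next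
    case 2 then show False by (rule S(2)) next
    case 3 then show False by (rule T(1)) next
    case 4 then show False using T(1)[of v u w] C by blast next
    case 5 then show False using T(1)[of u v w] C by blast next
    case 6 then show False by (rule T(2)) next
    case 7 then show False using T(2)[of v u w] C by blast next
    case 8 then show False using T(2)[of u v w] C by blast
  qed
qed

lemma card_common_neighbour_le:
  assumes G: "G \<subseteq> pairs M" and I: "finite I"
  shows "card {(u,v)\<in>I \<times> I. \<exists>w. adj G (\<phi> u) w \<and> adj G (\<phi> v) w} \<le> (\<Sum>w<M. card (nbhd \<phi> G I w) ^ 2)"
proof -
  have "{(u,v)\<in>I \<times> I. \<exists>w. adj G (\<phi> u) w \<and> adj G (\<phi> v) w} \<subseteq> (\<Union>w\<in>{..<M}. nbhd \<phi> G I w \<times> nbhd \<phi> G I w)"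
    using adj_pairs[OF G] by (auto simp: nbhd_def)
  moreover have fin: "finite (nbhd \<phi> G I w)" for w using I by (simp add: nbhd_def)
  ultimately have "card {(u,v)\<in>I \<times> I. \<exists>w. adj G (\<phi> u) w \<and> adj G (\<phi> v) w} \<le>
      card (\<Union>w\<in>{..<M}. nbhd \<phi> G I w \<times> nbhd \<phi> G I w)"
    by (intro card_mono) auto
  also have "\<dots> \<le> (\<Sum>w\<in>{..<M}. card (nbhd \<phi> G I w \<times> nbhd \<phi> G I w))" by (intro card_UN_le) auto
  finally show ?thesis by (simp add: card_cartesian_product power2_eq_square)
qed

text \<open>Of the \<open>(s^2 - s) / 2\<close> pairs with increasing images, at most
  \<open>s^2 / 5\<close> are closed by \<open>G'\<close> and at most \<open>s^2 / 5\<close> by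
  \<open>G\<close>. So at least \<open>s^2 / 10 - s / 2\<close> are open, which is at least
  \<open>s^2 / 16\<close> for \<open>s \<ge> 30\<close>. Without survivors, none of these open pairs
  belongs to \<open>G\<close>.\<close>

lemma expect_no_survivor_le:
  fixes \<phi> \<phi>' :: "'v \<Rightarrow> nat" and p :: real
  assumes p: "0 \<le> p" "p < 1" and I: "finite I" "card I = s" "inj_on \<phi> I" "\<phi> ` I \<subseteq> {..<M}"
    and G': "G' \<subseteq> pairs M" "5 * (\<Sum>w<M. card (nbhd \<phi>' G' I w) ^ 2) \<le> s ^ 2"
    and s: "30 \<le> s" "16 * m \<le> s ^ 2"
  shows "expect p (pairs M) (\<lambda>G. of_bool (5 * (\<Sum>w<M. card (nbhd \<phi> G I w) ^ 2) \<le> s ^ 2 \<and>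
    (\<forall>u\<in>I. \<forall>v\<in>I. \<not> survives \<phi> G \<phi>' G' u v))) \<le> (1 - p) ^ m"
proof -
  define blk where "blk u v \<longleftrightarrow> (\<exists>w. adj G' (\<phi>' u) w \<and> adj G' (\<phi>' v) w)" for u v
  define P where "P = {(\<phi> u, \<phi> v) | u v. u \<in> I \<and> v \<in> I \<and> \<phi> u < \<phi> v \<and> \<not> blk u v}"
  \<comment> \<open>With \<open>G'\<close> fixed, \<open>P\<close> is fixed. Beyond
    \<open>P\<close>, the openness of \<open>(a,b)\<close> consults only pairs with second component
    \<open>z > b\<close>, which the rank \<open>- snd e\<close> exposes earlier.\<close>
  define op where "op e G \<longleftrightarrow> e \<in> P \<and> \<not> (\<exists>z>snd e. (fst e, z) \<in> G \<and> (snd e, z) \<in> G)"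
    for e :: "nat \<times> nat" and G :: "(nat \<times> nat) set"
  have PM: "P \<subseteq> pairs M" using I(4) by (auto simp: P_def pairs_def)
  have "expect p (pairs M) (\<lambda>G. of_bool (5 * (\<Sum>w<M. card (nbhd \<phi> G I w) ^ 2) \<le> s ^ 2 \<and>
    (\<forall>u\<in>I. \<forall>v\<in>I. \<not> survives \<phi> G \<phi>' G' u v))) \<le>
    expect p (pairs M) (\<lambda>G. of_bool ((\<forall>e\<in>G. \<not> op e G) \<and> m \<le> card {e\<in>pairs M. op e G}))"
  proof (rule expect_mono)
    fix G assume G: "G \<subseteq> pairs M"
    have "(\<forall>e\<in>G. \<not> op e G) \<and> m \<le> card {e\<in>pairs M. op e G}"
      if sp: "5 * (\<Sum>w<M. card (nbhd \<phi> G I w) ^ 2) \<le> s ^ 2" and ns: "\<forall>u\<in>I. \<forall>v\<in>I. \<not> survives \<phi> G \<phi>' G' u v"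
    proof
      have adj_iff: "adj G a z \<longleftrightarrow> (a,z) \<in> G" if "a < z" for a z
        using that G by (auto simp: adj_def pairs_def)
      show "\<forall>e\<in>G. \<not> op e G"
      proof (intro ballI notI)
        fix e assume e: "e \<in> G" "op e G"
        then obtain u v where uv: "e = (\<phi> u, \<phi> v)" "u \<in> I" "v \<in> I" "\<phi> u < \<phi> v" "\<not> blk u v"
          by (auto simp: op_def P_def)
        have "survives \<phi> G \<phi>' G' u v"
          unfolding survives_def
        proof (intro conjI allI impI)
          show "adj G (\<phi> u) (\<phi> v)" using e uv by (simp add: adj_def)
          show "\<not> (adj G (\<phi> u) z \<and> adj G (\<phi> v) z)" if "\<phi> u < z" "\<phi> v < z" for z
            using e(2) that by (simp add: adj_iff op_def uv(1))
          show "\<not> (adj G' (\<phi>' u) w \<and> adj G' (\<phi>' v) w)" for w using uv(5) by (auto simp: blk_def)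
        qed
        with ns uv show False by blast
      qed
      define cl where "cl u v \<longleftrightarrow> (\<exists>w. adj G (\<phi> u) w \<and> adj G (\<phi> v) w)" for u v
      define Lt where "Lt = {(u,v)\<in>I \<times> I. \<phi> u < \<phi> v}"
      \<comment> \<open>Common neighbours in \<open>G\<close> are excluded here whether or not they
        are larger: this still implies openness, and it is what the sum of squares controls.\<close>
      define Q where "Q = {(u,v)\<in>I \<times> I. \<phi> u < \<phi> v \<and> \<not> blk u v \<and> \<not> cl u v}"
      define B where "B = {(u,v)\<in>I \<times> I. blk u v}"
      define C where "C = {(u,v)\<in>I \<times> I. cl u v}"
      have fII: "finite (I \<times> I)" using I by simp
      have fin: "finite Lt" "finite Q" "finite B" "finite C"
        unfolding Lt_def Q_def B_def C_def by (rule finite_subset[OF _ fII]; auto)+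
      have "(\<lambda>(u,v). (\<phi> u, \<phi> v)) ` Q \<subseteq> {e\<in>pairs M. op e G}"
      proof (intro subsetI)
        fix e assume "e \<in> (\<lambda>(u,v). (\<phi> u, \<phi> v)) ` Q"
        then obtain u v where uv: "(u,v) \<in> Q" and e: "e = (\<phi> u, \<phi> v)" by auto
        from uv have "(\<phi> u, \<phi> v) \<in> P" by (auto simp: Q_def P_def)
        moreover have "\<not> (\<exists>z>\<phi> v. (\<phi> u, z) \<in> G \<and> (\<phi> v, z) \<in> G)"
          using uv by (auto simp: Q_def cl_def adj_def)
        ultimately show "e \<in> {e\<in>pairs M. op e G}" using PM by (auto simp: op_def e)
      qed
      then have "card ((\<lambda>(u,v). (\<phi> u, \<phi> v)) ` Q) \<le> card {e\<in>pairs M. op e G}" by (intro card_mono) auto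
      moreover have "card ((\<lambda>(u,v). (\<phi> u, \<phi> v)) ` Q) = card Q"
        using I(3) by (intro card_image inj_onI) (auto simp: Q_def inj_on_def)
      ultimately have Q: "card Q \<le> card {e\<in>pairs M. op e G}" by simp
      have "I \<times> I \<subseteq> (\<lambda>u. (u,u)) ` I \<union> (Lt \<union> prod.swap ` Lt)"
      proof
        fix e assume "e \<in> I \<times> I"
        then obtain u v where uv: "u \<in> I" "v \<in> I" and e: "e = (u,v)" by auto
        consider "\<phi> u < \<phi> v" | "\<phi> v < \<phi> u" | "\<phi> u = \<phi> v" by linarith
        then show "e \<in> (\<lambda>u. (u,u)) ` I \<union> (Lt \<union> prod.swap ` Lt)"
        proof cases
          case 1
          then show ?thesis using uv by (simp add: Lt_def e)
        next
          case 2
          then have "(v,u) \<in> Lt" using uv by (simp add: Lt_def)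
          then show ?thesis unfolding e by (metis UnCI image_eqI swap_simp)
        next
          case 3
          then have "u = v" using I(3) uv by (simp add: inj_on_def)
          then show ?thesis using uv by (simp add: e)
        qed
      qed
      then have "card (I \<times> I) \<le> card ((\<lambda>u. (u,u)) ` I \<union> (Lt \<union> prod.swap ` Lt))"
        using fin I by (intro card_mono) auto
      also have "\<dots> \<le> card ((\<lambda>u. (u,u)) ` I) + (card Lt + card (prod.swap ` Lt))"
        by (meson add_left_mono card_Un_le order_trans)
      also have "\<dots> \<le> s + (card Lt + card Lt)"
        using fin I card_image_le by (intro add_mono) (auto intro: card_image_le)
      finally have 1: "s * s \<le> s + 2 * card Lt" using I by (simp add: card_cartesian_product)
      have "card Lt \<le> card (Q \<union> (B \<union> C))"
        using fin by (intro card_mono) (auto simp: Lt_def Q_def B_def C_def)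
      also have "\<dots> \<le> card Q + (card B + card C)" by (meson add_left_mono card_Un_le order_trans)
      finally have 2: "card Lt \<le> card Q + (card B + card C)" .
      have 3: "5 * card B \<le> s * s" "5 * card C \<le> s * s"
        using card_common_neighbour_le[OF G'(1) I(1), of \<phi>'] G'(2) card_common_neighbour_le[OF G I(1), of \<phi>] sp
        by (auto simp: B_def C_def blk_def cl_def power2_eq_square)
      have "30 * s \<le> s * s" using s by simp
      moreover have "16 * m \<le> s * s" using s(2) by (simp add: power2_eq_square)
      ultimately have "m \<le> card Q" using 1 2 3 by linarith
      with Q show "m \<le> card {e\<in>pairs M. op e G}" by simp
    qed
    then show "of_bool (5 * (\<Sum>w<M. card (nbhd \<phi> G I w) ^ 2) \<le> s ^ 2 \<and> (\<forall>u\<in>I. \<forall>v\<in>I. \<not> survives \<phi> G \<phi>' G' u v))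
      \<le> (of_bool ((\<forall>e\<in>G. \<not> op e G) \<and> m \<le> card {e\<in>pairs M. op e G}) :: real)"
      by (auto simp: of_bool_def)
  qed (use p in auto)
  also have "\<dots> \<le> (1 - p) ^ m"
  proof (rule expect_no_open_le[where rank = "\<lambda>e. - int (snd e)", OF finite_pairs p])
    show "op e G \<longleftrightarrow> op e {g\<in>G. - int (snd g) < - int (snd e)}" for e G
      by (auto simp: op_def)
  qed
  finally show ?thesis .
qed

lemma expect_exists_no_survivor_le:
  fixes \<phi> \<phi>' :: "'v \<Rightarrow> nat" and p :: real
  assumes p: "0 \<le> p" "p < 1" and V: "finite V" "\<phi> ` V \<subseteq> {..<M}"
    and G': "G' \<subseteq> pairs M" "spread_out V \<phi>' s M G'"
    and s: "30 \<le> s" "16 * m \<le> s ^ 2"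
  shows "expect p (pairs M) (\<lambda>G. of_bool (spread_out V \<phi> s M G \<and>
    (\<exists>I\<subseteq>V. card I = s \<and> inj_on \<phi> I \<and> (\<forall>u\<in>I. \<forall>v\<in>I. \<not> survives \<phi> G \<phi>' G' u v)))) \<le> real (card V) ^ s * (1 - p) ^ m"
proof -
  define \<I> where "\<I> = {I. I \<subseteq> V \<and> card I = s \<and> inj_on \<phi> I}"
  have fI: "finite \<I>" using V by (simp add: \<I>_def)
  have "card \<I> \<le> card {I. I \<subseteq> V \<and> card I = s}" using V by (intro card_mono) (auto simp: \<I>_def)
  then have cI: "card \<I> \<le> card V ^ s" using card_subsets_le[OF V(1), of s] by linarith
  let ?E = "\<lambda>I G. 5 * (\<Sum>w<M. card (nbhd \<phi> G I w) ^ 2) \<le> s ^ 2 \<and> (\<forall>u\<in>I. \<forall>v\<in>I. \<not> survives \<phi> G \<phi>' G' u v)"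
  have "expect p (pairs M) (\<lambda>G. of_bool (spread_out V \<phi> s M G \<and>
      (\<exists>I\<subseteq>V. card I = s \<and> inj_on \<phi> I \<and> (\<forall>u\<in>I. \<forall>v\<in>I. \<not> survives \<phi> G \<phi>' G' u v)))) \<le>
    expect p (pairs M) (\<lambda>G. of_bool (\<exists>I\<in>\<I>. ?E I G))"
  proof (rule expect_mono)
    fix G
    have "(spread_out V \<phi> s M G \<and> (\<exists>I\<subseteq>V. card I = s \<and> inj_on \<phi> I \<and> (\<forall>u\<in>I. \<forall>v\<in>I. \<not> survives \<phi> G \<phi>' G' u v)))
      \<longrightarrow> (\<exists>I\<in>\<I>. ?E I G)"
      unfolding spread_out_def \<I>_def by blast
    then show "of_bool (spread_out V \<phi> s M G \<and> (\<exists>I\<subseteq>V. card I = s \<and> inj_on \<phi> I \<and> (\<forall>u\<in>I. \<forall>v\<in>I. \<not> survives \<phi> G \<phi>' G' u v)))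
      \<le> (of_bool (\<exists>I\<in>\<I>. ?E I G) :: real)"
      by (simp only: of_bool_def split: if_split) simp
  qed (use p in auto)
  also have "\<dots> \<le> (\<Sum>I\<in>\<I>. expect p (pairs M) (\<lambda>G. of_bool (?E I G)))"
    using p fI by (intro expect_union_bound) auto
  also have "\<dots> \<le> (\<Sum>I\<in>\<I>. (1 - p) ^ m)"
  proof (rule sum_mono)
    fix I assume "I \<in> \<I>"
    then have I: "I \<subseteq> V" "card I = s" "inj_on \<phi> I" by (auto simp: \<I>_def)
    show "expect p (pairs M) (\<lambda>G. of_bool (?E I G)) \<le> (1 - p) ^ m"
    proof (rule expect_no_survivor_le[OF p _ I(2,3) _ G'(1) _ s])
      show "finite I" "\<phi> ` I \<subseteq> {..<M}" using I V finite_subset by auto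
      show "5 * (\<Sum>w<M. card (nbhd \<phi>' G' I w) ^ 2) \<le> s ^ 2" using G'(2) I by (auto simp: spread_out_def)
    qed
  qed
  also have "\<dots> \<le> real (card V) ^ s * (1 - p) ^ m"
  proof -
    have "real (card \<I>) \<le> real (card V ^ s)" using cI by (simp only: of_nat_le_iff)
    then show ?thesis using p by (simp add: mult_right_mono)
  qed
  finally show ?thesis .
qed

text \<open>Four failures, each of probability at most \<open>1 / 8\<close>: one of the graphs is
  not spread out, or both are and some \<open>s\<close>-set has no survivor of the first, or of the
  second, colour. By \<open>expect_swap\<close> each colour is treated with the other graph
  fixed.\<close>

lemma two_bites:
  fixes \<phi>1 \<phi>2 :: "'v \<Rightarrow> nat" and p :: real
  assumes p: "0 \<le> p" "p < 1" and V: "finite V" "\<phi>1 ` V \<subseteq> {..<M}" "\<phi>2 ` V \<subseteq> {..<M}"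
    and cover: "\<And>I. I \<subseteq> V \<Longrightarrow> card I = k \<Longrightarrow> \<exists>I'\<subseteq>I. card I' = s \<and> (inj_on \<phi>1 I' \<or> inj_on \<phi>2 I')"
    and spread: "expect p (pairs M) (\<lambda>G. of_bool (\<not> spread_out V \<phi>1 s M G)) \<le> 1 / 8"
      "expect p (pairs M) (\<lambda>G. of_bool (\<not> spread_out V \<phi>2 s M G)) \<le> 1 / 8"
    and s: "30 \<le> s" "16 * m \<le> s ^ 2" and small: "real (card V) ^ s * (1 - p) ^ m \<le> 1 / 8"
  shows "\<not> ramsey_arrow (card V) 3 k"
proof -
  define N where "N \<phi> G \<phi>' G' \<longleftrightarrow> (\<exists>I\<subseteq>V. card I = s \<and> inj_on \<phi> I \<and> (\<forall>u\<in>I. \<forall>v\<in>I. \<not> survives \<phi> G \<phi>' G' u v))"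
    for \<phi> \<phi>' :: "'v \<Rightarrow> nat" and G G'
  let ?s1 = "spread_out V \<phi>1 s M" and ?s2 = "spread_out V \<phi>2 s M"
  let ?E = "expect p (pairs M)"
  have p': "0 \<le> p" "p \<le> 1" using p by auto
  have N1: "?E (\<lambda>G1. of_bool (?s2 G2) * of_bool (?s1 G1 \<and> N \<phi>1 G1 \<phi>2 G2)) \<le> 1 / 8" if "G2 \<subseteq> pairs M" for G2
  proof (cases "?s2 G2")
    case True
    then show ?thesis
      using expect_exists_no_survivor_le[OF p V(1,2) that True s] small by (simp add: N_def)
  qed simp
  have N2: "?E (\<lambda>G2. of_bool (?s1 G1) * of_bool (?s2 G2 \<and> N \<phi>2 G2 \<phi>1 G1)) \<le> 1 / 8" if "G1 \<subseteq> pairs M" for G1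
  proof (cases "?s1 G1")
    case True
    then show ?thesis
      using expect_exists_no_survivor_le[OF p V(1,3) that True s] small by (simp add: N_def)
  qed simp
  \<comment> \<open>The first factor depends on the fixed graph alone and restricts it to being
    spread out, as the bound for the exposed graph demands.\<close>
  let ?f1 = "\<lambda>G1 G2. of_bool (?s2 G2) * of_bool (?s1 G1 \<and> N \<phi>1 G1 \<phi>2 G2) :: real"
  let ?f2 = "\<lambda>G1 G2. of_bool (?s1 G1) * of_bool (?s2 G2 \<and> N \<phi>2 G2 \<phi>1 G1) :: real"
  have "?E (\<lambda>G1. ?E (\<lambda>G2. (of_bool (\<not> ?s1 G1) + of_bool (\<not> ?s2 G2)) + (?f1 G1 G2 + ?f2 G1 G2))) =
      (?E (\<lambda>G1. of_bool (\<not> ?s1 G1)) + ?E (\<lambda>G2. of_bool (\<not> ?s2 G2))) + (?E (\<lambda>G2. ?E (\<lambda>G1. ?f1 G1 G2)) + ?E (\<lambda>G1. ?E (\<lambda>G2. ?f2 G1 G2)))"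
    unfolding expect_add expect_swap[of p "pairs M" p "pairs M" ?f1] by simp
  also have "\<dots> \<le> (1 / 8 + 1 / 8) + (?E (\<lambda>_. 1 / 8) + ?E (\<lambda>_. 1 / 8))"
    by (intro add_mono spread expect_mono p' N1 N2)
  also have "\<dots> < 1" by simp
  finally obtain G1 where G1: "G1 \<subseteq> pairs M"
    and "?E (\<lambda>G2. (of_bool (\<not> ?s1 G1) + of_bool (\<not> ?s2 G2)) + (?f1 G1 G2 + ?f2 G1 G2)) < 1"
    using expect_lessD[OF _ finite_pairs p'] by blast
  then obtain G2 where G2: "G2 \<subseteq> pairs M"
    and lt: "(of_bool (\<not> ?s1 G1) + of_bool (\<not> ?s2 G2)) + (?f1 G1 G2 + ?f2 G1 G2) < 1"
    using expect_lessD[OF _ finite_pairs p'] by blast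
  from lt have no: "\<not> N \<phi>1 G1 \<phi>2 G2" "\<not> N \<phi>2 G2 \<phi>1 G1"
    by (cases "?s1 G1"; cases "?s2 G2"; cases "N \<phi>1 G1 \<phi>2 G2"; cases "N \<phi>2 G2 \<phi>1 G1"; simp)+
  define R where "R u v \<longleftrightarrow> survives \<phi>1 G1 \<phi>2 G2 u v \<or> survives \<phi>2 G2 \<phi>1 G1 u v" for u v
  show ?thesis
  proof (rule not_ramsey_arrowI[where V = V and adj = R])
    show "R y x" if "R x y" for x y 
      using that survives_commute[of \<phi>1 G1 \<phi>2 G2 x y] survives_commute[of \<phi>2 G2 \<phi>1 G1 x y]
      unfolding R_def by blast
  next
    fix W assume "W \<subseteq> V" "card W = 3"
    then obtain u v w where W: "W = {u,v,w}" "u \<noteq> v" "v \<noteq> w" "u \<noteq> w" by (auto simp: card_3_iff)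
    have "\<not> (R u v \<and> R v w \<and> R u w)"
      using survives_triangle_free[OF G1 G2, of \<phi>1 \<phi>2] unfolding R_def by blast
    then show "\<exists>x\<in>W. \<exists>y\<in>W. x \<noteq> y \<and> \<not> R x y" using W by auto
  next
    fix W assume W: "W \<subseteq> V" "card W = k"
    from cover[OF this] obtain I where I: "I \<subseteq> W" "card I = s" "inj_on \<phi>1 I \<or> inj_on \<phi>2 I" by blast
    then have "I \<subseteq> V" using W by blast
    with I no obtain u v where uv: "u \<in> I" "v \<in> I" "R u v" unfolding N_def R_def by blast
    then have "u \<noteq> v" using adj_pairs[OF G1] adj_pairs[OF G2] unfolding R_def survives_def by blast
    with uv I show "\<exists>x\<in>W. \<exists>y\<in>W. x \<noteq> y \<and> R x y" by blast
  qed (use V in auto)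
qed

section \<open>A locally sparse pair of projections\<close>

lemma card_PiE_constrained:
  assumes V: "finite V" and K: "K \<subseteq> V" and T: "T \<subseteq> {..<M}" and M: "0 < M"
  shows "real (card {f \<in> V \<rightarrow>\<^sub>E {..<M}. \<forall>v\<in>K. f v \<in> T}) = (real (card T) / real M) ^ card K * real M ^ card V"
proof -
  have eq: "{f \<in> V \<rightarrow>\<^sub>E {..<M}. \<forall>v\<in>K. f v \<in> T} = PiE V (\<lambda>v. if v \<in> K then T else {..<M})"
  proof (intro set_eqI iffI)
    fix f assume f: "f \<in> PiE V (\<lambda>v. if v \<in> K then T else {..<M})"
    have m: "f v \<in> (if v \<in> K then T else {..<M})" if "v \<in> V" for v using PiE_mem[OF f that] .
    have "f v \<in> {..<M}" if "v \<in> V" for v using m[OF that] T by (auto split: if_splits)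
    moreover have "f v \<in> T" if "v \<in> K" for v using m[of v] that K by auto
    ultimately show "f \<in> {f \<in> V \<rightarrow>\<^sub>E {..<M}. \<forall>v\<in>K. f v \<in> T}" using f by (simp add: PiE_iff)
  qed (auto simp: PiE_iff)
  have VK: "V \<inter> K = K" "V \<inter> - K = V - K" using K by auto
  have fK: "finite K" using K V finite_subset by blast
  have "card {f \<in> V \<rightarrow>\<^sub>E {..<M}. \<forall>v\<in>K. f v \<in> T} = (\<Prod>v\<in>V. if v \<in> K then card T else M)"
    unfolding eq by (simp add: card_PiE[OF V] if_distrib[of card] cong: if_cong)
  also have "\<dots> = card T ^ card K * M ^ (card V - card K)"
    using V fK K by (simp add: prod.If_cases VK card_Diff_subset)
  finally have "real (card {f \<in> V \<rightarrow>\<^sub>E {..<M}. \<forall>v\<in>K. f v \<in> T}) = real (card T) ^ card K * real M ^ (card V - card K)"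
    by simp
  moreover have "card K \<le> card V" using V K by (rule card_mono)
  ultimately show ?thesis using M by (simp add: power_diff power_divide)
qed

text \<open>A uniformly random \<open>f\<close>, in the form of a count. Think of \<open>v\<close>
  as an edge from \<open>fst v\<close> to \<open>f v\<close>. One union bound is over
  \<open>F\<close>-sets mapped to a point, the other over \<open>S\<close>, \<open>T\<close> and
  \<open>k\<close> edges at \<open>S\<close> sent into \<open>T\<close>; the factor
  \<open>2 ^ (s * t)\<close> counts all subsets of the \<open>s * t\<close> edges at
  \<open>S\<close>.\<close>

lemma exists_sparse_map:
  fixes M t s k F :: nat
  defines "V \<equiv> {..<M} \<times> {..<t}"
  assumes M: "0 < M"
    and small: "real M ^ (2 * s) * 2 ^ (s * t) * (real s / real M) ^ k + real M * (real t ^ F / fact F) < 1"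
  obtains f where "f ` V \<subseteq> {..<M}" "\<And>a. card {v\<in>V. f v = a} \<le> F"
    "\<And>S T. S \<subseteq> {..<M} \<Longrightarrow> T \<subseteq> {..<M} \<Longrightarrow> card S = s \<Longrightarrow> card T = s \<Longrightarrow> card {v\<in>V. fst v \<in> S \<and> f v \<in> T} < k"
proof -
  define \<Omega> where "\<Omega> = V \<rightarrow>\<^sub>E {..<M}"
  define Sub where "Sub = {S. S \<subseteq> {..<M} \<and> card S = s}"
  define J1 where "J1 = {..<M} \<times> {K. K \<subseteq> V \<and> card K = F}"
  define J2 where "J2 = (SIGMA S:Sub. Sub \<times> {K. K \<subseteq> S \<times> {..<t} \<and> card K = k})"
  define B1 where "B1 = (\<lambda>(a,K). {f\<in>\<Omega>. \<forall>v\<in>K. f v \<in> {a}})"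
  define B2 where "B2 = (\<lambda>(S::nat set,T,K). {f\<in>\<Omega>. \<forall>v\<in>K. f v \<in> T})"
  have fV: "finite V" and cV: "card V = M * t" by (simp_all add: V_def card_cartesian_product)
  have fO: "finite \<Omega>" and cO: "card \<Omega> = M ^ card V"
    unfolding \<Omega>_def using fV by (auto simp: card_PiE intro: finite_PiE)
  have fSub: "finite Sub" and cSub: "card Sub \<le> M ^ s"
    using card_subsets_le[of "{..<M}" s] by (simp_all add: Sub_def)
  have finS: "finite S" if "S \<in> Sub" for S using that finite_subset by (auto simp: Sub_def)
  have fJ1: "finite J1" using fV by (simp add: J1_def)
  have fJ2: "finite J2" unfolding J2_def using fSub finS by (intro finite_SigmaI finite_cartesian_product) auto
  have c1: "real (card (B1 j)) = (1 / real M) ^ F * real M ^ card V" if "j \<in> J1" for j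
  proof -
    obtain a K where j: "j = (a,K)" "a < M" "K \<subseteq> V" "card K = F" using \<open>j \<in> J1\<close> by (auto simp: J1_def)
    then show ?thesis using card_PiE_constrained[OF fV j(3) _ M, of "{a}"] by (simp add: B1_def \<Omega>_def)
  qed
  have c2: "real (card (B2 j)) = (real s / real M) ^ k * real M ^ card V" if "j \<in> J2" for j
  proof -
    obtain S T K where j: "j = (S,T,K)" by (cases j)
    have J: "S \<in> Sub" "T \<in> Sub" "K \<subseteq> S \<times> {..<t}" "card K = k" using that by (auto simp: j J2_def)
    then have "K \<subseteq> V" by (auto simp: V_def Sub_def)
    then show ?thesis using card_PiE_constrained[OF fV _ _ M, of K T] J by (simp add: B2_def j \<Omega>_def Sub_def)
  qed
  have cJ1: "real (card J1) \<le> real M * ((real M * real t) ^ F / fact F)"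
  proof -
    have "real ((M * t choose F) * fact F) \<le> real ((M * t) ^ F)"
      using binomial_fact_pow[of "M * t" F] by (simp only: of_nat_le_iff)
    then have "real (M * t choose F) \<le> (real M * real t) ^ F / fact F"
      by (simp add: pos_le_divide_eq)
    then have "real M * real (M * t choose F) \<le> real M * ((real M * real t) ^ F / fact F)"
      by (intro mult_left_mono) auto
    moreover have "card J1 = M * (M * t choose F)"
      unfolding J1_def using fV by (simp add: card_cartesian_product n_subsets cV)
    ultimately show ?thesis by simp
  qed
  have cJ2: "real (card J2) \<le> real M ^ (2 * s) * 2 ^ (s * t)"
  proof -
    have "card J2 = (\<Sum>S\<in>Sub. card (Sub \<times> {K. K \<subseteq> S \<times> {..<t} \<and> card K = k}))"
      unfolding J2_def using fSub finS by (intro card_SigmaI) auto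
    also have "\<dots> \<le> (\<Sum>S\<in>Sub. M ^ s * 2 ^ (s * t))"
    proof (rule sum_mono)
      fix S assume S: "S \<in> Sub"
      have "card {K. K \<subseteq> S \<times> {..<t} \<and> card K = k} \<le> card (Pow (S \<times> {..<t}))"
        using finS[OF S] by (intro card_mono) auto
      also have "\<dots> = 2 ^ (s * t)" using finS[OF S] S by (simp add: card_Pow card_cartesian_product Sub_def)
      finally show "card (Sub \<times> {K. K \<subseteq> S \<times> {..<t} \<and> card K = k}) \<le> M ^ s * 2 ^ (s * t)"
        using cSub by (simp add: card_cartesian_product mult_mono)
    qed
    also have "\<dots> = card Sub * (M ^ s * 2 ^ (s * t))" by simp
    also have "\<dots> \<le> M ^ s * (M ^ s * 2 ^ (s * t))" using cSub by (intro mult_right_mono) auto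
    also have "\<dots> = M ^ (2 * s) * 2 ^ (s * t)" by (simp add: mult_2 power_add)
    finally have "real (card J2) \<le> real (M ^ (2 * s) * 2 ^ (s * t))" by (simp only: of_nat_le_iff)
    then show ?thesis by simp
  qed
  define Bad where "Bad = (\<Union>j\<in>J1. B1 j) \<union> (\<Union>j\<in>J2. B2 j)"
  have "card Bad \<le> (\<Sum>j\<in>J1. card (B1 j)) + (\<Sum>j\<in>J2. card (B2 j))"
    unfolding Bad_def using card_UN_le[OF fJ1, of B1] card_UN_le[OF fJ2, of B2] card_Un_le
    by (meson add_mono order_trans)
  then have "real (card Bad) \<le> (\<Sum>j\<in>J1. real (card (B1 j))) + (\<Sum>j\<in>J2. real (card (B2 j)))"
    unfolding of_nat_sum[symmetric] of_nat_add[symmetric] of_nat_le_iff .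
  also have "\<dots> = real (card J1) * ((1 / real M) ^ F * real M ^ card V) + real (card J2) * ((real s / real M) ^ k * real M ^ card V)"
    using c1 c2 by simp
  also have "\<dots> \<le> real M * ((real M * real t) ^ F / fact F) * ((1 / real M) ^ F * real M ^ card V) +
      real M ^ (2 * s) * 2 ^ (s * t) * ((real s / real M) ^ k * real M ^ card V)"
    using cJ1 cJ2 by (intro add_mono mult_right_mono) auto
  also have "\<dots> = (real M ^ (2 * s) * 2 ^ (s * t) * (real s / real M) ^ k + real M * (real t ^ F / fact F)) * real M ^ card V"
    using M by (simp add: power_mult_distrib power_one_over field_simps)
  also have "\<dots> < 1 * real M ^ card V" using small M by (intro mult_strict_right_mono) auto
  also have "\<dots> = real (card \<Omega>)" by (simp add: cO)
  finally have "card Bad < card \<Omega>" by simp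
  moreover have "Bad \<subseteq> \<Omega>" by (auto simp: Bad_def B1_def B2_def)
  ultimately obtain f where f: "f \<in> \<Omega>" "f \<notin> Bad" by (metis less_irrefl subsetI subset_antisym)
  show ?thesis
  proof (rule that)
    show fV: "f ` V \<subseteq> {..<M}" using f by (auto simp: \<Omega>_def)
    show "card {v\<in>V. f v = a} \<le> F" for a
    proof (rule ccontr)
      assume n: "\<not> card {v\<in>V. f v = a} \<le> F"
      then obtain K where K: "K \<subseteq> {v\<in>V. f v = a}" "card K = F" by (meson linear obtain_subset_with_card_n)
      have "{v\<in>V. f v = a} \<noteq> {}" using n by (intro notI) simp
      then have "a < M" using fV by auto
      then have "(a,K) \<in> J1" using K by (auto simp: J1_def)
      moreover have "f \<in> B1 (a,K)" using f K by (auto simp: B1_def)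
      ultimately show False using f by (auto simp: Bad_def)
    qed
    show "card {v\<in>V. fst v \<in> S \<and> f v \<in> T} < k" if ST: "S \<subseteq> {..<M}" "T \<subseteq> {..<M}" "card S = s" "card T = s" for S T
    proof (rule ccontr)
      assume "\<not> card {v\<in>V. fst v \<in> S \<and> f v \<in> T} < k"
      then obtain K where K: "K \<subseteq> {v\<in>V. fst v \<in> S \<and> f v \<in> T}" "card K = k"
        by (meson not_less obtain_subset_with_card_n)
      then have "K \<subseteq> S \<times> {..<t}" by (auto simp: V_def)
      then have "(S,T,K) \<in> J2" using K ST by (auto simp: J2_def Sub_def)
      moreover have "f \<in> B2 (S,T,K)" using f K by (auto simp: B2_def)
      ultimately show False using f by (auto simp: Bad_def)
    qed
  qed
qed

text \<open>If both projections of \<open>I\<close> had fewer than \<open>s\<close> values, the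
  values would fit into two \<open>s\<close>-sets spanning at least \<open>k\<close> edges. So one
  projection has \<open>s\<close> values, and a preimage of each forms \<open>I'\<close>.\<close>

lemma sparse_map_cover:
  fixes M t s k :: nat
  defines "V \<equiv> {..<M} \<times> {..<t}"
  assumes f: "f ` V \<subseteq> {..<M}" and sM: "s \<le> M"
    and sparse: "\<And>S T. S \<subseteq> {..<M} \<Longrightarrow> T \<subseteq> {..<M} \<Longrightarrow> card S = s \<Longrightarrow> card T = s \<Longrightarrow> card {v\<in>V. fst v \<in> S \<and> f v \<in> T} < k"
    and I: "I \<subseteq> V" "card I = k"
  shows "\<exists>I'\<subseteq>I. card I' = s \<and> (inj_on fst I' \<or> inj_on f I')"
proof -
  have fV: "finite V" by (simp add: V_def)
  have large: "\<exists>I'\<subseteq>I. card I' = s \<and> inj_on g I'" if "s \<le> card (g ` I)" for g :: "nat \<times> nat \<Rightarrow> nat"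
  proof -
    obtain T where T: "T \<subseteq> g ` I" "card T = s" using \<open>s \<le> card (g ` I)\<close> by (rule obtain_subset_with_card_n)
    then obtain I' where "I' \<subseteq> I" "inj_on g I'" "T = g ` I'" by (auto simp: subset_image_inj)
    then show ?thesis using T(2) card_image[of g I'] by auto
  qed
  show ?thesis
  proof (cases "s \<le> card (fst ` I) \<or> s \<le> card (f ` I)")
    case True
    then show ?thesis using large[of fst] large[of f] by blast
  next
    case False
    have sub: "fst ` I \<subseteq> {..<M}" "f ` I \<subseteq> {..<M}" using I f by (auto simp: V_def)
    obtain S where S: "fst ` I \<subseteq> S" "S \<subseteq> {..<M}" "card S = s"
      using exists_subset_between[of "fst ` I" s "{..<M}"] False sub sM by auto
    obtain T where T: "f ` I \<subseteq> T" "T \<subseteq> {..<M}" "card T = s"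
      using exists_subset_between[of "f ` I" s "{..<M}"] False sub sM by auto
    have "card I \<le> card {v\<in>V. fst v \<in> S \<and> f v \<in> T}"
      using fV S T I by (intro card_mono) auto
    with sparse[OF S(2) T(2) S(3) T(3)] I show ?thesis by simp
  qed
qed

section \<open>The lower bound on r(3,n): choice of parameters\<close>

lemma power_over_fact_le_exp:
  fixes x :: real
  assumes "0 \<le> x"
  shows "x ^ n / fact n \<le> exp x"
proof -
  have s: "(\<lambda>n. x ^ n /\<^sub>R fact n) sums exp x" by (rule exp_converges)
  have "(\<Sum>i\<in>{n}. x ^ i /\<^sub>R fact i) \<le> (\<Sum>i. x ^ i /\<^sub>R fact i)"
    using assms s by (intro sum_le_suminf) (auto simp: sums_iff)
  then show ?thesis using s by (simp add: sums_iff divide_inverse mult.commute)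
qed


text \<open>Here \<open>b\<close> plays the role of \<open>log M\<close>: there are
  \<open>b * M\<close> vertices with \<open>M = 4096 ^ b\<close>, and independent sets are smaller
  than a constant times \<open>b * sqrt M\<close>, which is the order
  \<open>n^2 / log n\<close>.\<close>

lemma eventually_not_ramsey_arrow_3:
  "\<forall>\<^sub>F b in sequentially. \<not> ramsey_arrow (b * 2 ^ (12 * b)) 3 (6 * (2 ^ 17 * b * 2 ^ (6 * b)))"
proof -
  have "\<forall>\<^sub>F b in sequentially. 2 ^ 17 * real b * 64 ^ b + 16 ^ b * (2 ^ 14 * real b ^ 2) \<le> (128::real) ^ b"
    by real_asymp
  moreover have "\<forall>\<^sub>F b in sequentially. real b \<le> 4 ^ b" by real_asymp
  moreover have "\<forall>\<^sub>F b in sequentially. 13 * 2 ^ 17 * real b ^ 2 * 64 ^ b + 6 \<le> 2 ^ 15 * real b * 128 ^ b"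
    by real_asymp
  moreover have "\<forall>\<^sub>F b in sequentially. (4096::real) ^ b * exp (- (64 ^ b / 4)) \<le> 1 / 32" by real_asymp
  moreover have "\<forall>\<^sub>F b in sequentially. 2 ^ 102 * real b ^ 6 * 2 ^ b \<le> (1 / 4) * (4096::real) ^ b" by real_asymp
  moreover have "\<forall>\<^sub>F b in sequentially. 2 ^ 17 * real b \<le> (64::real) ^ b" by real_asymp
  moreover have "\<forall>\<^sub>F b in sequentially. 1 \<le> b" by (rule eventually_ge_at_top)
  ultimately show ?thesis
  proof eventually_elim
    case (elim b)
    \<comment> \<open>\<open>x = sqrt M\<close>, so that \<open>p = 1 / (512 * x)\<close>
      corresponds to \<open>\<epsilon> = 1 / 512\<close>.\<close>
    define x :: nat where "x = 2 ^ (6 * b)"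
    define M :: nat where "M = 2 ^ (12 * b)"
    \<comment> \<open>With \<open>2 ^ 17\<close> the exponent \<open>m * p\<close> equals
      \<open>16 * b * s\<close>, which beats the \<open>13 * b * s\<close> from the at most
      \<open>exp (13 * b * s)\<close> sets of size \<open>s\<close>.\<close>
    define s where "s = 2 ^ 17 * b * x"
    \<comment> \<open>Proportional to \<open>b\<close>, like \<open>s / x\<close>: then
      \<open>18 * p * s / F = 9 / 16\<close> is constant and \<open>M * F^2\<close> is a small
      multiple of \<open>s^2\<close>, while \<open>20 * F * \<Delta> \<le> s\<close> still
      holds.\<close>
    define F where "F = 2 ^ 13 * b"
    \<comment> \<open>\<open>D\<close> and \<open>h\<close> are \<open>x\<close> to the powers
      \<open>5/6\<close> and \<open>1/3\<close>: their product exceeds \<open>s\<close>, which is of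
      order \<open>b * x\<close>, and \<open>h^2 * F * q\<close> is only of order \<open>b^2\<close>
      times \<open>x\<close> to the power \<open>2/3\<close>.\<close>
    define D :: nat where "D = 2 ^ (5 * b)"
    define h :: nat where "h = 2 ^ (2 * b)"
    \<comment> \<open>As \<open>M * p^2 = 2^-18\<close>, this \<open>q\<close> yields
      \<open>2 ^ (- 36 * b)\<close>, against the \<open>M^2 = 2 ^ (24 * b)\<close> pairs of
      indices.\<close>
    define q where "q = 2 * b"
    define \<Delta> where "\<Delta> = x div 2"
    \<comment> \<open>Exactly \<open>s^2 / 16\<close>.\<close>
    define m where "m = 2 ^ 30 * b ^ 2 * x ^ 2"
    define y where "y = real x"
    define p where "p = 1 / (512 * y)"
    define B where "B = real b"
    define V where "V = {..<M} \<times> {..<b}"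
    have b: "1 \<le> b" "1 \<le> B" using elim by (auto simp: B_def)
    have y: "y = 64 ^ b" by (simp add: y_def x_def power_mult)
    have y1: "1 \<le> y" by (simp add: y)
    have rM: "real M = y ^ 2" and rM': "real M = 4096 ^ b"
      by (simp_all add: y M_def power_mult power_mult_distrib[symmetric] power2_eq_square)
    have rD: "real D = 32 ^ b" by (simp add: D_def power_mult)
    have rs: "real s = 2 ^ 17 * B * y" by (simp add: s_def y_def B_def)
    have rF: "real F = 2 ^ 13 * B" by (simp add: F_def B_def)
    have hD: "real (h * D) = 128 ^ b" and h2: "real (h ^ 2) = 16 ^ b"
      by (simp_all add: h_def D_def power_mult power_mult_distrib[symmetric] power2_eq_square)
    have p: "0 < p" "p < 1" "p \<le> 1" using y1 by (auto simp: p_def)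
    have pos: "0 < M" "0 < F" "0 < D" "0 < h" "1 \<le> s" using b by (auto simp: M_def F_def D_def h_def s_def x_def)
    have fV: "finite V" and cV: "card V = M * b" by (simp_all add: V_def card_cartesian_product)
    have num: "s + h ^ 2 * (F * q) \<le> h * D" "h ^ 2 * (F * q) \<le> s" "20 * F * \<Delta> \<le> s"
    proof -
      have hFq: "real (h ^ 2 * (F * q)) = 16 ^ b * (2 ^ 14 * B ^ 2)"
        unfolding of_nat_mult h2 by (simp add: F_def q_def B_def power2_eq_square)
      have "real (s + h ^ 2 * (F * q)) \<le> real (h * D)"
        unfolding hD of_nat_add hFq rs using elim(1) by (simp add: y B_def)
      then show "s + h ^ 2 * (F * q) \<le> h * D" by (simp only: of_nat_le_iff)
      have "2 ^ 14 * 16 ^ b * B * B \<le> 2 ^ 14 * 16 ^ b * B * (4 ^ b)"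
        using elim(2) b by (intro mult_left_mono) (auto simp: B_def)
      also have "\<dots> = 2 ^ 14 * B * y" by (simp add: y power_mult_distrib[symmetric])
      also have "\<dots> \<le> 2 ^ 17 * B * y" using b y1 by (intro mult_right_mono) auto
      finally have "real (h ^ 2 * (F * q)) \<le> real s" unfolding hFq rs by (simp add: power2_eq_square mult_ac)
      then show "h ^ 2 * (F * q) \<le> s" by (simp only: of_nat_le_iff)
      have "20 * F * \<Delta> \<le> 10 * F * x" by (simp add: \<Delta>_def)
      also have "\<dots> \<le> s" by (simp add: F_def s_def)
      finally show "20 * F * \<Delta> \<le> s" .
    qed
    have e2: "(2::real) \<le> exp 1" using exp_ge_add_one_self[of 1] by simp
    have cV_exp: "real (card V) ^ s \<le> exp (13 * B * real s)"
    proof -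
      have "card V \<le> 2 ^ (12 * b) * 2 ^ b" unfolding cV M_def by (intro mult_left_mono) (auto simp: less_imp_le)
      also have "\<dots> = 2 ^ (13 * b)" by (simp flip: power_add)
      finally have "real (card V) \<le> real (2 ^ (13 * b))" by (simp only: of_nat_le_iff)
      also have "\<dots> = 2 ^ (13 * b)" by simp
      also have "\<dots> \<le> exp 1 ^ (13 * b)" using e2 by (intro power_mono) auto
      also have "\<dots> = exp (13 * B)" by (simp add: exp_of_nat_mult[symmetric] B_def)
      finally have "real (card V) ^ s \<le> exp (13 * B) ^ s" by (intro power_mono) auto
      then show ?thesis by (simp add: exp_of_nat_mult[symmetric] mult_ac)
    qed
    define \<theta> where "\<theta> = 1 / (real F * real D)"
    have spread: "expect p (pairs M) (\<lambda>G. of_bool (\<not> spread_out V \<phi> s M G)) \<le> 1 / 8"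
      if fib: "\<And>a. card {u\<in>V. \<phi> u = a} \<le> F" for \<phi> :: "nat \<times> nat \<Rightarrow> nat"
    proof -
      have \<theta>0: "0 < \<theta>" using pos by (simp add: \<theta>_def)
      have "18 * p * real s / real F = 9 / 16" using y1 b by (simp add: p_def rs rF)
      then have "exp (18 * p * real s / real F) \<le> 1 + 9 / 16 + (9 / 16) ^ 2"
        using exp_bound[of "9 / 16"] by (simp only:)
      then have "exp (18 * p * real s / real F) - 1 \<le> 225 / 256" by (simp add: power2_eq_square)
      then have "real M * (2 * \<theta> * real F ^ 2 * (exp (18 * p * real s / real F) - 1)) \<le>
          real M * (2 * \<theta> * real F ^ 2 * (225 / 256))"
        using \<theta>0 by (intro mult_left_mono) auto
      also have "\<dots> = 117964800 * (\<theta> * B ^ 2 * y ^ 2)"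
        by (simp add: rM rF power_mult_distrib)
      finally have main: "real M * (2 * \<theta> * real F ^ 2 * (exp (18 * p * real s / real F) - 1)) \<le>
          117964800 * (\<theta> * B ^ 2 * y ^ 2)" .
      \<comment> \<open>The coefficient \<open>2 ^ 34 / 40\<close> is about 429 million, the one in
        \<open>main\<close> about 118 million; the difference exceeds \<open>2 ^ 28\<close>.\<close>
      have saving: "\<theta> * (real s ^ 2 / 40) = 2 ^ 34 / 40 * (\<theta> * B ^ 2 * y ^ 2)"
        by (simp add: rs power_mult_distrib)
      have "2 ^ 28 * (\<theta> * B ^ 2 * y ^ 2) = 2 ^ 15 * B * 128 ^ b"
      proof -
        have "y ^ 2 = real D * 128 ^ b"
          by (simp add: y rD power_mult_distrib[symmetric] power2_eq_square)
        then show ?thesis using b pos by (simp add: \<theta>_def rF power2_eq_square)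
      qed
      moreover have "117964800 * (\<theta> * B ^ 2 * y ^ 2) - 2 ^ 34 / 40 * (\<theta> * B ^ 2 * y ^ 2) \<le> - (2 ^ 28 * (\<theta> * B ^ 2 * y ^ 2))"
        using \<theta>0 by simp
      ultimately have expo: "real M * (2 * \<theta> * real F ^ 2 * (exp (18 * p * real s / real F) - 1)) - \<theta> * (real s ^ 2 / 40) \<le>
          - (2 ^ 15 * B * 128 ^ b)" using main saving by linarith
      have low: "real (card V) ^ s * exp (real M * (2 * \<theta> * real F ^ 2 * (exp (18 * p * real s / real F) - 1)) - \<theta> * (real s ^ 2 / 40)) \<le> 1 / 64"
      proof -
        have "real (card V) ^ s * exp (real M * (2 * \<theta> * real F ^ 2 * (exp (18 * p * real s / real F) - 1)) - \<theta> * (real s ^ 2 / 40)) \<le>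
          exp (13 * B * real s) * exp (- (2 ^ 15 * B * 128 ^ b))"
          using cV_exp expo by (intro mult_mono) auto
        also have "\<dots> = exp (13 * B * real s - 2 ^ 15 * B * 128 ^ b)" by (simp add: mult_exp_exp)
        also have "\<dots> \<le> exp (- 6)"
          using elim(3) by (simp add: rs B_def y power2_eq_square algebra_simps)
        also have "\<dots> \<le> 1 / 64"
        proof -
          have "(2::real) ^ 6 \<le> exp 1 ^ 6" using e2 by (intro power_mono) auto
          then have "64 \<le> exp (6::real)" by (simp add: exp_of_nat_mult[of 6 1, simplified])
          then show ?thesis by (simp add: exp_minus inverse_eq_divide frac_le)
        qed
        finally show ?thesis .
      qed
      have deg: "real M * exp (2 * p * real M - real \<Delta>) \<le> 1 / 32"
      proof -
        have "even x" using b by (simp add: x_def)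
        then have "real \<Delta> = y / 2" by (simp add: \<Delta>_def y_def real_of_nat_div)
        moreover have "2 * p * real M = y / 256" using y1 by (simp add: p_def rM power2_eq_square)
        ultimately have "2 * p * real M - real \<Delta> \<le> - (y / 4)" using y1 by simp
        then have "real M * exp (2 * p * real M - real \<Delta>) \<le> real M * exp (- (y / 4))" by (intro mult_left_mono) auto
        also have "\<dots> \<le> 1 / 32" using elim(4) by (simp add: rM' y)
        finally show ?thesis .
      qed
      have codeg: "real M ^ 2 * (real M * p ^ 2) ^ q \<le> 1 / 32"
      proof -
        have Mp: "real M * p ^ 2 = 1 / 2 ^ 18" using y1 by (simp add: rM p_def power_divide power_mult_distrib)
        have "(real M * p ^ 2) ^ q = 1 / 2 ^ (36 * b)"
          unfolding Mp q_def by (simp add: power_divide power_mult)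
        moreover have "real M ^ 2 = 2 ^ (24 * b)"
        proof -
          have e: "24 * b = 12 * b * 2" by simp
          show ?thesis unfolding e by (simp only: power_mult M_def of_nat_power of_nat_numeral)
        qed
        ultimately have "real M ^ 2 * (real M * p ^ 2) ^ q = 2 ^ (24 * b) / 2 ^ (36 * b)" by simp
        also have "\<dots> = 1 / 2 ^ (12 * b)"
        proof -
          have "(2::real) ^ (36 * b) = 2 ^ (24 * b) * 2 ^ (12 * b)" by (simp flip: power_add)
          then show ?thesis by simp
        qed
        also have "\<dots> \<le> 1 / 2 ^ 5" using b by (intro divide_left_mono power_increasing) auto
        finally show ?thesis by simp
      qed
      have p0: "0 \<le> p" "p \<le> 1" using p by auto
      show ?thesis
        using expect_not_spread_out[OF p0 fV fib num pos(4,2,3), of M] low deg codeg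
        unfolding \<theta>_def by linarith
    qed
    \<comment> \<open>The 6 in \<open>6 * s\<close> makes \<open>M^2 * (s / M)^6\<close> of order
      \<open>b^6 / M\<close>, which also absorbs the factor \<open>2 ^ b\<close>.\<close>
    have small: "real M ^ (2 * s) * 2 ^ (s * b) * (real s / real M) ^ (6 * s) + real M * (real b ^ F / fact F) < 1"
    proof -
      have "real M ^ (2 * s) * 2 ^ (s * b) * (real s / real M) ^ (6 * s) = (real M ^ 2 * 2 ^ b * (real s / real M) ^ 6) ^ s"
        by (simp add: power_mult_distrib power_mult[symmetric] mult_ac)
      also have "real M ^ 2 * 2 ^ b * (real s / real M) ^ 6 = 2 ^ 102 * B ^ 6 * 2 ^ b / y ^ 2"
        using y1 by (simp add: rM rs power_divide power_mult_distrib field_simps flip: power_add power_mult)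
      also have "(2 ^ 102 * B ^ 6 * 2 ^ b / y ^ 2) ^ s \<le> (1 / 4) ^ s"
        using elim(5) y1 by (intro power_mono) (auto simp: B_def rM[symmetric] rM' divide_le_eq)
      also have "\<dots> \<le> (1 / 4) ^ 1" using pos by (intro power_decreasing) auto
      finally have 1: "real M ^ (2 * s) * 2 ^ (s * b) * (real s / real M) ^ (6 * s) \<le> 1 / 4" by simp
      \<comment> \<open>Since \<open>b = F / 2 ^ 13\<close>, the fibre term is at most
        \<open>(exp 1 / 2 ^ 13) ^ F\<close>, far below \<open>1 / M\<close>.\<close>
      have "real b ^ F / fact F = (1 / 2 ^ 13) ^ F * (real F ^ F / fact F)"
        by (simp add: rF B_def power_mult_distrib power_one_over)
      also have "\<dots> \<le> (1 / 2 ^ 13) ^ F * exp (real F)"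
        by (intro mult_left_mono power_over_fact_le_exp) auto
      also have "\<dots> = (exp 1 / 2 ^ 13) ^ F"
        by (simp add: exp_of_nat_mult[symmetric] power_divide power_one_over)
      also have "\<dots> \<le> (1 / 2 ^ 11) ^ F" using exp_le by (intro power_mono) auto
      also have "\<dots> \<le> (1 / 2 ^ 11) ^ (2 * b)" by (intro power_decreasing) (auto simp: F_def)
      also have "\<dots> = 1 / 2 ^ (22 * b)" by (simp add: power_one_over power_mult)
      finally have "real M * (real b ^ F / fact F) \<le> real M * (1 / 2 ^ (22 * b))" by (intro mult_left_mono) auto
      also have "\<dots> = 1 / 2 ^ (10 * b)"
      proof -
        have "(2::real) ^ (22 * b) = 2 ^ (12 * b) * 2 ^ (10 * b)" by (simp flip: power_add)
        then show ?thesis by (simp add: M_def)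
      qed
      also have "\<dots> \<le> 1 / 2 ^ 2" using b by (intro divide_left_mono power_increasing) auto
      also have "\<dots> = (1 / 4 :: real)" by simp
      finally have 2: "real M * (real b ^ F / fact F) \<le> 1 / 4" .
      show ?thesis using 1 2 by linarith
    qed
    obtain f where f: "f ` V \<subseteq> {..<M}" "\<And>a. card {v\<in>V. f v = a} \<le> F"
      "\<And>S T. S \<subseteq> {..<M} \<Longrightarrow> T \<subseteq> {..<M} \<Longrightarrow> card S = s \<Longrightarrow> card T = s \<Longrightarrow> card {v\<in>V. fst v \<in> S \<and> f v \<in> T} < 6 * s"
      by (rule exists_sparse_map[OF pos(1) small, folded V_def]) (rule that)
    have sM: "s \<le> M"
    proof -
      have "2 ^ 17 * B * y \<le> y * y" using elim(6) y1 by (intro mult_right_mono) (auto simp: B_def y)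
      then have "real s \<le> real M" by (simp add: rs rM power2_eq_square)
      then show ?thesis by simp
    qed
    have "\<not> ramsey_arrow (card V) 3 (6 * s)"
    proof (rule two_bites[of p V fst M f "6 * s" s m])
      show "\<exists>I'\<subseteq>I. card I' = s \<and> (inj_on fst I' \<or> inj_on f I')" if "I \<subseteq> V" "card I = 6 * s" for I
        by (rule sparse_map_cover[of f M b s "6 * s" I, folded V_def, OF f(1) sM f(3) that])
      show "expect p (pairs M) (\<lambda>G. of_bool (\<not> spread_out V fst s M G)) \<le> 1 / 8"
      proof (rule spread)
        fix a
        have "{u\<in>V. fst u = a} \<subseteq> {a} \<times> {..<b}" by (auto simp: V_def)
        then have "card {u\<in>V. fst u = a} \<le> card ({a} \<times> {..<b})" by (intro card_mono) auto
        also have "\<dots> \<le> F" by (simp add: card_cartesian_product F_def)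
        finally show "card {u\<in>V. fst u = a} \<le> F" .
      qed
      show "expect p (pairs M) (\<lambda>G. of_bool (\<not> spread_out V f s M G)) \<le> 1 / 8"
        by (rule spread[OF f(2)])
      have "x \<ge> 1" by (simp add: x_def)
      then have "1 * 1 \<le> b * x" using b by (intro mult_mono) auto
      then have "30 * (1 * 1) \<le> 2 ^ 17 * (b * x)" by (intro mult_le_mono) auto
      then show "30 \<le> s" by (simp add: s_def mult.assoc)
      show "16 * m \<le> s ^ 2" by (simp add: m_def s_def power_mult_distrib)
      show "real (card V) ^ s * (1 - p) ^ m \<le> 1 / 8"
      proof -
        have "(1 - p) ^ m \<le> exp (- p) ^ m" using p exp_ge_add_one_self[of "- p"] by (intro power_mono) auto
        also have "\<dots> = exp (- (16 * B * real s))"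
        proof -
          have "real m * p = 16 * B * real s"
            using y1 by (simp add: m_def p_def rs B_def y_def[symmetric] power2_eq_square)
          then show ?thesis by (simp add: exp_of_nat_mult[symmetric])
        qed
        finally have "real (card V) ^ s * (1 - p) ^ m \<le> exp (13 * B * real s) * exp (- (16 * B * real s))"
          using cV_exp p by (intro mult_mono) auto
        also have "\<dots> = exp (- (3 * (B * real s)))" by (simp add: mult_exp_exp)
        also have "\<dots> \<le> exp (- 3)"
        proof -
          have "1 * 1 \<le> B * real s" using b pos by (intro mult_mono) auto
          then show ?thesis by simp
        qed
        also have "\<dots> \<le> 1 / 8"
        proof -
          have "(2::real) ^ 3 \<le> exp 1 ^ 3" using e2 by (intro power_mono) auto
          then have "8 \<le> exp (3::real)" by (simp add: exp_of_nat_mult[of 3 1, simplified])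
          then show ?thesis by (simp add: exp_minus inverse_eq_divide frac_le)
        qed
        finally show ?thesis .
      qed
    qed (use p fV f(1) in \<open>auto simp: V_def\<close>)
    then show ?case by (simp add: cV M_def s_def x_def mult.commute)
  qed
qed

section \<open>Counting Ramsey numbers\<close>

lemma ramsey_number_3_le:
  assumes "2 \<le> n"
  shows "real (ramsey_number 3 n) \<le> 16 * real n ^ 2 / log 2 n + 1"
proof -
  have "\<not> ramsey_arrow (ramsey_number 3 n - 1) 3 n" using assms by (intro not_ramsey_arrow_pred) auto
  then have "real (ramsey_number 3 n - 1) * log 2 n \<le> 16 * real n ^ 2"
    using assms by (intro not_ramsey_arrow_3_bound) auto
  moreover have "0 < log 2 n" using assms by simp
  moreover have "real (ramsey_number 3 n - 1) = real (ramsey_number 3 n) - 1"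
    using ramsey_number_pos[of 3 n] by simp
  ultimately have "real (ramsey_number 3 n) - 1 \<le> 16 * real n ^ 2 / log 2 n"
    by (subst pos_le_divide_eq) auto
  then show ?thesis by linarith
qed

lemma inj_on_ramsey_number_3: "inj_on (ramsey_number 3) {1..}"
proof (rule strict_mono_on_imp_inj_on)
  have "ramsey_number 3 m < ramsey_number 3 n" if "m < n" "1 \<le> m" for m n
    using that
  proof (induction n)
    case (Suc n)
    then show ?case using ramsey_number_less_Suc[of 3 m] ramsey_number_less_Suc[of 3 n]
      by (cases "m = n") auto
  qed simp
  then show "strict_mono_on {1..} (ramsey_number 3)" by (intro strict_mono_onI) auto
qed

lemma finite_nontrivial_ramsey_le: "finite (real ` nontrivial_ramsey_numbers \<inter> {0..x})"
proof (rule finite_subset)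
  show "real ` nontrivial_ramsey_numbers \<inter> {0..x} \<subseteq> real ` {..nat \<lfloor>x\<rfloor>}"
    by (auto simp: le_nat_floor)
qed simp

text \<open>With \<open>n\<close> about \<open>sqrt (x * ln x) / 8\<close>, the bound
  \<open>ln n \<ge> 2 / 5 * ln x\<close> (the true ratio tends to \<open>1 / 2\<close>) gives
  \<open>r(3,n) \<le> 5 / 8 * x + 1 \<le> x\<close>, and r(3,3), ..., r(3,n) are distinct.\<close>

lemma ramsey_count_lower: "\<forall>\<^sub>F x in at_top. 1 / 16 * sqrt (x * ln x) \<le> real (ramsey_count x)"
proof -
  have "\<forall>\<^sub>F x::real in at_top. 2 / 5 * ln x \<le> ln (sqrt (x * ln x) / 8 - 1)" by real_asymp
  moreover have "\<forall>\<^sub>F x::real in at_top. 3 \<le> x" by (rule eventually_ge_at_top)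
  moreover have "\<forall>\<^sub>F x::real in at_top. 48 \<le> sqrt (x * ln x)" by real_asymp
  ultimately show ?thesis
  proof eventually_elim
    case (elim x)
    define z where "z = sqrt (x * ln x) / 8"
    define n where "n = nat \<lfloor>z\<rfloor>"
    have z: "6 \<le> z" using elim by (simp add: z_def)
    have ln_x: "0 < ln x" using elim(2) by simp
    have n: "real n \<le> z" "z - 1 < real n" using z unfolding n_def by linarith+
    then have n5: "5 < n" using z by linarith
    have "2 / 5 * ln x \<le> log 2 n"
    proof -
      have "2 / 5 * ln x \<le> ln (real n)"
        using elim(1) n z by (intro order_trans[OF elim(1)]) (simp add: z_def)
      also have "\<dots> \<le> ln (real n) / ln 2"
        using n5 ln_2_less_1 by (simp add: field_simps mult_left_le)
      finally show ?thesis by (simp add: log_def)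
    qed
    then have "16 * real n ^ 2 / log 2 n \<le> 16 * z ^ 2 / (2 / 5 * ln x)"
      using n n5 ln_x by (intro frac_le mult_left_mono power_mono) auto
    also have "z ^ 2 = x * ln x / 64" using elim(2) ln_x by (simp add: z_def power_divide)
    also have "16 * (x * ln x / 64) / (2 / 5 * ln x) = 5 / 8 * x" using ln_x by simp
    finally have rn: "real (ramsey_number 3 n) \<le> x"
      using ramsey_number_3_le[of n] n5 elim(2) by linarith
    have "real ` ramsey_number 3 ` {3..n} \<subseteq> real ` nontrivial_ramsey_numbers \<inter> {0..x}"
    proof clarify
      fix k assume k: "k \<in> {3..n}"
      then have "ramsey_number 3 k \<in> nontrivial_ramsey_numbers"
        by (auto simp: nontrivial_ramsey_numbers_def)
      moreover have "ramsey_number 3 k \<le> ramsey_number 3 n" using k by (intro ramsey_number_mono) auto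
      ultimately show "real (ramsey_number 3 k) \<in> real ` nontrivial_ramsey_numbers \<inter> {0..x}"
        using rn by simp
    qed
    then have "card (real ` ramsey_number 3 ` {3..n}) \<le> ramsey_count x"
      unfolding ramsey_count_def by (intro card_mono finite_nontrivial_ramsey_le)
    moreover have "card (real ` ramsey_number 3 ` {3..n}) = n - 2"
    proof -
      have "inj_on (ramsey_number 3) {3..n}" by (rule inj_on_subset[OF inj_on_ramsey_number_3]) auto
      then show ?thesis by (simp add: card_image)
    qed
    ultimately have "z - 3 \<le> real (ramsey_count x)" using n n5 by linarith
    \<comment> \<open>\<open>z - 3 \<ge> z / 2\<close> because \<open>z \<ge> 6\<close>, and
      \<open>z / 2\<close> is \<open>1 / 16\<close> of the root.\<close>
    then show ?case using z by (simp add: z_def)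
  qed
qed

text \<open>The lower bound on r(3,n) is known only along the sequence \<open>k b\<close>;
  monotonicity fills the gaps. From one term to the next \<open>k\<close> grows by at most
  \<open>64 * 2\<close>, the origin of the constant 128.\<close>

lemma card_ramsey_3_le: "\<forall>\<^sub>F x in at_top.
  finite {n. real (ramsey_number 3 n) \<le> x} \<and>
  real (card {n. real (ramsey_number 3 n) \<le> x}) \<le> 128 * 6 * 2 ^ 17 * sqrt (x * ln x)"
proof -
  define N where "N b = b * 2 ^ (12 * b)" for b :: nat
  define k where "k b = 6 * (2 ^ 17 * b * 2 ^ (6 * b))" for b :: nat
  obtain b0 where b0: "\<And>b. b0 \<le> b \<Longrightarrow> \<not> ramsey_arrow (N b) 3 (k b)"
    using eventually_not_ramsey_arrow_3 unfolding N_def k_def eventually_sequentially by blast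
  have N_mono: "N a \<le> N b" if "a \<le> b" for a b
    unfolding N_def using that by (intro mult_le_mono power_increasing) auto
  have N_ge: "b \<le> N b" for b unfolding N_def by simp
  show ?thesis
    using eventually_gt_at_top[of "real (N (Suc b0))"]
  proof eventually_elim
    case (elim x)
    \<comment> \<open>With \<open>b = Suc c\<close> this puts \<open>x\<close> between
      \<open>N c\<close> and \<open>N (Suc c)\<close>.\<close>
    define b where "b = (LEAST b. x \<le> real (N b))"
    have "x \<le> real (N (nat \<lceil>x\<rceil>))"
    proof -
      have "x \<le> real (nat \<lceil>x\<rceil>)" by linarith
      also have "\<dots> \<le> real (N (nat \<lceil>x\<rceil>))" using N_ge by (simp only: of_nat_le_iff)
      finally show ?thesis .
    qed
    then have xb: "x \<le> real (N b)" unfolding b_def by (rule LeastI)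
    have "\<not> b \<le> Suc b0"
    proof
      assume "b \<le> Suc b0"
      then have "real (N b) \<le> real (N (Suc b0))" using N_mono by (simp only: of_nat_le_iff)
      with xb elim show False by linarith
    qed
    then obtain c where c: "b = Suc c" "1 \<le> c" "b0 \<le> c" by (cases b) auto
    have xc: "real (N c) < x" using not_less_Least[of c "\<lambda>b. x \<le> real (N b)"] c(1) by (auto simp: b_def)
    have rb: "real (N b) < real (ramsey_number 3 (k b))"
      using less_ramsey_numberI[OF b0[of b]] c by simp
    have sub: "{n. real (ramsey_number 3 n) \<le> x} \<subseteq> {..<k b}"
    proof
      fix n assume n: "n \<in> {n. real (ramsey_number 3 n) \<le> x}"
      show "n \<in> {..<k b}"
      proof (rule ccontr)
        assume "n \<notin> {..<k b}"
        then have "real (ramsey_number 3 (k b)) \<le> real (ramsey_number 3 n)"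
          using ramsey_number_mono[of 3 3 "k b" n] by simp
        with n rb xb show False by simp
      qed
    qed
    then have fin: "finite {n. real (ramsey_number 3 n) \<le> x}" by (rule finite_subset) simp
    have "card {n. real (ramsey_number 3 n) \<le> x} \<le> card {..<k b}" using sub by (intro card_mono) auto
    also have "\<dots> = k b" by simp
    finally have "real (card {n. real (ramsey_number 3 n) \<le> x}) \<le> real (k b)" by (simp only: of_nat_le_iff)
    also have "\<dots> = 64 * 6 * 2 ^ 17 * (real (Suc c) * 64 ^ c)"
      by (simp add: k_def c(1) power_mult power_add)
    also have "\<dots> \<le> 64 * 6 * 2 ^ 17 * (2 * real c * 64 ^ c)"
      using c(2) by (intro mult_left_mono mult_right_mono) auto
    also have "\<dots> = 128 * 6 * 2 ^ 17 * (real c * 64 ^ c)" by simp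
    also have "\<dots> \<le> 128 * 6 * 2 ^ 17 * sqrt (x * ln x)"
    \<comment> \<open>The square of \<open>c * 64 ^ c\<close> is \<open>N c * c\<close>, and
      \<open>N c < x\<close> forces \<open>c \<le> ln x\<close>.\<close>
    proof (intro mult_left_mono real_le_rsqrt)
      have e: "exp (real c) \<le> 4096 ^ c"
      proof -
        have "exp (real c) = exp 1 ^ c" by (simp add: exp_of_nat_mult[symmetric])
        also have "\<dots> \<le> 4096 ^ c" using exp_le by (intro power_mono) auto
        finally show ?thesis .
      qed
      have Nc: "real (N c) = real c * 4096 ^ c" by (simp add: N_def power_mult)
      have "1 * 4096 ^ c \<le> real c * 4096 ^ c" using c(2) by (intro mult_right_mono) auto
      then have "exp (real c) \<le> x" using e xc Nc by linarith
      then have "real c \<le> ln x" using xc by (subst ln_ge_iff) auto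
      moreover have "real c * 4096 ^ c \<le> x" using xc Nc by linarith
      ultimately have "(real c * 4096 ^ c) * real c \<le> x * ln x"
        using xc by (intro mult_mono) auto
      moreover have "(real c * 64 ^ c) ^ 2 = (real c * 4096 ^ c) * real c"
        by (simp add: power2_eq_square power_mult_distrib[symmetric])
      ultimately show "(real c * 64 ^ c) ^ 2 \<le> x * ln x" by simp
    qed simp
    finally show ?case using fin by simp
  qed
qed

text \<open>The diagonal bound gives \<open>k < 2 * log 2 x + 3\<close>, and
  \<open>r(4,n) \<le> r(k,n)\<close> gives \<open>n < u ^ 19\<close> with \<open>u\<close> about
  \<open>x powr (1 / 40)\<close>. The product of these ranges is so small that counting pairs
  instead of values costs nothing.\<close>

lemma card_ramsey_ge_4_le: "\<forall>\<^sub>F x in at_top.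
  finite {(k,n). 4 \<le> k \<and> k \<le> n \<and> real (ramsey_number k n) \<le> x} \<and>
  real (card {(k,n). 4 \<le> k \<and> k \<le> n \<and> real (ramsey_number k n) \<le> x}) \<le> sqrt (x * ln x)"
proof -
  obtain u0 where u0: "\<And>u. u0 \<le> u \<Longrightarrow> \<not> ramsey_arrow (u ^ 40) 4 (u ^ 19)"
    using eventually_not_ramsey_arrow_4 unfolding eventually_sequentially by blast
  have "\<forall>\<^sub>F x::real in at_top. (2 * log 2 x + 4) * (x powr (1 / 40) + 1) ^ 19 \<le> sqrt (x * ln x)"
    by real_asymp
  moreover have "\<forall>\<^sub>F x::real in at_top. real u0 \<le> x powr (1 / 40)" by real_asymp
  moreover have "\<forall>\<^sub>F x::real in at_top. 1 \<le> x" by (rule eventually_ge_at_top)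
  ultimately show ?thesis
  proof eventually_elim
    case (elim x)
    define u where "u = nat \<lceil>x powr (1 / 40)\<rceil>"
    define K where "K = nat \<lceil>2 * log 2 x + 3\<rceil>"
    have u: "x powr (1 / 40) \<le> real u" "real u \<le> x powr (1 / 40) + 1"
      unfolding u_def using elim by (auto simp: of_nat_ceiling)
    have "u0 \<le> u" using elim(2) u(1) by linarith
    then have "u ^ 40 < ramsey_number 4 (u ^ 19)" by (intro less_ramsey_numberI u0)
    then have "real (u ^ 40) < real (ramsey_number 4 (u ^ 19))" by (simp only: of_nat_less_iff)
    moreover have "x \<le> real (u ^ 40)"
    proof -
      have "x = (x powr (1 / 40)) ^ 40" using elim(3) by (simp add: powr_power)
      also have "\<dots> \<le> real u ^ 40" using u(1) by (intro power_mono) auto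
      finally show ?thesis by simp
    qed
    ultimately have ru: "x < real (ramsey_number 4 (u ^ 19))" by linarith
    have lg: "0 \<le> log 2 x" using elim(3) by simp
    have K: "2 * log 2 x + 3 \<le> real K" "real K \<le> 2 * log 2 x + 4"
      unfolding K_def using lg by linarith+
    have sub: "{(k,n). 4 \<le> k \<and> k \<le> n \<and> real (ramsey_number k n) \<le> x} \<subseteq> {..<K} \<times> {..<u ^ 19}"
    proof clarify
      fix k n :: nat assume kn: "4 \<le> k" "k \<le> n" "real (ramsey_number k n) \<le> x"
      have "k < K"
      proof -
        have "2 ^ (k div 2 - 1) < ramsey_number k k"
          using kn(1) by (intro less_ramsey_numberI not_ramsey_arrow_diagonal)
        also have "\<dots> \<le> ramsey_number k n" using kn(2) by (intro ramsey_number_mono) auto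
        finally have "real (2 ^ (k div 2 - 1)) < real (ramsey_number k n)" by (simp only: of_nat_less_iff)
        then have "real (2 ^ (k div 2 - 1)) < x" using kn(3) by linarith
        then have "2 ^ (k div 2 - 1) < x" by simp
        then have "log 2 (2 ^ (k div 2 - 1)) < log 2 x" using elim(3) by (subst log_less_cancel_iff) auto
        then have "real (k div 2 - 1) < log 2 x" by simp
        \<comment> \<open>The 3 is 2 for the subtracted one and 1 for rounding in
          \<open>k div 2\<close>.\<close>
        moreover have "k \<le> 2 * (k div 2 - 1) + 3" using kn(1) by linarith
        ultimately have "real k < 2 * log 2 x + 3" by linarith
        then show ?thesis using K(1) by linarith
      qed
      moreover have "n < u ^ 19"
      proof (rule ccontr)
        assume "\<not> n < u ^ 19"
        then have "real (ramsey_number 4 (u ^ 19)) \<le> real (ramsey_number k n)"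
          using kn(1) ramsey_number_mono[of 4 k "u ^ 19" n] by simp
        with ru kn(3) show False by linarith
      qed
      ultimately show "k \<in> {..<K} \<and> n \<in> {..<u ^ 19}" by simp
    qed
    then have fin: "finite {(k,n). 4 \<le> k \<and> k \<le> n \<and> real (ramsey_number k n) \<le> x}"
      by (rule finite_subset) simp
    have "card {(k,n). 4 \<le> k \<and> k \<le> n \<and> real (ramsey_number k n) \<le> x} \<le> card ({..<K} \<times> {..<u ^ 19})"
      using sub by (intro card_mono) auto
    also have "\<dots> = K * u ^ 19" by (simp add: card_cartesian_product)
    finally have "real (card {(k,n). 4 \<le> k \<and> k \<le> n \<and> real (ramsey_number k n) \<le> x}) \<le> real (K * u ^ 19)"
      by (simp only: of_nat_le_iff)
    also have "\<dots> = real K * real u ^ 19" by simp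
    also have "\<dots> \<le> (2 * log 2 x + 4) * (x powr (1 / 40) + 1) ^ 19"
      using K u lg by (intro mult_mono power_mono) auto
    also have "\<dots> \<le> sqrt (x * ln x)" by (rule elim(1))
    finally show ?case using fin by simp
  qed
qed

lemma ramsey_count_upper: "\<forall>\<^sub>F x in at_top. real (ramsey_count x) \<le> (128 * 6 * 2 ^ 17 + 1) * sqrt (x * ln x)"
  using card_ramsey_3_le card_ramsey_ge_4_le
proof eventually_elim
  case (elim x)
  let ?A = "{n. real (ramsey_number 3 n) \<le> x}"
  let ?B = "{(k,n). 4 \<le> k \<and> k \<le> n \<and> real (ramsey_number k n) \<le> x}"
  let ?f = "\<lambda>n. real (ramsey_number 3 n)" and ?g = "\<lambda>(k,n). real (ramsey_number k n)"
  have "real ` nontrivial_ramsey_numbers \<inter> {0..x} \<subseteq> ?f ` ?A \<union> ?g ` ?B"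
  proof
    fix r assume "r \<in> real ` nontrivial_ramsey_numbers \<inter> {0..x}"
    then obtain k n where r: "r = real (ramsey_number k n)" "3 \<le> k" "k \<le> n" "r \<le> x"
      by (auto simp: nontrivial_ramsey_numbers_def)
    show "r \<in> ?f ` ?A \<union> ?g ` ?B"
    proof (cases "k = 3")
      case True
      with r have "r \<in> ?f ` ?A" by auto
      then show ?thesis ..
    next
      case False
      with r have "(k,n) \<in> ?B" by auto
      then have "?g (k,n) \<in> ?g ` ?B" by (rule imageI)
      then show ?thesis using r(1) by simp
    qed
  qed
  then have "ramsey_count x \<le> card (?f ` ?A \<union> ?g ` ?B)"
    unfolding ramsey_count_def using elim by (intro card_mono) auto
  also have "\<dots> \<le> card (?f ` ?A) + card (?g ` ?B)" by (rule card_Un_le)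
  also have "\<dots> \<le> card ?A + card ?B" using elim by (intro add_mono card_image_le) auto
  finally have "real (ramsey_count x) \<le> real (card ?A) + real (card ?B)" by (simp flip: of_nat_add)
  also have "\<dots> \<le> 128 * 6 * 2 ^ 17 * sqrt (x * ln x) + sqrt (x * ln x)"
    using elim by (intro add_mono) auto
  finally show ?case by (simp add: algebra_simps)
qed

theorem theorem2p3:
  shows "(\<lambda>x. real (ramsey_count x)) \<in> \<Theta>[at_top](\<lambda>x. sqrt (x * ln x)) \<and>
    (\<exists>C\<^sub>1 C\<^sub>2 X\<^sub>0 :: real. 0 < C\<^sub>1 \<and> C\<^sub>1 \<le> C\<^sub>2 \<and>
       (\<forall>x \<ge> X\<^sub>0. C\<^sub>1 * sqrt (x * ln x) \<le> real (ramsey_count x) \<and>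
                real (ramsey_count x) \<le> C\<^sub>2 * sqrt (x * ln x)))"
proof -
  define C\<^sub>1 C\<^sub>2 :: real where "C\<^sub>1 = 1 / 16" and "C\<^sub>2 = 128 * 6 * 2 ^ 17 + 1"
  have C: "0 < C\<^sub>1" "C\<^sub>1 \<le> C\<^sub>2" by (simp_all add: C\<^sub>1_def C\<^sub>2_def)
  have ev: "\<forall>\<^sub>F x in at_top. C\<^sub>1 * sqrt (x * ln x) \<le> real (ramsey_count x) \<and>
      real (ramsey_count x) \<le> C\<^sub>2 * sqrt (x * ln x)"
    using ramsey_count_lower ramsey_count_upper unfolding C\<^sub>1_def C\<^sub>2_def by (rule eventually_conj)
  have "\<forall>\<^sub>F x::real in at_top. 0 \<le> sqrt (x * ln x)" by real_asymp
  with ev have "\<forall>\<^sub>F x in at_top. C\<^sub>1 * norm (sqrt (x * ln x)) \<le> norm (real (ramsey_count x)) \<and>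
      norm (real (ramsey_count x)) \<le> C\<^sub>2 * norm (sqrt (x * ln x))"
    by eventually_elim simp
  then have "(\<lambda>x. real (ramsey_count x)) \<in> \<Theta>[at_top](\<lambda>x. sqrt (x * ln x))"
    using C by (intro bigthetaI'[of C\<^sub>1 C\<^sub>2]) auto
  moreover obtain X\<^sub>0 where "\<forall>x\<ge>X\<^sub>0. C\<^sub>1 * sqrt (x * ln x) \<le> real (ramsey_count x) \<and>
      real (ramsey_count x) \<le> C\<^sub>2 * sqrt (x * ln x)"
    using ev unfolding eventually_at_top_linorder by blast
  ultimately show ?thesis using C by blast
qed

end
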